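(* Let $N\ge 3$, $0<\mu<2$ and $\alpha>0$, and let $\mathcal G$ be the star graph made of $N$ halflines intersecting one another at the vertex $\textsc v$. Let $\omega>\alpha^2/N^2$, let $\Psi_\omega$ be the unique positive bound state of frequency $\omega$, symmetric under exchange of edges, of the Schrödinger equation $i\partial_t\Psi=H\Psi-|\Psi|^{2\mu}\Psi$ on $\mathcal G$ with delta interaction of strength $-\alpha$ at $\textsc v$, and let $M=\|\Psi_\omega\|_{L^2(\mathcal G)}^2$. Then $\Psi_\omega$ is a strict (up to phase invariance) local minimizer of the energy functional $$E(\Psi,\mathcal G)=\frac12\|\Psi'\|_{L^2(\mathcal G)}^2-\frac1{2\mu+2}\|\Psi\|_{L^{2\mu+2}(\mathcal G)}^{2\mu+2}-\frac\alpha2|\Psi(\textsc v)|^2$$ constrained to $H^1_M(\mathcal G)=\{\Psi\in H^1(\mathcal G):\ \|\Psi\|^2_{L^2(\mathcal G)}=M\}$; that is, there exists $\delta>0$ such that every $\Phi\in H^1_M(\mathcal G)$ with $\|\Phi-\Psi_\omega\|_{H^1(\mathcal G)}<\delta$ satisfies $E(\Phi,\mathcal G)\ge E(\Psi_\omega,\mathcal G)$, with equality if and only if $\Phi=e^{i\theta}\Psi_\omega$ for some $\theta\in\mathbb R$.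
   Context: Star graph: $\mathcal G$ consists of $N$ halflines, each identified with $[0,+\infty)$ with coordinate $x_j$, glued at their origins at the vertex $\textsc v$ ($x_j=0$ for all $j$). A function $\Psi:\mathcal G\to\mathbb C$ is a vector $(\psi_1,\dots,\psi_N)$ with $\psi_j:[0,+\infty)\to\mathbb C$; $\Psi'$ is the vector with components $\psi_j'$. $L^p(\mathcal G)$ is the direct sum of $N$ copies of $L^p(0,+\infty)$; $H^1(\mathcal G)$ is the set of $\Psi$ with all $\psi_j\in H^1(0,+\infty)$ and $\psi_1(0)=\dots=\psi_N(0)=:\Psi(\textsc v)$, with norm $\|\Psi\|_{H^1(\mathcal G)}^2=\sum_j\|\psi_j\|_{H^1(0,\infty)}^2$. The expression $|\Psi|^{2\mu}\Psi$ is understood componentwise. Operator: $H$ has domain $D(H)=\{\Psi\in H^1(\mathcal G):\ \psi_j\in H^2(0,+\infty)\ \forall j,\ \sum_{j=1}^N\psi_j'(0)=-\alpha\Psi(\textsc v)\}$ and acts as $(H\Psi)_j=-\psi_j''$. Symmetric bound state: for $\omega>0$ let $\phi_\omega(x)=[(\mu+1)\omega]^{\frac1{2\mu}}\operatorname{sech}^{\frac1\mu}(\mu\sqrt\omega\,x)$. For $\omega>\alpha^2/N^2$, $\Psi_\omega$ is given by $(\Psi_\omega)_j(x_j)=\phi_\omega(x_j+\zeta)$, $j=1,\dots,N$, with $\zeta=\frac1{\mu\sqrt\omega}\operatorname{arctanh}\left(\frac{\alpha}{N\sqrt\omega}\right)$. It is the unique positive stationary solution with frequency $\omega$ that is symmetric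 under exchange of edges (all components coincide), i.e. $\Psi_\omega\in D(H)$ and $H\Psi_\omega-|\Psi_\omega|^{2\mu}\Psi_\omega=-\omega\Psi_\omega$ (known result). *)

theory Defs
  imports "HOL-Analysis.Analysis"
begin

text \<open>
  Functions on a halfline are total functions \<^typ>\<open>real \<Rightarrow> complex\<close>; only their values on
  \<open>[0, \<infinity>)\<close> matter. The edges of the star graph are \<open>1, \<dots>, N\<close>, so a function on the graph has
  type \<^typ>\<open>nat \<Rightarrow> real \<Rightarrow> complex\<close>; only the components with index in \<open>{1..N}\<close> matter.
\<close>

section \<open>Sobolev spaces on the halfline\<close>

definition halfline_L2 :: "(real \<Rightarrow> complex) \<Rightarrow> bool" where
  "halfline_L2 f \<longleftrightarrow> set_borel_measurable lborel {0<..} f \<and>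
     set_integrable lborel {0<..} (\<lambda>x. norm (f x) ^ 2)"

text \<open>Test functions are of class \<open>C\<^sup>1\<close> with compact support in the open halfline, extended by
  zero to the real line; \<open>p'\<close> is the derivative of \<open>p\<close>. On square integrable functions, \<open>C\<^sup>1\<close> and
  \<open>C\<^sup>\<infinity>\<close> test functions yield the same weak derivative.\<close>

definition test_function :: "(real \<Rightarrow> real) \<Rightarrow> (real \<Rightarrow> real) \<Rightarrow> bool" where
  "test_function p p' \<longleftrightarrow> (\<forall>x. (p has_real_derivative p' x) (at x)) \<and> continuous_on UNIV p' \<and>
     (\<exists>a b. 0 < a \<and> a < b \<and> (\<forall>x. x \<notin> {a..b} \<longrightarrow> p x = 0))"

definition has_weak_deriv :: "(real \<Rightarrow> complex) \<Rightarrow> (real \<Rightarrow> complex) \<Rightarrow> bool" where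
  "has_weak_deriv f g \<longleftrightarrow> halfline_L2 f \<and> halfline_L2 g \<and>
     (\<forall>p p'. test_function p p' \<longrightarrow>
        (LINT x:{0<..}|lborel. p' x *\<^sub>R f x) = - (LINT x:{0<..}|lborel. p x *\<^sub>R g x))"

text \<open>The square integrable weak derivative, if there is one. It is unique up to a null set
  (\<open>has_weak_deriv_unique\<close> below), hence may only be used where null sets do not matter.\<close>

definition weak_deriv :: "(real \<Rightarrow> complex) \<Rightarrow> (real \<Rightarrow> complex)" where
  "weak_deriv f = (SOME g. has_weak_deriv f g)"

text \<open>An element of \<open>H\<^sup>1(0, \<infinity>)\<close> is represented by its continuous representative, for which point
  values make sense.\<close>

definition halfline_H1 :: "(real \<Rightarrow> complex) \<Rightarrow> bool" where
  "halfline_H1 f \<longleftrightarrow> continuous_on {0..} f \<and> (\<exists>g. has_weak_deriv f g)"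

definition halfline_H2 :: "(real \<Rightarrow> complex) \<Rightarrow> bool" where
  "halfline_H2 f \<longleftrightarrow> halfline_H1 f \<and> (\<exists>g. has_weak_deriv f g \<and> halfline_H1 g)"


section \<open>Function spaces on the star graph\<close>

definition graph_Lp_norm :: "nat \<Rightarrow> real \<Rightarrow> (nat \<Rightarrow> real \<Rightarrow> complex) \<Rightarrow> real" where
  "graph_Lp_norm N r \<Psi> =
     (\<Sum>j=1..N. LINT x:{0<..}|lborel. norm (\<Psi> j x) powr r) powr (1 / r)"

definition graph_deriv :: "(nat \<Rightarrow> real \<Rightarrow> complex) \<Rightarrow> (nat \<Rightarrow> real \<Rightarrow> complex)" where
  "graph_deriv \<Psi> = (\<lambda>j. weak_deriv (\<Psi> j))"

text \<open>By continuity at the vertex, any edge can be used to evaluate an \<open>H\<^sup>1\<close> function there.\<close>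

definition vertex_value :: "(nat \<Rightarrow> real \<Rightarrow> complex) \<Rightarrow> complex" where
  "vertex_value \<Psi> = \<Psi> 1 0"

definition graph_H1 :: "nat \<Rightarrow> (nat \<Rightarrow> real \<Rightarrow> complex) set" where
  "graph_H1 N = {\<Psi>. (\<forall>j\<in>{1..N}. halfline_H1 (\<Psi> j)) \<and>
                     (\<forall>j\<in>{1..N}. \<Psi> j 0 = vertex_value \<Psi>)}"

definition graph_H1_norm :: "nat \<Rightarrow> (nat \<Rightarrow> real \<Rightarrow> complex) \<Rightarrow> real" where
  "graph_H1_norm N \<Psi> =
     sqrt ((graph_Lp_norm N 2 \<Psi>)\<^sup>2 + (graph_Lp_norm N 2 (graph_deriv \<Psi>))\<^sup>2)"

definition graph_H1_mass :: "nat \<Rightarrow> real \<Rightarrow> (nat \<Rightarrow> real \<Rightarrow> complex) set" where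
  "graph_H1_mass N M = {\<Psi> \<in> graph_H1 N. (graph_Lp_norm N 2 \<Psi>)\<^sup>2 = M}"

definition energy :: "nat \<Rightarrow> real \<Rightarrow> real \<Rightarrow> (nat \<Rightarrow> real \<Rightarrow> complex) \<Rightarrow> real" where
  "energy N \<mu> \<alpha> \<Psi> =
     1 / 2 * (graph_Lp_norm N 2 (graph_deriv \<Psi>))\<^sup>2
     - 1 / (2 * \<mu> + 2) * graph_Lp_norm N (2 * \<mu> + 2) \<Psi> powr (2 * \<mu> + 2)
     - \<alpha> / 2 * (norm (vertex_value \<Psi>))\<^sup>2"


section \<open>The Hamiltonian and the symmetric bound state\<close>

text \<open>Functions in \<open>H\<^sup>2(0, \<infinity>)\<close> are continuously differentiable up to the origin, so that the
  one-sided classical derivative is the boundary value of the derivative.\<close>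

definition hamiltonian_domain :: "nat \<Rightarrow> real \<Rightarrow> (nat \<Rightarrow> real \<Rightarrow> complex) set" where
  "hamiltonian_domain N \<alpha> = {\<Psi> \<in> graph_H1 N. (\<forall>j\<in>{1..N}. halfline_H2 (\<Psi> j)) \<and>
     (\<Sum>j=1..N. vector_derivative (\<Psi> j) (at 0 within {0..})) =
       - complex_of_real \<alpha> * vertex_value \<Psi>}"

definition hamiltonian :: "(nat \<Rightarrow> real \<Rightarrow> complex) \<Rightarrow> (nat \<Rightarrow> real \<Rightarrow> complex)" where
  "hamiltonian \<Psi> = (\<lambda>j x. - weak_deriv (weak_deriv (\<Psi> j)) x)"

definition stationary_state ::
  "nat \<Rightarrow> real \<Rightarrow> real \<Rightarrow> real \<Rightarrow> (nat \<Rightarrow> real \<Rightarrow> complex) \<Rightarrow> bool" where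
  "stationary_state N \<mu> \<alpha> \<omega> \<Psi> \<longleftrightarrow> \<Psi> \<in> hamiltonian_domain N \<alpha> \<and>
     (\<forall>j\<in>{1..N}. AE x in lborel. 0 < x \<longrightarrow>
        hamiltonian \<Psi> j x - complex_of_real (norm (\<Psi> j x) powr (2 * \<mu>)) * \<Psi> j x =
        - complex_of_real \<omega> * \<Psi> j x)"

definition soliton :: "real \<Rightarrow> real \<Rightarrow> real \<Rightarrow> real" where
  "soliton \<mu> \<omega> x =
     ((\<mu> + 1) * \<omega>) powr (1 / (2 * \<mu>)) * (1 / cosh (\<mu> * sqrt \<omega> * x)) powr (1 / \<mu>)"

definition soliton_shift :: "nat \<Rightarrow> real \<Rightarrow> real \<Rightarrow> real \<Rightarrow> real" where
  "soliton_shift N \<mu> \<alpha> \<omega> = 1 / (\<mu> * sqrt \<omega>) * artanh (\<alpha> / (real N * sqrt \<omega>))"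

definition symmetric_bound_state ::
  "nat \<Rightarrow> real \<Rightarrow> real \<Rightarrow> real \<Rightarrow> nat \<Rightarrow> real \<Rightarrow> complex" where
  "symmetric_bound_state N \<mu> \<alpha> \<omega> =
     (\<lambda>j x. complex_of_real (soliton \<mu> \<omega> (x + soliton_shift N \<mu> \<alpha> \<omega>)))"


section \<open>Uniqueness of the weak derivative\<close>

lemma set_int_bounded:
  fixes g :: "real \<Rightarrow> complex"
  assumes "halfline_L2 g" "0 < a"
  shows "set_integrable lborel {a<..<b} g"
proof -
  have m: "(\<lambda>x. indicator {0<..} x *\<^sub>R g x) \<in> borel_measurable lborel"
    and i: "set_integrable lborel {0<..} (\<lambda>x. norm (g x) ^ 2)"
    using assms by (auto simp: halfline_L2_def set_borel_measurable_def)
  have eq: "(\<lambda>x. indicator {a<..<b} x *\<^sub>R g x) = (\<lambda>x. indicator {a<..<b} x *\<^sub>R (indicator {0<..} x *\<^sub>R g x))"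
    using assms(2) by (auto simp: indicator_def fun_eq_iff)
  have "set_integrable lborel {a<..<b} (\<lambda>x. 1 + norm (g x) ^ 2)"
  proof (rule set_integral_add)
    show "set_integrable lborel {a<..<b} (\<lambda>x. 1::real)"
      by (simp add: set_integrable_def)
        (rule integrable_real_indicator, simp, cases "a \<le> b", simp_all)
    show "set_integrable lborel {a<..<b} (\<lambda>x. norm (g x) ^ 2)"
      by (rule set_integrable_subset[OF i]) (use assms(2) in auto)
  qed
  then show ?thesis unfolding set_integrable_def
  proof (rule Bochner_Integration.integrable_bound)
    show "(\<lambda>x. indicator {a<..<b} x *\<^sub>R g x) \<in> borel_measurable lborel"
      unfolding eq using m by measurable
    have "t \<le> 1 + t\<^sup>2" for t :: real
      using zero_le_power2[of "t - 1/2"] by (simp add: power2_eq_square algebra_simps)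
    then show "AE x in lborel. norm (indicat_real {a<..<b} x *\<^sub>R g x)
       \<le> norm (indicat_real {a<..<b} x *\<^sub>R (1 + (cmod (g x))\<^sup>2))"
      by (auto simp: indicator_def abs_of_nonneg)
  qed
qed

lemma test_function_integrable:
  assumes t: "test_function p p'" and g: "halfline_L2 g"
  shows "set_integrable lborel {0<..} (\<lambda>x. p x *\<^sub>R g x)"
proof -
  from t obtain a b where ab: "0 < a" "a < b" and s: "\<And>x. x \<notin> {a..b} \<Longrightarrow> p x = 0"
    unfolding test_function_def by blast
  have cp: "continuous_on UNIV p"
    using t unfolding test_function_def
    by (meson DERIV_isCont continuous_at_imp_continuous_on)
  then have "compact (p ` {a..b})"
    by (intro compact_continuous_image) (auto intro: continuous_on_subset)
  then have "bounded (p ` {a..b})" by (rule compact_imp_bounded)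
  then obtain B where "\<forall>y\<in>p ` {a..b}. norm y \<le> B" unfolding bounded_iff ..
  then have B: "norm (p x) \<le> B" if "x \<in> {a..b}" for x
    using that by simp
  have B0: "0 \<le> B"
    using B[of a] ab norm_ge_zero[of "p a"] by (meson atLeastAtMost_iff order.refl order.trans less_imp_le)
  have B': "norm (p x) \<le> B" for x
  proof (cases "x \<in> {a..b}")
    case True then show ?thesis by (rule B)
  next
    case False then show ?thesis using s[OF False] B0 by simp
  qed
  have i: "set_integrable lborel {a/2<..<b+1} g"
    by (rule set_int_bounded[OF g]) (use ab in auto)
  have m: "(\<lambda>x. indicator {a/2<..<b+1} x *\<^sub>R g x) \<in> borel_measurable lborel"
    using i unfolding set_integrable_def by (rule borel_measurable_integrable)
  have eq: "(\<lambda>x. indicator {0<..} x *\<^sub>R p x *\<^sub>R g x) = (\<lambda>x. p x *\<^sub>R (indicator {a/2<..<b+1} x *\<^sub>R g x))"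
    proof
    fix x
    show "indicator {0<..} x *\<^sub>R p x *\<^sub>R g x = p x *\<^sub>R (indicator {a/2<..<b+1} x *\<^sub>R g x)"
      using s[of x] ab by (cases "x \<in> {a..b}") (auto simp: indicator_def)
  qed
  have "integrable lborel (\<lambda>x. B * norm (indicator {a/2<..<b+1} x *\<^sub>R g x))"
    using i unfolding set_integrable_def by (intro integrable_mult_right integrable_norm)
  then show ?thesis unfolding set_integrable_def eq
  proof (rule Bochner_Integration.integrable_bound)
    show "(\<lambda>x. p x *\<^sub>R indicat_real {a / 2<..<b + 1} x *\<^sub>R g x) \<in> borel_measurable lborel"
      by (rule borel_measurable_scaleR[OF _ m]) (simp add: borel_measurable_continuous_onI[OF cp])
    show "AE x in lborel. norm (p x *\<^sub>R indicat_real {a / 2<..<b + 1} x *\<^sub>R g x)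
         \<le> norm (B * cmod (indicat_real {a / 2<..<b + 1} x *\<^sub>R g x))"
    proof (rule AE_I2)
      fix x
      have "\<bar>p x\<bar> \<le> \<bar>B\<bar>" using B'[of x] by simp
      then show "norm (p x *\<^sub>R indicat_real {a / 2<..<b + 1} x *\<^sub>R g x)
         \<le> norm (B * cmod (indicat_real {a / 2<..<b + 1} x *\<^sub>R g x))"
        by (cases "x \<in> {a / 2<..<b + 1}") (auto simp: abs_mult intro: mult_right_mono)
    qed
  qed
qed

lemma test_function_pos_part:
  fixes a b n :: real
  assumes "0 < a" "a < b" "0 \<le> n"
  defines "m \<equiv> \<lambda>x. max 0 ((x - a) * (b - x))"
  shows "test_function (\<lambda>x. n * (m x)\<^sup>2 / (1 + n * (m x)\<^sup>2))
     (\<lambda>x. n * (2 * m x * (a + b - 2 * x)) / (1 + n * (m x)\<^sup>2)\<^sup>2)"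
proof -
  have pos: "1 + n * (m x)\<^sup>2 \<noteq> 0" for x
    using assms(3) by (smt (verit) mult_nonneg_nonneg zero_le_power2)
  have sq: "((\<lambda>t::real. (max 0 t)\<^sup>2) has_real_derivative 2 * max 0 t) (at t)" for t
  proof -
    consider "t < 0" | "t > 0" | "t = 0" by linarith
    then show ?thesis
    proof cases
      case 1
      have "((\<lambda>t::real. 0) has_real_derivative 2 * max 0 t) (at t)" using 1 by simp
      then show ?thesis
        by (rule has_field_derivative_transform_within_open[where S="{..<0}"]) (use 1 in auto)
    next
      case 2
      have "((\<lambda>t::real. t\<^sup>2) has_real_derivative 2 * max 0 t) (at t)"
        using 2 by (auto intro!: derivative_eq_intros)
      then show ?thesis
        by (rule has_field_derivative_transform_within_open[where S="{0<..}"]) (use 2 in auto)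
    next
      case 3
      have l: "((\<lambda>h::real. \<bar>h\<bar>) \<longlongrightarrow> 0) (at 0)" by (auto intro!: tendsto_eq_intros)
      have "((\<lambda>h::real. ((max 0 (0 + h))\<^sup>2 - (max 0 0)\<^sup>2) / h) \<longlongrightarrow> 0) (at 0)"
        by (rule Lim_null_comparison[OF _ l])
           (auto intro!: always_eventually simp: max_def power2_eq_square)
      then show ?thesis using 3 by (simp add: DERIV_def)
    qed
  qed
  have M: "((\<lambda>x. (m x)\<^sup>2) has_real_derivative 2 * m x * (a + b - 2 * x)) (at x)" for x
    unfolding m_def
    by (rule DERIV_chain2[OF sq]) (auto intro!: derivative_eq_intros simp: algebra_simps)
  have cm: "continuous_on UNIV m" unfolding m_def by (intro continuous_intros)
  have "m x = 0" if "x \<notin> {a..b}" for x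
    using that assms(2) unfolding m_def by (auto simp: max_def zero_le_mult_iff)
  moreover have "((\<lambda>x. n * (m x)\<^sup>2 / (1 + n * (m x)\<^sup>2)) has_real_derivative
      n * (2 * m x * (a + b - 2 * x)) / (1 + n * (m x)\<^sup>2)\<^sup>2) (at x)" for x
    by (rule derivative_eq_intros M refl pos)+
       (simp add: pos field_simps power2_eq_square)
  moreover have "continuous_on UNIV (\<lambda>x. n * (2 * m x * (a + b - 2 * x)) / (1 + n * (m x)\<^sup>2)\<^sup>2)"
    by (intro continuous_intros cm ballI) (simp add: pos)
  ultimately show ?thesis unfolding test_function_def using assms(1,2) by auto
qed


lemma interval_integral_zero:
  fixes d :: "real \<Rightarrow> complex"
  assumes d: "halfline_L2 d" and ab: "0 < a" "a < b"
    and z: "\<And>p p'. test_function p p' \<Longrightarrow> (LINT x:{0<..}|lborel. p x *\<^sub>R d x) = 0"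
  shows "(LINT x:{a<..<b}|lborel. d x) = 0"
proof -
  define m where "m = (\<lambda>x. max 0 ((x - a) * (b - x)))"
  define q where "q = (\<lambda>(n::nat) x. real n * (m x)\<^sup>2 / (1 + real n * (m x)\<^sup>2))"
  have tq: "\<exists>p'. test_function (q n) p'" for n
    unfolding q_def m_def by (rule exI, rule test_function_pos_part) (use ab in auto)
  have i: "set_integrable lborel {a<..<b} d" by (rule set_int_bounded[OF d ab(1)])
  have m0: "m x = 0" if "x \<notin> {a<..<b}" for x
    using that ab unfolding m_def by (auto simp: max_def zero_le_mult_iff)
  have mpos: "m x > 0" if "x \<in> {a<..<b}" for x
    using that unfolding m_def by (auto simp: max_def zero_less_mult_iff not_less)
  have q01: "0 \<le> q n x" "q n x \<le> 1" for n x
    unfolding q_def by (auto simp: divide_le_eq_1 add_pos_nonneg)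
  have ql: "(\<lambda>n. q n x) \<longlonglongrightarrow> 1" if "x \<in> {a<..<b}" for x
  proof -
    define c where "c = (m x)\<^sup>2"
    have c: "c > 0" using mpos[OF that] by (simp add: c_def)
    have "filterlim (\<lambda>n. real n * c) at_top sequentially"
      by (rule filterlim_at_top_mult_tendsto_pos[OF tendsto_const c filterlim_real_sequentially])
    then have "filterlim (\<lambda>n. 1 + real n * c) at_top sequentially"
      by (rule filterlim_tendsto_add_at_top[OF tendsto_const])
    then have "(\<lambda>n. 1 - inverse (1 + real n * c)) \<longlonglongrightarrow> 1 - 0"
      by (intro tendsto_intros tendsto_inverse_0_at_top)
    moreover have "1 - inverse (1 + real n * c) = q n x" for n
    proof -
      have "1 + real n * c > 0" using c by (simp add: add_pos_nonneg)
      then show ?thesis unfolding q_def c_def by (simp add: field_simps)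
    qed
    ultimately show ?thesis by simp
  qed
  have "(\<lambda>n. LINT x|lborel. indicator {0<..} x *\<^sub>R q n x *\<^sub>R d x)
      \<longlonglongrightarrow> (LINT x|lborel. indicator {a<..<b} x *\<^sub>R d x)"
  proof (rule integral_dominated_convergence[where w="\<lambda>x. norm (indicator {a<..<b} x *\<^sub>R d x)"])
    show "(\<lambda>x. indicat_real {a<..<b} x *\<^sub>R d x) \<in> borel_measurable lborel"
      using i unfolding set_integrable_def by (rule borel_measurable_integrable)
    show "(\<lambda>x. indicat_real {0<..} x *\<^sub>R q n x *\<^sub>R d x) \<in> borel_measurable lborel" for n
      using tq[of n] test_function_integrable[OF _ d] unfolding set_integrable_def
      by (metis borel_measurable_integrable)
    show "integrable lborel (\<lambda>x. norm (indicat_real {a<..<b} x *\<^sub>R d x))"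
      using i unfolding set_integrable_def by (rule integrable_norm)
    show "AE x in lborel. (\<lambda>n. indicat_real {0<..} x *\<^sub>R q n x *\<^sub>R d x)
        \<longlonglongrightarrow> indicat_real {a<..<b} x *\<^sub>R d x"
    proof (rule AE_I2)
      fix x
      show "(\<lambda>n. indicat_real {0<..} x *\<^sub>R q n x *\<^sub>R d x) \<longlonglongrightarrow> indicat_real {a<..<b} x *\<^sub>R d x"
      proof (cases "x \<in> {a<..<b}")
        case True
        then have "(\<lambda>n. q n x *\<^sub>R d x) \<longlonglongrightarrow> 1 *\<^sub>R d x" by (intro tendsto_intros ql)
        with True ab show ?thesis by simp
      next
        case False
        then show ?thesis using m0[OF False] by (simp add: q_def)
      qed
    qed
    show "AE x in lborel. norm (indicat_real {0<..} x *\<^sub>R q n x *\<^sub>R d x)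
        \<le> norm (indicat_real {a<..<b} x *\<^sub>R d x)" for n
    proof (rule AE_I2)
      fix x
      show "norm (indicat_real {0<..} x *\<^sub>R q n x *\<^sub>R d x) \<le> norm (indicat_real {a<..<b} x *\<^sub>R d x)"
      proof (cases "x \<in> {a<..<b}")
        case True
        then show ?thesis using q01[of n x] ab by (simp add: mult_left_le_one_le)
      next
        case False
        then show ?thesis using m0[OF False] by (simp add: q_def)
      qed
    qed
  qed
  moreover have "(LINT x|lborel. indicator {0<..} x *\<^sub>R q n x *\<^sub>R d x) = 0" for n
    using tq[of n] z unfolding set_lebesgue_integral_def by blast
  ultimately show ?thesis
    unfolding set_lebesgue_integral_def by (simp add: LIMSEQ_const_iff)
qed

lemma interval_integral_zero_imp_AE:
  fixes d :: "real \<Rightarrow> complex"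
  assumes d: "halfline_L2 d"
    and z: "\<And>a b. 0 < a \<Longrightarrow> a < b \<Longrightarrow> (LINT x:{a<..<b}|lborel. d x) = 0"
  shows "AE x in lborel. 0 < x \<longrightarrow> d x = 0"
proof -
  have main: "AE x in lborel. indicator {a<..<b} x *\<^sub>R d x = 0" if a: "0 < a" for a b
  proof (rule sigma_finite_measure.density_zero[OF lborel.sigma_finite_measure_axioms])
    let ?I = "{a<..<b}"
    have i: "set_integrable lborel ?I d" by (rule set_int_bounded[OF d a])
    then show i': "integrable lborel (\<lambda>x. indicator ?I x *\<^sub>R d x)"
      unfolding set_integrable_def .
    let ?P = "\<lambda>A. (LINT x:A|lborel. indicator ?I x *\<^sub>R d x) = 0"
    have si: "set_integrable lborel A (\<lambda>x. indicator ?I x *\<^sub>R d x)" if "A \<in> sets borel" for A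
      unfolding set_integrable_def by (rule integrable_mult_indicator[OF _ i']) (use that in simp)
    let ?G = "range (\<lambda>(u, v). {u<..<v::real})"
    have borel_eq: "(borel :: real measure) = sigma UNIV ?G"
      by (simp add: borel_eq_box box_real)
    fix A :: "real set" assume "A \<in> sets lborel"
    then have A: "A \<in> sigma_sets UNIV ?G"
      by (simp add: borel_eq)
    have G: "B \<in> sets borel" if "B \<in> sigma_sets UNIV ?G" for B
      using that by (simp add: borel_eq)
    have basic: "?P {u<..<v}" for u v
    proof -
      have "(LINT x:{u<..<v}|lborel. indicator ?I x *\<^sub>R d x) = (LINT x:{max a u<..<min b v}|lborel. d x)"
        unfolding set_lebesgue_integral_def
        by (intro Bochner_Integration.integral_cong) (auto simp: indicator_def)
      also have "\<dots> = 0"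
      proof (cases "max a u < min b v")
        case True then show ?thesis by (intro z) (use a in auto)
      next
        case False
        then have "{max a u<..<min b v} = {}" by (intro greaterThanLessThan_empty) (simp only: not_less)
        then show ?thesis by (simp add: set_lebesgue_integral_def)
      qed
      finally show ?thesis .
    qed
    have U: "?P UNIV"
    proof -
      have "(LINT x:UNIV|lborel. indicator ?I x *\<^sub>R d x) = (LINT x:?I|lborel. indicator ?I x *\<^sub>R d x)"
        unfolding set_lebesgue_integral_def
        by (intro Bochner_Integration.integral_cong refl) (simp split: split_indicator)
      then show ?thesis using basic[of a b] by simp
    qed
    have "Int_stable ?G"
    proof (rule Int_stableI)
      fix X Y assume "X \<in> ?G" "Y \<in> ?G"
      then obtain u v u' v' where "X = {u<..<v}" "Y = {u'<..<v'}" by auto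
      then have "X \<inter> Y = {max u u'<..<min v v'}" by auto
      then show "X \<inter> Y \<in> ?G" by auto
    qed
    moreover have "?G \<subseteq> Pow UNIV" by simp
    ultimately show "?P A" using A
    proof (induction rule: sigma_sets_induct_disjoint)
      case (basic A) then show ?case using \<open>\<And>u v. ?P {u<..<v}\<close> by auto
    next
      case empty show ?case by (simp add: set_lebesgue_integral_def)
    next
      case (compl A)
      then have A: "A \<in> sets borel" using G by blast
      have "(LINT x:A \<union> (UNIV - A)|lborel. indicator ?I x *\<^sub>R d x) =
         (LINT x:A|lborel. indicator ?I x *\<^sub>R d x) + (LINT x:UNIV - A|lborel. indicator ?I x *\<^sub>R d x)"
        by (rule set_integral_Un) (use A in \<open>auto intro: si\<close>)
      then show ?case using compl U by simp
    next
      case (union A)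
      have "(LINT x:(\<Union>i. A i)|lborel. indicator ?I x *\<^sub>R d x) =
         (\<Sum>i. (LINT x:A i|lborel. indicator ?I x *\<^sub>R d x))"
      proof (rule lebesgue_integral_countable_add)
        have b: "A i \<in> sets borel" for i using union(2) G by blast
        then show "A i \<in> sets lborel" for i by simp
        show "A i \<inter> A j = {}" if "i \<noteq> j" for i j
          using union(1) that by (auto simp: disjoint_family_on_def)
        show "set_integrable lborel (\<Union>i. A i) (\<lambda>x. indicator ?I x *\<^sub>R d x)"
          using b by (intro si sets.countable_UN) auto
      qed
      then show ?case using union(3) by simp
    qed
  qed
  have "AE x in lborel. \<forall>n::nat. indicator {1 / real (Suc n)<..<real n} x *\<^sub>R d x = 0"
    unfolding AE_all_countable by (intro allI main) simp
  then show ?thesis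
  proof (eventually_elim, intro impI)
    fix x :: real
    assume *: "\<forall>n::nat. indicator {1 / real (Suc n)<..<real n} x *\<^sub>R d x = 0" and x: "0 < x"
    obtain n1 where n1: "inverse (real (Suc n1)) < x" using reals_Archimedean[OF x] by blast
    obtain n2 where n2: "x < real n2" using reals_Archimedean2 by blast
    define n where "n = max n1 n2"
    have "inverse (real (Suc n)) \<le> inverse (real (Suc n1))" by (simp add: n_def)
    then have "1 / real (Suc n) < x" using n1 by (simp add: inverse_eq_divide)
    moreover have "x < real n" using n2 by (simp add: n_def less_max_iff_disj)
    ultimately show "d x = 0" using *[rule_format, of n] by simp
  qed
qed

lemma halfline_L2_diff:
  assumes "halfline_L2 f" "halfline_L2 g"
  shows "halfline_L2 (\<lambda>x. f x - g x)"
proof -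
  have mf: "(\<lambda>x. indicator {0<..} x *\<^sub>R f x) \<in> borel_measurable lborel"
    and mg: "(\<lambda>x. indicator {0<..} x *\<^sub>R g x) \<in> borel_measurable lborel"
    and i: "set_integrable lborel {0<..} (\<lambda>x. norm (f x) ^ 2)"
    "set_integrable lborel {0<..} (\<lambda>x. norm (g x) ^ 2)"
    using assms by (auto simp: halfline_L2_def set_borel_measurable_def)
  have "(\<lambda>x. indicator {0<..} x *\<^sub>R f x - indicator {0<..} x *\<^sub>R g x) \<in> borel_measurable lborel"
    by (rule borel_measurable_diff[OF mf mg])
  then have m: "(\<lambda>x. indicator {0<..} x *\<^sub>R (f x - g x)) \<in> borel_measurable lborel"
    by (simp add: scaleR_right_diff_distrib)
  have "set_integrable lborel {0<..} (\<lambda>x. 2 * norm (f x) ^ 2 + 2 * norm (g x) ^ 2)"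
    by (intro set_integral_add set_integrable_mult_right i)
  then have "set_integrable lborel {0<..} (\<lambda>x. norm (f x - g x) ^ 2)"
    unfolding set_integrable_def
  proof (rule Bochner_Integration.integrable_bound)
    have "(\<lambda>x. (norm (indicator {0<..} x *\<^sub>R (f x - g x)))\<^sup>2) \<in> borel_measurable lborel"
      by (rule borel_measurable_power[OF measurable_compose[OF m borel_measurable_norm]])
    also have "(\<lambda>x. (norm (indicator {0<..} x *\<^sub>R (f x - g x)))\<^sup>2) =
      (\<lambda>x. indicat_real {0<..} x *\<^sub>R (norm (f x - g x))\<^sup>2)"
      by (auto simp: fun_eq_iff indicator_def)
    finally show "(\<lambda>x. indicat_real {0<..} x *\<^sub>R (norm (f x - g x))\<^sup>2) \<in> borel_measurable lborel" .
    have "(norm (f x - g x))\<^sup>2 \<le> 2 * (norm (f x))\<^sup>2 + 2 * (norm (g x))\<^sup>2" for x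
    proof -
      have "(norm (f x - g x))\<^sup>2 \<le> (norm (f x) + norm (g x))\<^sup>2"
        by (intro power_mono norm_triangle_ineq4) simp
      also have "\<dots> \<le> 2 * (norm (f x))\<^sup>2 + 2 * (norm (g x))\<^sup>2"
        using zero_le_power2[of "norm (f x) - norm (g x)"] by (simp add: power2_eq_square algebra_simps)
      finally show ?thesis .
    qed
    then show "AE x in lborel. norm (indicat_real {0<..} x *\<^sub>R (norm (f x - g x))\<^sup>2)
       \<le> norm (indicat_real {0<..} x *\<^sub>R (2 * (norm (f x))\<^sup>2 + 2 * (norm (g x))\<^sup>2))"
      by (auto simp: indicator_def)
  qed
  with m show ?thesis by (simp add: halfline_L2_def set_borel_measurable_def)
qed

lemma has_weak_deriv_unique:
  assumes g: "has_weak_deriv f g" and h: "has_weak_deriv f h"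
  shows "AE x in lborel. 0 < x \<longrightarrow> g x = h x"
proof -
  have L: "halfline_L2 g" "halfline_L2 h" using g h by (auto simp: has_weak_deriv_def)
  have L2: "halfline_L2 (\<lambda>x. g x - h x)" by (rule halfline_L2_diff[OF L])
  have "(LINT x:{0<..}|lborel. p x *\<^sub>R (g x - h x)) = 0" if t: "test_function p p'" for p p'
  proof -
    have "(LINT x:{0<..}|lborel. p x *\<^sub>R g x) = (LINT x:{0<..}|lborel. p x *\<^sub>R h x)"
    proof -
      have "(LINT x:{0<..}|lborel. p' x *\<^sub>R f x) = - (LINT x:{0<..}|lborel. p x *\<^sub>R g x)"
        "(LINT x:{0<..}|lborel. p' x *\<^sub>R f x) = - (LINT x:{0<..}|lborel. p x *\<^sub>R h x)"
        using g h t unfolding has_weak_deriv_def by blast+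
      then show ?thesis by simp
    qed
    then show ?thesis
      using set_integral_diff(2)[OF test_function_integrable[OF t L(1)] test_function_integrable[OF t L(2)]]
      by (simp add: scaleR_right_diff_distrib)
  qed
  then have "AE x in lborel. 0 < x \<longrightarrow> g x - h x = 0"
    by (intro interval_integral_zero_imp_AE[OF L2] interval_integral_zero[OF L2])
  then show ?thesis by simp
qed


section \<open>The symmetric bound state is a stationary state\<close>

lemma has_weak_deriv_C1:
  fixes f g :: "real \<Rightarrow> complex"
  assumes L: "halfline_L2 f" "halfline_L2 g"
    and d: "\<And>x. (f has_vector_derivative g x) (at x)" and cg: "continuous_on UNIV g"
  shows "has_weak_deriv f g"
  unfolding has_weak_deriv_def
proof (intro conjI allI impI L)
  fix p p' assume t: "test_function p p'"
  then obtain a b where ab: "0 < a" "a < b" and s: "\<And>x. x \<notin> {a..b} \<Longrightarrow> p x = 0"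
    unfolding test_function_def by blast
  have dp: "(p has_real_derivative p' x) (at x)" for x using t by (simp add: test_function_def)
  have cp': "continuous_on UNIV p'" using t by (simp add: test_function_def)
  have cp: "continuous_on UNIV p"
    using dp by (meson DERIV_isCont continuous_at_imp_continuous_on)
  have cf: "continuous_on UNIV f"
    using d by (meson has_vector_derivative_continuous continuous_at_imp_continuous_on)
  have s': "p' x = 0" if "x \<notin> {a..b}" for x
  proof -
    have "((\<lambda>x. 0) has_real_derivative p' x) (at x)"
      by (rule has_field_derivative_transform_within_open[OF dp, of "- {a..b}"])
        (use that s in \<open>auto simp del: atLeastAtMost_iff\<close>)
    then show ?thesis using DERIV_unique DERIV_const by blast
  qed
  define I where "I = {a/2..b+1}"
  have int: "set_integrable lborel {0<..} (\<lambda>x. u x *\<^sub>R v x)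
      \<and> (LINT x:{0<..}|lborel. u x *\<^sub>R v x) = (LINT x|lborel. indicator I x *\<^sub>R (u x *\<^sub>R v x))"
    if "continuous_on UNIV u" "continuous_on UNIV v" "\<And>x. x \<notin> {a..b} \<Longrightarrow> u x = 0"
    for u :: "real \<Rightarrow> real" and v :: "real \<Rightarrow> complex"
  proof -
    have eq: "(\<lambda>x. indicator {0<..} x *\<^sub>R (u x *\<^sub>R v x)) = (\<lambda>x. indicator I x *\<^sub>R (u x *\<^sub>R v x))"
    proof
      fix x show "indicator {0<..} x *\<^sub>R (u x *\<^sub>R v x) = indicator I x *\<^sub>R (u x *\<^sub>R v x)"
        using that(3)[of x] ab by (cases "x \<in> {a..b}") (auto simp: I_def indicator_def)
    qed
    have "continuous_on I (\<lambda>x. u x *\<^sub>R v x)"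
      using that(1,2) by (intro continuous_intros) (auto intro: continuous_on_subset)
    then have "set_integrable lborel I (\<lambda>x. u x *\<^sub>R v x)"
      unfolding I_def by (rule borel_integrable_atLeastAtMost')
    then show ?thesis unfolding set_integrable_def set_lebesgue_integral_def eq by simp
  qed
  note i1 = int[OF cp' cf s'] and i2 = int[OF cp cg s]
  have "(LINT x|lborel. indicator {a/2..b+1} x *\<^sub>R (p' x *\<^sub>R f x + p x *\<^sub>R g x)) =
      p (b+1) *\<^sub>R f (b+1) - p (a/2) *\<^sub>R f (a/2)"
  proof (rule integral_FTC_atLeastAtMost)
    show "a/2 \<le> b + 1" using ab by simp
    show "((\<lambda>x. p x *\<^sub>R f x) has_vector_derivative p' x *\<^sub>R f x + p x *\<^sub>R g x) (at x within {a/2..b+1})" for x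
      using has_vector_derivative_scaleR[OF dp d, of x] 
      by (auto simp: add.commute intro: has_vector_derivative_at_within)
    show "continuous_on {a/2..b+1} (\<lambda>x. p' x *\<^sub>R f x + p x *\<^sub>R g x)"
      using cp cp' cf cg by (intro continuous_intros) (auto intro: continuous_on_subset)
  qed
  also have "\<dots> = 0" using s[of "b+1"] s[of "a/2"] ab by simp
  also have "(LINT x|lborel. indicator {a/2..b+1} x *\<^sub>R (p' x *\<^sub>R f x + p x *\<^sub>R g x)) =
     (LINT x:{0<..}|lborel. p' x *\<^sub>R f x + p x *\<^sub>R g x)"
    unfolding set_lebesgue_integral_def
  proof (intro Bochner_Integration.integral_cong refl)
    fix x show "indicator {a/2..b+1} x *\<^sub>R (p' x *\<^sub>R f x + p x *\<^sub>R g x) =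
      indicator {0<..} x *\<^sub>R (p' x *\<^sub>R f x + p x *\<^sub>R g x)"
      using s[of x] s'[of x] ab by (cases "x \<in> {a..b}") (auto simp: indicator_def)
  qed
  also have "\<dots> = (LINT x:{0<..}|lborel. p' x *\<^sub>R f x) + (LINT x:{0<..}|lborel. p x *\<^sub>R g x)"
    using i1 i2 by (intro set_integral_add) auto
  finally show "(LINT x:{0<..}|lborel. p' x *\<^sub>R f x) = - (LINT x:{0<..}|lborel. p x *\<^sub>R g x)"
    by (simp add: eq_neg_iff_add_eq_0)
qed

lemma has_weak_deriv_cong:
  assumes f: "has_weak_deriv f h" and g: "halfline_L2 g"
    and ae: "AE x in lborel. 0 < x \<longrightarrow> g x = f x"
  shows "has_weak_deriv g h"
proof -
  have mf: "(\<lambda>x. indicator {0<..} x *\<^sub>R f x) \<in> borel_measurable lborel"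
    and mg: "(\<lambda>x. indicator {0<..} x *\<^sub>R g x) \<in> borel_measurable lborel"
    using f g by (auto simp: has_weak_deriv_def halfline_L2_def set_borel_measurable_def)
  have "(LINT x:{0<..}|lborel. p' x *\<^sub>R g x) = (LINT x:{0<..}|lborel. p' x *\<^sub>R f x)"
    if "test_function p p'" for p p'
  proof -
    have m: "p' \<in> borel_measurable lborel"
      using that by (simp add: test_function_def borel_measurable_continuous_onI)
    have "(LINT x|lborel. p' x *\<^sub>R (indicator {0<..} x *\<^sub>R g x)) =
          (LINT x|lborel. p' x *\<^sub>R (indicator {0<..} x *\<^sub>R f x))"
    proof (rule integral_cong_AE)
      show "AE x in lborel. p' x *\<^sub>R (indicat_real {0<..} x *\<^sub>R g x) = p' x *\<^sub>R (indicat_real {0<..} x *\<^sub>R f x)"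
        using ae by eventually_elim (auto simp: indicator_def)
    qed (rule borel_measurable_scaleR[OF m mg] borel_measurable_scaleR[OF m mf])+
    then show ?thesis
      by (simp add: set_lebesgue_integral_def mult.commute)
  qed
  then show ?thesis using f g by (simp add: has_weak_deriv_def)
qed

lemma halfline_L2_exp_bound:
  fixes f :: "real \<Rightarrow> complex"
  assumes c: "continuous_on UNIV f" and a: "0 < a"
    and b: "\<And>x. 0 < x \<Longrightarrow> norm (f x) \<le> K * exp (- a * x)"
  shows "halfline_L2 f"
proof -
  have m: "f \<in> borel_measurable borel" by (rule borel_measurable_continuous_onI[OF c])
  have "(\<lambda>x::real. exp (- (2 * a) * x)) absolutely_integrable_on {0..}"
    by (intro nonnegative_absolutely_integrable_1 integrable_on_exp_minus_to_infinity) (use a in auto)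
  then have "set_integrable lborel {0..} (\<lambda>x::real. exp (- (2 * a) * x))"
    unfolding set_integrable_def
    by (subst (asm) integrable_completion) measurable
  then have "set_integrable lborel {0<..} (\<lambda>x::real. exp (- (2 * a) * x))"
    by (rule set_integrable_subset) auto
  then have i: "set_integrable lborel {0<..} (\<lambda>x::real. K\<^sup>2 * exp (- (2 * a) * x))"
    by (rule set_integrable_mult_right)
  have "set_integrable lborel {0<..} (\<lambda>x. norm (f x) ^ 2)"
  proof (rule set_integrable_bound[OF i])
    show "set_borel_measurable lborel {0<..} (\<lambda>x. norm (f x) ^ 2)"
      unfolding set_borel_measurable_def using m by measurable
    show "AE x in lborel. x \<in> {0<..} \<longrightarrow> norm ((cmod (f x))\<^sup>2) \<le> norm (K\<^sup>2 * exp (- (2 * a) * x))"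
    proof (intro AE_I2 impI)
      fix x :: real assume "x \<in> {0<..}"
      then have "(norm (f x))\<^sup>2 \<le> (K * exp (- a * x))\<^sup>2"
        using b[of x] by (intro power_mono) auto
      also have "\<dots> = K\<^sup>2 * exp (- (2 * a) * x)"
        by (simp add: power_mult_distrib exp_double[symmetric])
      finally show "norm ((cmod (f x))\<^sup>2) \<le> norm (K\<^sup>2 * exp (- (2 * a) * x))"
        by (simp add: abs_mult)
    qed
  qed
  then show ?thesis
    unfolding halfline_L2_def set_borel_measurable_def using m by simp
qed

lemma soliton_pos: "0 < \<mu> \<Longrightarrow> 0 < \<omega> \<Longrightarrow> 0 < soliton \<mu> \<omega> x"
  by (simp add: soliton_def)

lemma soliton_deriv:
  assumes "0 < \<mu>" "0 < \<omega>"
  shows "(soliton \<mu> \<omega> has_real_derivative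
           - sqrt \<omega> * tanh (\<mu> * sqrt \<omega> * x) * soliton \<mu> \<omega> x) (at x)"
proof -
  have eq: "soliton \<mu> \<omega> x =
     ((\<mu> + 1) * \<omega>) powr (1 / (2 * \<mu>)) * exp (- ln (cosh (\<mu> * sqrt \<omega> * x)) / \<mu>)" for x
    using cosh_real_pos[of "\<mu> * sqrt \<omega> * x"]
    by (simp add: soliton_def powr_def ln_div)
  show ?thesis
    unfolding eq[abs_def]
    using assms by (auto intro!: derivative_eq_intros simp: tanh_def field_simps)
qed

lemma soliton_powr:
  assumes "0 < \<mu>" "0 < \<omega>"
  shows "soliton \<mu> \<omega> x powr (2 * \<mu>) = (\<mu> + 1) * \<omega> * (1 - (tanh (\<mu> * sqrt \<omega> * x))\<^sup>2)"
proof -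
  let ?y = "\<mu> * sqrt \<omega> * x"
  have "soliton \<mu> \<omega> x powr (2 * \<mu>) = (\<mu> + 1) * \<omega> * (1 / cosh ?y) powr 2"
    using assms by (simp add: soliton_def powr_mult powr_powr)
  also have "(1 / cosh ?y) powr 2 = 1 - (tanh ?y)\<^sup>2"
  proof -
    have "1 - (tanh ?y)\<^sup>2 = ((cosh ?y)\<^sup>2 - (sinh ?y)\<^sup>2) / (cosh ?y)\<^sup>2"
      by (simp add: tanh_def power_divide diff_divide_distrib)
    then show ?thesis
      by (simp only: hyperbolic_pythagoras) (simp add: powr_numeral power_divide)
  qed
  finally show ?thesis .
qed

lemma soliton_deriv2:
  assumes "0 < \<mu>" "0 < \<omega>"
  shows "((\<lambda>x. - sqrt \<omega> * tanh (\<mu> * sqrt \<omega> * x) * soliton \<mu> \<omega> x) has_real_derivative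
           \<omega> * soliton \<mu> \<omega> x - soliton \<mu> \<omega> x powr (2 * \<mu>) * soliton \<mu> \<omega> x) (at x)"
proof -
  have w: "sqrt \<omega> * (sqrt \<omega> * z) = \<omega> * z" for z using assms by (simp flip: mult.assoc)
  show ?thesis
    unfolding soliton_powr[OF assms]
    by (rule derivative_eq_intros soliton_deriv[OF assms] refl | simp)+
       (use assms in \<open>simp add: algebra_simps w power2_eq_square\<close>)
qed

lemma soliton_decay:
  assumes "0 < \<mu>" "0 < \<omega>"
  shows "\<exists>K\<ge>0. \<forall>x. soliton \<mu> \<omega> x \<le> K * exp (- sqrt \<omega> * x)"
proof (intro exI conjI allI)
  let ?K = "((\<mu> + 1) * \<omega>) powr (1 / (2 * \<mu>)) * 2 powr (1 / \<mu>)"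
  show "0 \<le> ?K" by simp
  fix x
  let ?y = "\<mu> * sqrt \<omega> * x"
  have "exp ?y \<le> 2 * cosh ?y" by (simp add: cosh_def)
  then have "1 / cosh ?y \<le> 2 * exp (- ?y)"
    using cosh_real_pos[of ?y] by (simp add: exp_minus field_simps)
  then have "(1 / cosh ?y) powr (1 / \<mu>) \<le> (2 * exp (- ?y)) powr (1 / \<mu>)"
    using assms by (intro powr_mono2) auto
  also have "\<dots> = 2 powr (1 / \<mu>) * exp (- sqrt \<omega> * x)"
    using assms by (simp add: powr_mult) (simp add: powr_def)
  finally show "soliton \<mu> \<omega> x \<le> ?K * exp (- sqrt \<omega> * x)"
    unfolding soliton_def by (simp add: mult.assoc mult_left_mono)
qed

lemma tanh_artanh:
  fixes y :: real assumes "\<bar>y\<bar> < 1" shows "tanh (artanh y) = y"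
proof -
  have p: "1 + y > 0" "1 - y > 0" using assms by auto
  have "exp (2 * artanh y) = (1 + y) / (1 - y)"
    using p by (simp add: artanh_def)
  then have e: "exp (- 2 * artanh y) = (1 - y) / (1 + y)" by (simp add: exp_minus)
  have "1 - (1 - y) / (1 + y) = 2 * y / (1 + y)" "1 + (1 - y) / (1 + y) = 2 / (1 + y)"
    using p by (simp_all add: field_simps)
  then show ?thesis using p by (simp add: tanh_real_altdef[of "artanh y", unfolded e])
qed

theorem symmetric_bound_state_stationary:
  assumes N: "1 \<le> N" and \<mu>: "0 < \<mu>" and \<omega>: "\<alpha>\<^sup>2 / (real N)\<^sup>2 < \<omega>"
  shows "stationary_state N \<mu> \<alpha> \<omega> (symmetric_bound_state N \<mu> \<alpha> \<omega>)"
proof -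
  have w: "0 < \<omega>" using \<omega> by (smt (verit) zero_le_divide_iff zero_le_power2)
  define z where "z = soliton_shift N \<mu> \<alpha> \<omega>"
  define S where "S = (\<lambda>x. soliton \<mu> \<omega> (x + z))"
  define T where "T = (\<lambda>x. - sqrt \<omega> * tanh (\<mu> * sqrt \<omega> * (x + z)) * S x)"
  define R where "R = (\<lambda>x. \<omega> * S x - S x powr (2 * \<mu>) * S x)"
  define f f1 f2 where "f = (\<lambda>x. complex_of_real (S x))"
    and "f1 = (\<lambda>x. complex_of_real (T x))" and "f2 = (\<lambda>x. complex_of_real (R x))"
  have Spos: "0 < S x" for x unfolding S_def by (rule soliton_pos[OF \<mu> w])
  have dS: "(S has_real_derivative T x) (at x)" for x
    unfolding S_def T_def using DERIV_shift[THEN iffD1, OF soliton_deriv[OF \<mu> w]] by simp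
  have dT: "(T has_real_derivative R x) (at x)" for x
    unfolding S_def T_def R_def
    using DERIV_shift[THEN iffD1, OF soliton_deriv2[OF \<mu> w]] by simp
  have cS: "continuous_on UNIV S" using dS by (meson DERIV_isCont continuous_at_imp_continuous_on)
  have cT: "continuous_on UNIV T" using dT by (meson DERIV_isCont continuous_at_imp_continuous_on)
  have cR: "continuous_on UNIV R"
    unfolding R_def using Spos by (intro continuous_intros cS) (metis less_irrefl)
  obtain K where K: "0 \<le> K" "\<And>x. soliton \<mu> \<omega> x \<le> K * exp (- sqrt \<omega> * x)"
    using soliton_decay[OF \<mu> w] by blast
  define K' where "K' = K * exp (- sqrt \<omega> * z)"
  have SK: "S x \<le> K' * exp (- sqrt \<omega> * x)" for x
    using K(2)[of "x + z"] unfolding S_def K'_def by (simp add: algebra_simps exp_add exp_diff flip: exp_add)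
  have TS: "\<bar>T x\<bar> \<le> sqrt \<omega> * S x" for x
  proof -
    have "\<bar>tanh (\<mu> * sqrt \<omega> * (x + z))\<bar> \<le> 1"
      using tanh_real_bounds[of "\<mu> * sqrt \<omega> * (x + z)"] by auto
    then show ?thesis using Spos[of x] w
      unfolding T_def by (simp add: abs_mult mult_left_le_one_le mult.assoc)
  qed
  have RS: "\<bar>R x\<bar> \<le> (\<omega> + (\<mu> + 1) * \<omega>) * S x" for x
  proof -
    have "(tanh (\<mu> * sqrt \<omega> * (x + z)))\<^sup>2 \<ge> 0" by simp
    then have "S x powr (2 * \<mu>) \<le> (\<mu> + 1) * \<omega>"
      unfolding S_def soliton_powr[OF \<mu> w] using \<mu> w by (intro mult_left_le) auto
    then have "S x powr (2 * \<mu>) * S x \<le> (\<mu> + 1) * \<omega> * S x"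
      using Spos[of x] by (intro mult_right_mono) auto
    moreover have "0 \<le> S x powr (2 * \<mu>) * S x" "0 \<le> \<omega> * S x" using Spos[of x] w by auto
    ultimately show ?thesis unfolding R_def by (simp add: algebra_simps abs_le_iff)
  qed
  have s0: "0 < sqrt \<omega>" using w by simp
  have Lf: "halfline_L2 f"
    by (rule halfline_L2_exp_bound[OF _ s0, of _ K'])
      (use SK Spos in \<open>auto simp: f_def less_imp_le intro!: continuous_intros cS\<close>)
  have scale: "norm (complex_of_real u) \<le> (c * K') * exp (- sqrt \<omega> * x)"
    if "\<bar>u\<bar> \<le> c * S x" "0 \<le> c" for u c x
    using that mult_left_mono[OF SK[of x] that(2)] by (simp add: mult.assoc)
  have Lf1: "halfline_L2 f1"
    unfolding f1_def
    by (rule halfline_L2_exp_bound[OF _ s0 scale[OF TS]]) (auto intro!: continuous_intros cT less_imp_le w)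
  have Lf2: "halfline_L2 f2"
    unfolding f2_def
    by (rule halfline_L2_exp_bound[OF _ s0 scale[OF RS]]) (use w \<mu> in \<open>auto intro!: continuous_intros cR\<close>)
  have df: "(f has_vector_derivative f1 x) (at x)" for x
    unfolding f_def f1_def
    by (rule has_vector_derivative_of_real)
       (use dS in \<open>simp add: has_real_derivative_iff_has_vector_derivative\<close>)
  have df1: "(f1 has_vector_derivative f2 x) (at x)" for x
    unfolding f1_def f2_def
    by (rule has_vector_derivative_of_real)
       (use dT in \<open>simp add: has_real_derivative_iff_has_vector_derivative\<close>)
  have wf: "has_weak_deriv f f1"
    by (rule has_weak_deriv_C1[OF Lf Lf1 df]) (auto simp: f1_def intro!: continuous_intros cT)
  have wf1: "has_weak_deriv f1 f2"
    by (rule has_weak_deriv_C1[OF Lf1 Lf2 df1]) (auto simp: f2_def intro!: continuous_intros cR)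
  have H1: "halfline_H1 f" "halfline_H1 f1" unfolding halfline_H1_def using wf wf1
    by (auto simp: f_def f1_def intro!: continuous_intros intro: continuous_on_subset[OF cS] continuous_on_subset[OF cT])
  then have H2: "halfline_H2 f" unfolding halfline_H2_def using wf by blast
  have sbs: "symmetric_bound_state N \<mu> \<alpha> \<omega> = (\<lambda>j. f)"
    by (simp add: symmetric_bound_state_def f_def S_def z_def)
  have vd: "vector_derivative f (at 0 within {0..}) = f1 0"
    by (rule vector_derivative_within[OF _ has_vector_derivative_at_within[OF df]])
       (simp add: at_within_Ici_at_right)
  have "tanh (\<mu> * sqrt \<omega> * z) = \<alpha> / (real N * sqrt \<omega>)"
  proof -
    have "(\<alpha> / (real N * sqrt \<omega>))\<^sup>2 < 1\<^sup>2"
      using \<omega> N w by (simp add: power_divide power_mult_distrib field_simps)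
    then have "\<bar>\<alpha> / (real N * sqrt \<omega>)\<bar> < 1" using power2_less_imp_less
      by (metis abs_ge_zero abs_1 power2_abs zero_le_one)
    then show ?thesis using \<mu> w by (simp add: z_def soliton_shift_def tanh_artanh)
  qed
  then have "real N * T 0 = - \<alpha> * S 0" using N w by (simp add: T_def)
  then have "of_nat N * f1 0 = - complex_of_real \<alpha> * f 0"
    unfolding f_def f1_def by (metis of_real_minus of_real_mult of_real_of_nat_eq)
  then have dom: "(\<lambda>j::nat. f) \<in> hamiltonian_domain N \<alpha>"
    using H1 H2 vd by (simp add: hamiltonian_domain_def graph_H1_def vertex_value_def)
  have g: "has_weak_deriv f (weak_deriv f)"
    unfolding weak_deriv_def by (rule someI[of "has_weak_deriv f", OF wf])
  have "AE x in lborel. 0 < x \<longrightarrow> weak_deriv f x = f1 x" by (rule has_weak_deriv_unique[OF g wf])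
  then have g2: "has_weak_deriv (weak_deriv f) f2"
    by (rule has_weak_deriv_cong[OF wf1, rotated]) (use g in \<open>simp add: has_weak_deriv_def\<close>)
  have g3: "has_weak_deriv (weak_deriv f) (weak_deriv (weak_deriv f))"
    unfolding weak_deriv_def[of "weak_deriv f"]
    by (rule someI[of "has_weak_deriv (weak_deriv f)", OF g2])
  have "AE x in lborel. 0 < x \<longrightarrow> weak_deriv (weak_deriv f) x = f2 x"
    by (rule has_weak_deriv_unique[OF g3 g2])
  then have "AE x in lborel. 0 < x \<longrightarrow>
      hamiltonian (\<lambda>j. f) j x - complex_of_real (norm (f x) powr (2 * \<mu>)) * f x = - complex_of_real \<omega> * f x" for j
    by eventually_elim (auto simp: hamiltonian_def f2_def R_def f_def abs_of_pos[OF Spos])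
  with dom show ?thesis by (simp add: stationary_state_def sbs)
qed

end

theory Submission
  imports Defs
begin

text \<open>
  The energy is bounded below by completing a square, in the manner of a calibration. Fix a
  frequency \<open>\<nu>\<close>. The soliton of frequency \<open>\<nu>\<close> satisfies the first order equation
  \<open>\<psi>' = - q(\<psi>) \<psi>\<close> with \<open>q(\<psi>) = sqrt (\<nu> - \<bar>\<psi>\<bar>\<^bsup>2\<mu>\<^esup> / (\<mu> + 1))\<close> as long as it decreases. On a halfline, expanding
  \<open>\<bar>\<psi>' + q(\<psi>) \<psi>\<bar>\<^sup>2\<close> yields the Lagrangian \<open>\<bar>\<psi>'\<bar>\<^sup>2 + \<nu> \<bar>\<psi>\<bar>\<^sup>2 - \<bar>\<psi>\<bar>\<^bsup>2\<mu>+2\<^esup> / (\<mu> + 1)\<close> plus a cross term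
  which is an exact derivative, so that only the boundary term \<open>soliton_action \<mu> \<nu> (\<bar>\<psi>(0)\<bar>\<^sup>2)\<close> is left of
  it. This needs \<open>\<bar>\<psi>\<bar>\<^bsup>2\<mu>\<^esup> \<le> (\<mu> + 1) \<nu>\<close> throughout. The bound state obeys this inequality strictly,
  because \<open>\<alpha> > 0\<close> puts the top of the soliton outside the edges, and hence so does every function
  close to it in \<open>H\<^sup>1\<close>.

  Summing over the edges (\<open>energy_completing_square\<close>), the energy of a function \<open>\<Phi>\<close> of mass \<open>M\<close> with
  vertex modulus \<open>s\<close> equals a nonnegative defect plus
  \<open>N/2 * soliton_action \<mu> \<nu> (s\<^sup>2) - \<alpha>/2 * s\<^sup>2 - \<nu> M/2\<close>. The frequency \<open>\<nu>\<close> is free. It is chosen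
  such that the symmetric bound state of frequency \<open>\<nu>\<close> has vertex modulus \<open>s\<close>, that is
  \<open>\<nu> = s\<^bsup>2\<mu>\<^esup> / (\<mu> + 1) + \<alpha>\<^sup>2 / N\<^sup>2\<close>. The bound then becomes \<open>N/2 * H(\<nu>) - \<nu> M/2\<close>, where \<open>H\<close> is
  \<open>branch_action\<close> (\<open>soliton_action_at_vertex\<close>). The derivative of \<open>H\<close> is the mass per edge of the bound
  state of frequency \<open>\<nu>\<close> (\<open>branch_action_deriv\<close>, \<open>shifted_soliton_mass\<close>), and for \<open>\<mu> < 2\<close> this mass increases
  strictly with \<open>\<nu>\<close> (\<open>branch_mass_increasing\<close>). So \<open>H\<close> is strictly convex and the bound has its unique minimum at
  \<open>\<nu> = \<omega>\<close>, where its value is the energy of \<open>\<Psi>\<^sub>\<omega>\<close>.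

  In the case of equality \<open>\<nu> = \<omega>\<close>, the vertex modulus is that of \<open>\<Psi>\<^sub>\<omega>\<close>, and the defect vanishes, so
  that every component solves \<open>\<psi>' = - q(\<psi>) \<psi>\<close>; such a function is a multiple of the shifted soliton by a
  constant phase (\<open>integral_curve_eq_soliton\<close>), and the phase is the same on all edges since it is
  determined at the vertex.

  The functions in question are only weakly differentiable. The analytic basis is that the continuous
  representative is the integral of its weak derivative (\<open>has_weak_deriv_FTC\<close>) and that this suffices for the
  chain rule (\<open>chain_rule_integral\<close>).
\<close>

section \<open>The fundamental theorem for weak derivatives\<close>

text \<open>A \<open>C\<^sup>1\<close> transition from \<open>0\<close> to \<open>1\<close> which takes place on \<open>[1, 2]\<close>. Starting at \<open>1\<close> instead of \<open>0\<close> keeps the support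
  of \<open>x \<mapsto> ramp (x / e)\<close> away from the origin, as test functions on the open halfline require.\<close>

definition ramp :: "real \<Rightarrow> real" where
  "ramp s = 2 * ((max 0 (s - 1))\<^sup>2 - 2 * (max 0 (s - 3/2))\<^sup>2 + (max 0 (s - 2))\<^sup>2)"

definition tent :: "real \<Rightarrow> real" where
  "tent s = 4 * (max 0 (s - 1) - 2 * max 0 (s - 3/2) + max 0 (s - 2))"

lemma pos_part_square_deriv:
  "((\<lambda>t::real. (max 0 (t - c))\<^sup>2) has_real_derivative 2 * max 0 (t - c)) (at t)"
proof -
  consider "t < c" | "t > c" | "t = c" by linarith
  then show ?thesis
  proof cases
    case 1
    then have "((\<lambda>t::real. 0) has_real_derivative 2 * max 0 (t - c)) (at t)" by simp
    then show ?thesis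
      by (rule has_field_derivative_transform_within_open[where S="{..<c}"]) (use 1 in auto)
  next
    case 2
    then have "((\<lambda>t::real. (t - c)\<^sup>2) has_real_derivative 2 * max 0 (t - c)) (at t)"
      by (auto intro!: derivative_eq_intros)
    then show ?thesis
      by (rule has_field_derivative_transform_within_open[where S="{c<..}"]) (use 2 in auto)
  next
    case 3
    have l: "((\<lambda>h::real. \<bar>h\<bar>) \<longlongrightarrow> 0) (at 0)" by (auto intro!: tendsto_eq_intros)
    have "((\<lambda>h::real. ((max 0 (c + h - c))\<^sup>2 - (max 0 (c - c))\<^sup>2) / h) \<longlongrightarrow> 0) (at 0)"
      by (rule Lim_null_comparison[OF _ l])
        (auto intro!: always_eventually simp: max_def power2_eq_square)
    then show ?thesis using 3 by (simp add: DERIV_def)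
  qed
qed

lemma ramp_deriv: "(ramp has_real_derivative tent s) (at s)"
  unfolding ramp_def[abs_def] tent_def
  by (rule derivative_eq_intros pos_part_square_deriv refl)+ simp

lemma continuous_on_tent: "continuous_on A tent"
  unfolding tent_def[abs_def] by (intro continuous_intros)

lemma tent_outside: "s \<notin> {1..2} \<Longrightarrow> tent s = 0"
  by (auto simp: tent_def max_def)

lemma tent_bounds: "0 \<le> tent s" "tent s \<le> 2"
  by (auto simp: tent_def max_def)

lemma ramp_left: "s \<le> 1 \<Longrightarrow> ramp s = 0"
  by (simp add: ramp_def)

lemma ramp_right: "2 \<le> s \<Longrightarrow> ramp s = 1"
  by (simp add: ramp_def power2_eq_square algebra_simps)

lemma ramp_mono: "s \<le> t \<Longrightarrow> ramp s \<le> ramp t"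
  by (rule DERIV_nonneg_imp_nondecreasing[of s t ramp]) (use ramp_deriv tent_bounds(1) in blast)+

lemma ramp_bounds: "0 \<le> ramp s" "ramp s \<le> 1"
  using ramp_mono[of "min s 1" s] ramp_left[of "min s 1"] ramp_mono[of s "max s 2"] ramp_right[of "max s 2"]
  by auto

lemma integral_tent: "(LINT s|lborel. tent s) = 1"
proof -
  have "(LINT s|lborel. indicator {1..2} s *\<^sub>R tent s) = ramp 2 - ramp 1"
    by (rule integral_FTC_atLeastAtMost)
      (auto simp: continuous_on_tent has_real_derivative_iff_has_vector_derivative[symmetric]
        intro: has_field_derivative_at_within ramp_deriv)
  moreover have "(\<lambda>s. indicator {1..2} s *\<^sub>R tent s) = tent"
    using tent_outside by (auto simp: indicator_def fun_eq_iff)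
  ultimately show ?thesis by (simp add: ramp_left ramp_right)
qed

lemma test_function_ramp:
  fixes a b e :: real
  assumes "0 \<le> a" "a < b" "0 < e"
  shows "test_function (\<lambda>x. ramp ((x - a) / e) - ramp ((x - b) / e))
     (\<lambda>x. tent ((x - a) / e) / e - tent ((x - b) / e) / e)"
  unfolding test_function_def
proof (intro conjI allI)
  show "((\<lambda>x. ramp ((x - a) / e) - ramp ((x - b) / e)) has_real_derivative
      tent ((x - a) / e) / e - tent ((x - b) / e) / e) (at x)" for x
    using assms(3) by (auto intro!: derivative_eq_intros DERIV_chain2[OF ramp_deriv])
  show "continuous_on UNIV (\<lambda>x. tent ((x - a) / e) / e - tent ((x - b) / e) / e)"
    using assms(3) by (intro continuous_intros continuous_on_compose2[OF continuous_on_tent[of UNIV]]) auto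
  have "ramp ((x - a) / e) - ramp ((x - b) / e) = 0" if "x \<notin> {a + e..b + 2 * e}" for x
  proof -
    from that have "x < a + e \<or> b + 2 * e < x" by auto
    then consider "x < a + e" | "b + 2 * e < x" by blast
    then show ?thesis
    proof cases
      case 1
      then have "(x - a) / e \<le> 1" "(x - b) / e \<le> 1" using assms by (auto simp: field_simps)
      then show ?thesis by (simp add: ramp_left)
    next
      case 2
      then have "2 \<le> (x - a) / e" "2 \<le> (x - b) / e" using assms by (auto simp: field_simps)
      then show ?thesis by (simp add: ramp_right)
    qed
  qed
  then show "\<exists>a' b'. 0 < a' \<and> a' < b' \<and> (\<forall>x. x \<notin> {a'..b'} \<longrightarrow> ramp ((x - a) / e) - ramp ((x - b) / e) = 0)"
    using assms by (intro exI[of _ "a + e"] exI[of _ "b + 2 * e"]) auto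
qed

lemma halfline_L2_integrable_bounded:
  assumes "halfline_L2 g" and A: "A \<subseteq> {0<..R}" "A \<in> sets borel"
  shows "set_integrable lborel A g"
proof -
  have m: "(\<lambda>x. indicator {0<..} x *\<^sub>R g x) \<in> borel_measurable lborel"
    and i: "set_integrable lborel {0<..} (\<lambda>x. norm (g x) ^ 2)"
    using assms by (auto simp: halfline_L2_def set_borel_measurable_def)
  have "set_integrable lborel {0<..R} (\<lambda>x. 1 + norm (g x) ^ 2)"
  proof (rule set_integral_add)
    show "set_integrable lborel {0<..R} (\<lambda>x. 1::real)"
      by (rule set_integrable_subset[of _ "{0..R}"]) (auto intro!: borel_integrable_atLeastAtMost')
    show "set_integrable lborel {0<..R} (\<lambda>x. norm (g x) ^ 2)"
      by (rule set_integrable_subset[OF i]) auto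
  qed
  then have "set_integrable lborel {0<..R} g" unfolding set_integrable_def
  proof (rule Bochner_Integration.integrable_bound)
    have "(\<lambda>x. indicator {0<..R} x *\<^sub>R g x) = (\<lambda>x. indicator {0<..R} x *\<^sub>R (indicator {0<..} x *\<^sub>R g x))"
      by (auto simp: indicator_def fun_eq_iff)
    then show "(\<lambda>x. indicator {0<..R} x *\<^sub>R g x) \<in> borel_measurable lborel"
      using borel_measurable_scaleR[OF borel_measurable_indicator[of "{0<..R}"] m] by simp
    have "t \<le> 1 + t\<^sup>2" for t :: real
      using zero_le_power2[of "t - 1/2"] by (simp add: power2_eq_square algebra_simps)
    then show "AE x in lborel. norm (indicat_real {0<..R} x *\<^sub>R g x)
       \<le> norm (indicat_real {0<..R} x *\<^sub>R (1 + (cmod (g x))\<^sup>2))"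
      by (auto simp: indicator_def abs_of_nonneg)
  qed
  then show ?thesis by (rule set_integrable_subset) (use A in auto)
qed

text \<open>The weights form an approximate identity that looks only to the right of \<open>c\<close>. One-sided continuity is
  therefore enough, and \<open>c = 0\<close> is admitted.\<close>

lemma tent_average_tendsto:
  fixes f :: "real \<Rightarrow> complex"
  assumes cf: "continuous_on {0..} f" and c: "0 \<le> c"
  shows "(\<lambda>n. LINT x:{0<..}|lborel. (real (Suc n) * tent (real (Suc n) * (x - c))) *\<^sub>R f x)
           \<longlonglongrightarrow> f c"
proof -
  define h where "h = (\<lambda>x. f (max 0 x))"
  have ch: "continuous_on UNIV h"
    unfolding h_def by (rule continuous_on_compose2[OF cf]) (auto intro!: continuous_intros)
  have mh: "h \<in> borel_measurable borel" by (rule borel_measurable_continuous_onI[OF ch])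
  have mt: "tent \<in> borel_measurable borel" by (rule borel_measurable_continuous_onI[OF continuous_on_tent])
  have eq: "(LINT x:{0<..}|lborel. (real (Suc n) * tent (real (Suc n) * (x - c))) *\<^sub>R f x)
      = (LINT s|lborel. tent s *\<^sub>R h (c + s / real (Suc n)))" for n
  proof -
    let ?m = "real (Suc n)"
    have "(LINT x:{0<..}|lborel. (?m * tent (?m * (x - c))) *\<^sub>R f x)
        = (LINT x|lborel. (?m * tent (?m * (x - c))) *\<^sub>R h x)"
      unfolding set_lebesgue_integral_def
    proof (rule Bochner_Integration.integral_cong[OF refl])
      fix x :: real
      show "indicator {0<..} x *\<^sub>R (?m * tent (?m * (x - c))) *\<^sub>R f x = (?m * tent (?m * (x - c))) *\<^sub>R h x"
      proof (cases "0 < x")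
        case False
        then have "?m * (x - c) \<le> 0" using c by (intro mult_nonneg_nonpos) auto
        then have "tent (?m * (x - c)) = 0" by (intro tent_outside) auto
        then show ?thesis by simp
      qed (simp add: h_def max_def)
    qed
    also have "\<dots> = \<bar>1 / ?m\<bar> *\<^sub>R (LINT s|lborel. (?m * tent (?m * (c + 1 / ?m * s - c))) *\<^sub>R h (c + 1 / ?m * s))"
      by (rule lborel_integral_real_affine) simp
    also have "\<dots> = (LINT s|lborel. tent s *\<^sub>R h (c + s / ?m))"
      by (simp add: scaleR_scaleR[symmetric] del: of_nat_Suc scaleR_scaleR) (simp del: of_nat_Suc)
    finally show ?thesis .
  qed
  have "bounded (h ` {c..c+2})"
    by (intro compact_imp_bounded compact_continuous_image continuous_on_subset[OF ch]) auto
  then obtain B where B: "\<And>x. x \<in> {c..c+2} \<Longrightarrow> norm (h x) \<le> B"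
    unfolding bounded_iff by (meson imageI)
  have "(\<lambda>n. LINT s|lborel. tent s *\<^sub>R h (c + s / real (Suc n))) \<longlonglongrightarrow> (LINT s|lborel. tent s *\<^sub>R h c)"
  proof (rule integral_dominated_convergence[where w="\<lambda>s. indicator {1..2} s *\<^sub>R (2 * B)"])
    show "integrable lborel (\<lambda>s::real. indicat_real {1..2} s *\<^sub>R (2 * B))"
      using borel_integrable_atLeastAtMost'[of 1 "2::real" "\<lambda>_. 2 * B"] by (simp add: set_integrable_def)
    show "AE s in lborel. (\<lambda>n. tent s *\<^sub>R h (c + s / real (Suc n))) \<longlonglongrightarrow> tent s *\<^sub>R h c"
    proof (rule AE_I2)
      fix s :: real
      have "(\<lambda>n. c + s * inverse (real (Suc n))) \<longlonglongrightarrow> c + s * 0"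
        by (intro tendsto_intros LIMSEQ_inverse_real_of_nat)
      then have "(\<lambda>n. c + s / real (Suc n)) \<longlonglongrightarrow> c" by (simp add: divide_inverse)
      moreover have "isCont h c" using ch by (simp add: continuous_on_eq_continuous_at)
      ultimately show "(\<lambda>n. tent s *\<^sub>R h (c + s / real (Suc n))) \<longlonglongrightarrow> tent s *\<^sub>R h c"
        by (intro tendsto_intros isCont_tendsto_compose[of c h])
    qed
    show "AE s in lborel. norm (tent s *\<^sub>R h (c + s / real (Suc n))) \<le> indicat_real {1..2} s *\<^sub>R (2 * B)" for n
    proof (rule AE_I2)
      fix s :: real
      show "norm (tent s *\<^sub>R h (c + s / real (Suc n))) \<le> indicat_real {1..2} s *\<^sub>R (2 * B)"
      proof (cases "s \<in> {1..2}")
        case True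
        have "s / real (Suc n) \<le> s / 1" using True by (intro divide_left_mono) auto
        then have "s / real (Suc n) \<in> {0..2}" using True by auto
        then have "norm (h (c + s / real (Suc n))) \<le> B" by (intro B) auto
        then show ?thesis using True tent_bounds[of s] by (auto intro!: mult_mono)
      next
        case False
        then show ?thesis by (simp add: tent_outside)
      qed
    qed
  qed (use mh mt in measurable)
  moreover have "(LINT s|lborel. tent s *\<^sub>R h c) = f c"
  proof -
    have "integrable lborel tent"
      using integral_tent not_integrable_integral_eq by fastforce
    then show ?thesis using c by (simp add: integral_tent h_def)
  qed
  ultimately show ?thesis by (simp only: eq)
qed

text \<open>Testing with \<open>C\<^sup>1\<close> approximations of the indicator function of \<open>(a, b]\<close> produces, in the limit, the
  integral of \<open>g\<close> over \<open>(a, b]\<close> on one side and the values of \<open>f\<close> at the two transitions on the other.\<close>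

lemma has_weak_deriv_FTC:
  assumes w: "has_weak_deriv f g" and cf: "continuous_on {0..} f" and ab: "0 \<le> a" "a \<le> b"
  shows "f b - f a = (LINT x:{a<..b}|lborel. g x)"
proof (cases "a = b")
  case True
  then show ?thesis by (simp add: set_lebesgue_integral_def)
next
  case False
  with ab have ab': "a < b" by simp
  have Lg: "halfline_L2 g" using w by (simp add: has_weak_deriv_def)
  define p where "p = (\<lambda>(n::nat) x. ramp ((x - a) / inverse (real (Suc n))) - ramp ((x - b) / inverse (real (Suc n))))"
  define p' where "p' = (\<lambda>(n::nat) x. tent ((x - a) / inverse (real (Suc n))) / inverse (real (Suc n))
      - tent ((x - b) / inverse (real (Suc n))) / inverse (real (Suc n)))"
  have t: "test_function (p n) (p' n)" for n
    unfolding p_def p'_def using ab ab' by (intro test_function_ramp) auto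
  have wd: "(LINT x:{0<..}|lborel. p' n x *\<^sub>R f x) = - (LINT x:{0<..}|lborel. p n x *\<^sub>R g x)" for n
    using w t unfolding has_weak_deriv_def by blast
  \<comment> \<open>weighted averages of \<open>f\<close> over shrinking intervals to the right of \<open>c\<close>\<close>
  let ?A = "\<lambda>c (n::nat). LINT x:{0<..}|lborel. (real (Suc n) * tent (real (Suc n) * (x - c))) *\<^sub>R f x"
  have ti: "set_integrable lborel {0<..} (\<lambda>x. (real (Suc n) * tent (real (Suc n) * (x - c))) *\<^sub>R f x)"
    if "0 \<le> c" for c n
  proof -
    let ?u = "\<lambda>x. (real (Suc n) * tent (real (Suc n) * (x - c))) *\<^sub>R f x"
    have "continuous_on {0..c+2} ?u"
      by (intro continuous_intros continuous_on_compose2[OF continuous_on_tent[of UNIV]]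
          continuous_on_subset[OF cf]) auto
    then have "set_integrable lborel {0..c+2} ?u"
      by (rule borel_integrable_atLeastAtMost')
    then have "set_integrable lborel {0<..c+2} ?u"
      by (rule set_integrable_subset) auto
    moreover have "indicator {0<..} x *\<^sub>R ?u x = indicator {0<..c+2} x *\<^sub>R ?u x" for x
    proof (cases "x \<le> c + 2")
      case False
      then have "real (Suc n) * (x - c) \<ge> 1 * (x - c)" by (intro mult_right_mono) auto
      moreover have "2 < 1 * (x - c)" using False by simp
      ultimately have "real (Suc n) * (x - c) > 2" by (rule order.strict_trans2[rotated])
      then have "real (Suc n) * (x - c) \<notin> {1..2}" using False by (auto simp del: of_nat_Suc)
      then have "tent (real (Suc n) * (x - c)) = 0" by (rule tent_outside)
      then show ?thesis by (simp del: of_nat_Suc)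
    qed (simp add: indicator_def)
    ultimately show ?thesis unfolding set_integrable_def by (simp only:)
  qed
  have "(\<lambda>n. ?A a n - ?A b n) \<longlonglongrightarrow> f a - f b"
    by (intro tendsto_diff tent_average_tendsto[OF cf]) (use ab in auto)
  moreover have "?A a n - ?A b n = (LINT x:{0<..}|lborel. p' n x *\<^sub>R f x)" for n
    using set_integral_diff(2)[OF ti[of a n] ti[of b n]] ab
    by (simp add: p'_def scaleR_left_diff_distrib divide_inverse mult.commute del: of_nat_Suc)
  moreover have "(\<lambda>n. LINT x:{0<..}|lborel. p n x *\<^sub>R g x) \<longlonglongrightarrow> (LINT x:{a<..b}|lborel. g x)"
    unfolding set_lebesgue_integral_def
  proof (rule integral_dominated_convergence[where w="\<lambda>x. norm (indicator {0<..b+2} x *\<^sub>R g x)"])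
    have i: "set_integrable lborel {0<..b+2} g" by (rule halfline_L2_integrable_bounded[OF Lg]) auto
    then show "integrable lborel (\<lambda>x. norm (indicat_real {0<..b+2} x *\<^sub>R g x))"
      unfolding set_integrable_def by (rule integrable_norm)
    have "set_integrable lborel {a<..b} g" by (rule halfline_L2_integrable_bounded[OF Lg, of _ b]) (use ab in auto)
    then show "(\<lambda>x. indicat_real {a<..b} x *\<^sub>R g x) \<in> borel_measurable lborel"
      unfolding set_integrable_def by (rule borel_measurable_integrable)
    show "(\<lambda>x. indicat_real {0<..} x *\<^sub>R p n x *\<^sub>R g x) \<in> borel_measurable lborel" for n
      using test_function_integrable[OF t Lg] unfolding set_integrable_def by (rule borel_measurable_integrable)
    show "AE x in lborel. (\<lambda>n. indicat_real {0<..} x *\<^sub>R p n x *\<^sub>R g x)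
        \<longlonglongrightarrow> indicat_real {a<..b} x *\<^sub>R g x"
    proof (rule AE_I2)
      fix x :: real
      have r: "(\<lambda>n. ramp ((x - c) / inverse (real (Suc n)))) \<longlonglongrightarrow> (if c < x then 1 else 0)" for c
      proof (cases "c < x")
        case False
        then have "(x - c) / inverse (real (Suc n)) \<le> 1" for n
          by (auto simp: divide_inverse intro: order.trans[OF mult_nonpos_nonneg])
        then show ?thesis using False by (simp add: ramp_left)
      next
        case True
        have "filterlim (\<lambda>n. (x - c) * real (Suc n)) at_top sequentially"
          by (rule filterlim_tendsto_pos_mult_at_top[OF tendsto_const])
            (use True in \<open>auto intro: filterlim_compose[OF filterlim_real_sequentially filterlim_Suc] simp del: of_nat_Suc\<close>)
        then have "eventually (\<lambda>n. 2 \<le> (x - c) * real (Suc n)) sequentially"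
          by (simp only: filterlim_at_top)
        then have "eventually (\<lambda>n. ramp ((x - c) / inverse (real (Suc n))) = 1) sequentially"
          by eventually_elim (simp add: ramp_right divide_inverse del: of_nat_Suc)
        then show ?thesis using True by (simp add: tendsto_eventually del: of_nat_Suc)
      qed
      have "(\<lambda>n. p n x) \<longlonglongrightarrow> (if a < x then 1 else 0) - (if b < x then 1 else 0)"
        unfolding p_def by (intro tendsto_diff r)
      then have "(\<lambda>n. indicat_real {0<..} x *\<^sub>R p n x *\<^sub>R g x)
        \<longlonglongrightarrow> indicat_real {0<..} x *\<^sub>R ((if a < x then 1 else 0) - (if b < x then 1 else 0)) *\<^sub>R g x"
        by (intro tendsto_intros)
      also have "indicat_real {0<..} x *\<^sub>R ((if a < x then 1 else 0) - (if b < x then 1 else 0)) *\<^sub>R g x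
         = indicat_real {a<..b} x *\<^sub>R g x"
        using ab by (auto simp: indicator_def)
      finally show "(\<lambda>n. indicat_real {0<..} x *\<^sub>R p n x *\<^sub>R g x)
        \<longlonglongrightarrow> indicat_real {a<..b} x *\<^sub>R g x" .
    qed
    show "AE x in lborel. norm (indicat_real {0<..} x *\<^sub>R p n x *\<^sub>R g x)
       \<le> norm (indicat_real {0<..b+2} x *\<^sub>R g x)" for n
    proof (rule AE_I2)
      fix x :: real
      show "norm (indicat_real {0<..} x *\<^sub>R p n x *\<^sub>R g x) \<le> norm (indicat_real {0<..b+2} x *\<^sub>R g x)"
      proof (cases "x \<le> b + 2")
        case True
        have "\<bar>p n x\<bar> \<le> 1"
          using ramp_bounds[of "(x - a) / inverse (real (Suc n))"] ramp_bounds[of "(x - b) / inverse (real (Suc n))"]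
          unfolding p_def by linarith
        then show ?thesis using True by (auto simp: indicator_def mult_left_le_one_le)
      next
        case False
        have "1 * 2 \<le> real (Suc n) * (x - b)" "1 * 2 \<le> real (Suc n) * (x - a)"
          using False ab' by (intro mult_mono; simp)+
        then show ?thesis by (simp add: p_def ramp_right divide_inverse mult.commute del: of_nat_Suc)
      qed
    qed
  qed
  then have "(\<lambda>n. - (LINT x:{0<..}|lborel. p n x *\<^sub>R g x)) \<longlonglongrightarrow> - (LINT x:{a<..b}|lborel. g x)"
    by (rule tendsto_minus)
  ultimately have "f a - f b = - (LINT x:{a<..b}|lborel. g x)"
    using wd LIMSEQ_unique by (simp del: of_nat_Suc)
  then show ?thesis by (simp add: algebra_simps)
qed

section \<open>The chain rule and the behaviour at infinity\<close>

text \<open>Only increments of \<open>\<psi>\<close> are available, not pointwise derivatives. On a short interval the increment of \<open>\<Theta> \<circ> \<psi>\<close> is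
  linear in that of \<open>\<psi>\<close>, hence an integral of \<open>g\<close>, up to an error \<open>e * \<integral> \<bar>g\<bar>\<close>; the errors of
  adjacent intervals add up to \<open>e\<close> times the total integral of \<open>\<bar>g\<bar>\<close>.\<close>

lemma chain_rule_integral:
  fixes \<psi> g :: "real \<Rightarrow> complex" and \<Theta> :: "complex \<Rightarrow> real" and D :: "complex \<Rightarrow> complex"
  assumes c\<psi>: "continuous_on {0..R} \<psi>"
    and ig: "set_integrable lborel {0<..R} g"
    and ftc: "\<And>a b. 0 \<le> a \<Longrightarrow> a \<le> b \<Longrightarrow> b \<le> R \<Longrightarrow> \<psi> b - \<psi> a = (LINT x:{a<..b}|lborel. g x)"
    and d\<Theta>: "\<And>z. (\<Theta> has_derivative (\<lambda>h. D z \<bullet> h)) (at z)"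
    and cD: "continuous_on UNIV D"
    and R: "0 \<le> R"
  shows "set_integrable lborel {0<..R} (\<lambda>x. D (\<psi> x) \<bullet> g x)"
    and "\<Theta> (\<psi> R) - \<Theta> (\<psi> 0) = (LINT x:{0<..R}|lborel. D (\<psi> x) \<bullet> g x)"
proof -
  have cD\<psi>: "continuous_on {0..R} (\<lambda>x. D (\<psi> x))"
    by (rule continuous_on_compose2[OF cD c\<psi>]) auto
  have "bounded ((\<lambda>x. D (\<psi> x)) ` {0..R})"
    by (intro compact_imp_bounded compact_continuous_image cD\<psi>) auto
  then obtain B where B: "\<And>x. x \<in> {0..R} \<Longrightarrow> norm (D (\<psi> x)) \<le> B"
    unfolding bounded_iff by (meson imageI)
  have mD: "(\<lambda>x. indicator {0..R} x *\<^sub>R D (\<psi> x)) \<in> borel_measurable borel"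
    by (rule borel_measurable_continuous_on_indicator[OF _ cD\<psi>]) auto
  have mg: "(\<lambda>x. indicator {0<..R} x *\<^sub>R g x) \<in> borel_measurable lborel"
    using ig unfolding set_integrable_def by (rule borel_measurable_integrable)
  have "integrable lborel (\<lambda>x. B *\<^sub>R norm (indicator {0<..R} x *\<^sub>R g x))"
    using ig unfolding set_integrable_def by (intro integrable_scaleR_right integrable_norm)
  then have iR: "integrable lborel (\<lambda>x. (indicator {0..R} x *\<^sub>R D (\<psi> x)) \<bullet> (indicator {0<..R} x *\<^sub>R g x))"
  proof (rule Bochner_Integration.integrable_bound)
    show "(\<lambda>x. (indicat_real {0..R} x *\<^sub>R D (\<psi> x)) \<bullet> (indicat_real {0<..R} x *\<^sub>R g x)) \<in> borel_measurable lborel"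
      using mD mg by (intro borel_measurable_inner) simp_all
    show "AE x in lborel. norm ((indicat_real {0..R} x *\<^sub>R D (\<psi> x)) \<bullet> (indicat_real {0<..R} x *\<^sub>R g x))
      \<le> norm (B *\<^sub>R norm (indicat_real {0<..R} x *\<^sub>R g x))"
    proof (rule AE_I2)
      fix x
      show "norm ((indicat_real {0..R} x *\<^sub>R D (\<psi> x)) \<bullet> (indicat_real {0<..R} x *\<^sub>R g x))
        \<le> norm (B *\<^sub>R norm (indicat_real {0<..R} x *\<^sub>R g x))"
      proof (cases "x \<in> {0<..R}")
        case True
        have "norm (D (\<psi> x) \<bullet> g x) \<le> norm (D (\<psi> x)) * norm (g x)"
          by (simp add: Cauchy_Schwarz_ineq2)
        also have "\<dots> \<le> B * norm (g x)"
          using True by (intro mult_right_mono B) auto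
        finally have "norm (D (\<psi> x) \<bullet> g x) \<le> B * norm (g x)" .
        then show ?thesis using True by (simp add: order.trans[OF _ abs_ge_self])
      qed auto
    qed
  qed
  moreover have "(indicator {0..R} x *\<^sub>R D (\<psi> x)) \<bullet> (indicator {0<..R} x *\<^sub>R g x) = indicator {0<..R} x *\<^sub>R (D (\<psi> x) \<bullet> g x)" for x
    by (auto simp: indicator_def)
  ultimately show i: "set_integrable lborel {0<..R} (\<lambda>x. D (\<psi> x) \<bullet> g x)"
    unfolding set_integrable_def by (simp only:)
  have ig': "set_integrable lborel {a<..b} g" if "0 \<le> a" "b \<le> R" for a b
    by (rule set_integrable_subset[OF ig]) (use that in auto)
  have i': "set_integrable lborel {a<..b} (\<lambda>x. D (\<psi> x) \<bullet> g x)" if "0 \<le> a" "b \<le> R" for a b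
    by (rule set_integrable_subset[OF i]) (use that in auto)
  let ?V = "\<lambda>a b. LINT x:{a<..b}|lborel. norm (g x)"
  let ?I = "\<lambda>a b. LINT x:{a<..b}|lborel. D (\<psi> x) \<bullet> g x"
  have split: "(LINT x:{a<..c}|lborel. u x) = (LINT x:{a<..b}|lborel. u x) + (LINT x:{b<..c}|lborel. u x)"
    if "a \<le> b" "b \<le> c" "set_integrable lborel {a<..b} u" "set_integrable lborel {b<..c} u"
    for a b c and u :: "real \<Rightarrow> real"
  proof -
    have "{a<..c} = {a<..b} \<union> {b<..c}" using that by auto
    then show ?thesis using that by (simp add: set_integral_Un)
  qed
  have key: "\<bar>\<Theta> (\<psi> R) - \<Theta> (\<psi> 0) - ?I 0 R\<bar> \<le> e * ?V 0 R" if e: "0 < e" for e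
  proof -
    define P where "P = (\<lambda>a b. 0 \<le> a \<and> a \<le> b \<and> b \<le> R \<longrightarrow>
      \<bar>\<Theta> (\<psi> b) - \<Theta> (\<psi> a) - ?I a b\<bar> \<le> e * ?V a b)"
    \<comment> \<open>\<open>P\<close> is additive over adjacent intervals, so it suffices to prove it on short intervals.\<close>
    have "P 0 R"
      using R
    proof (induction rule: Bolzano)
      case (trans a b c)
      show ?case
        unfolding P_def
      proof (intro impI)
        assume "0 \<le> a \<and> a \<le> c \<and> c \<le> R"
        with trans have ineq: "0 \<le> a" "a \<le> b" "b \<le> c" "c \<le> R" by auto
        have "?I a c = ?I a b + ?I b c" "?V a c = ?V a b + ?V b c"
          by (rule split; use ineq in \<open>auto intro!: i' set_integrable_norm ig'\<close>)+
        then show "\<bar>\<Theta> (\<psi> c) - \<Theta> (\<psi> a) - ?I a c\<bar> \<le> e * ?V a c"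
          using trans(1,2) ineq by (simp add: algebra_simps P_def)
      qed
    next
      case (local x)
      have "isCont D (\<psi> x)" using cD by (simp add: continuous_on_eq_continuous_at)
      then obtain r where r: "r > 0" "\<And>z. dist z (\<psi> x) < r \<Longrightarrow> dist (D z) (D (\<psi> x)) < e / 2"
        unfolding continuous_at_eps_delta using e by (metis half_gt_zero)
      obtain d where d: "d > 0" "\<And>s. s \<in> {0..R} \<Longrightarrow> dist s x < d \<Longrightarrow> dist (\<psi> s) (\<psi> x) < r"
        using c\<psi> local r(1) unfolding continuous_on_iff by (metis atLeastAtMost_iff)
      show ?case
        unfolding P_def
      proof (intro exI[of _ d] conjI allI impI d)
        fix a b assume ab: "a \<le> x \<and> x \<le> b \<and> b - a < d" and "0 \<le> a \<and> a \<le> b \<and> b \<le> R"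
        then have ab': "0 \<le> a" "a \<le> b" "b \<le> R" by auto
        have near: "dist (\<psi> s) (\<psi> x) < r" if "a \<le> s" "s \<le> b" for s
          using that ab ab' by (intro d) (auto simp: dist_real_def)
        have ball: "convex (ball (\<psi> x) r)" by simp
        have 1: "\<bar>\<Theta> (\<psi> b) - \<Theta> (\<psi> a) - D (\<psi> x) \<bullet> (\<psi> b - \<psi> a)\<bar> \<le> norm (\<psi> b - \<psi> a) * (e / 2)"
          unfolding real_norm_def[symmetric]
        proof (rule differentiable_bound_linearization[where S="ball (\<psi> x) r" and f'="\<lambda>z h. D z \<bullet> h" and ?x0.0="\<psi> x"])
          show "\<psi> a + t *\<^sub>R (\<psi> b - \<psi> a) \<in> ball (\<psi> x) r" if "t \<in> {0..1}" for t
          proof -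
            have "(1 - t) *\<^sub>R \<psi> a + t *\<^sub>R \<psi> b \<in> ball (\<psi> x) r"
              by (rule convexD[OF ball]) (use that near ab' in \<open>auto simp: dist_commute\<close>)
            then show ?thesis by (simp add: algebra_simps)
          qed
          show "(\<Theta> has_derivative (\<lambda>h. D z \<bullet> h)) (at z within ball (\<psi> x) r)" for z
            by (rule has_derivative_at_withinI[OF d\<Theta>])
          show "onorm ((\<lambda>h. D z \<bullet> h) - (\<lambda>h. D (\<psi> x) \<bullet> h)) \<le> e / 2" if "z \<in> ball (\<psi> x) r" for z
          proof (rule onorm_bound)
            show "0 \<le> e / 2" using e by simp
            fix h
            have "norm ((D z - D (\<psi> x)) \<bullet> h) \<le> norm (D z - D (\<psi> x)) * norm h"
              by (simp add: Cauchy_Schwarz_ineq2)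
            also have "\<dots> \<le> e / 2 * norm h"
              using r(2)[of z] that by (intro mult_right_mono) (auto simp: dist_norm norm_minus_commute dist_commute)
            finally show "norm (((\<lambda>h. D z \<bullet> h) - (\<lambda>h. D (\<psi> x) \<bullet> h)) h) \<le> e / 2 * norm h"
              by (simp add: inner_diff_left)
          qed
        qed (use r in auto)
        have V: "norm (\<psi> b - \<psi> a) \<le> ?V a b"
          unfolding ftc[OF ab'] by (rule set_integral_norm_bound[OF ig']) (use ab' in auto)
        have 2: "\<bar>D (\<psi> x) \<bullet> (\<psi> b - \<psi> a) - ?I a b\<bar> \<le> e / 2 * ?V a b"
        proof -
          have "D (\<psi> x) \<bullet> (\<psi> b - \<psi> a) = (LINT s:{a<..b}|lborel. D (\<psi> x) \<bullet> g s)"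
            unfolding ftc[OF ab'] set_lebesgue_integral_def
            using ig'[of a b] ab' by (simp add: set_integrable_def integral_inner_right[symmetric])
          moreover have ii: "set_integrable lborel {a<..b} (\<lambda>s. D (\<psi> x) \<bullet> g s)"
            using ig'[of a b] ab' unfolding set_integrable_def
            by (simp flip: inner_scaleR_right)
          ultimately have "D (\<psi> x) \<bullet> (\<psi> b - \<psi> a) - ?I a b = (LINT s:{a<..b}|lborel. D (\<psi> x) \<bullet> g s - D (\<psi> s) \<bullet> g s)"
            using i' ab' by (simp add: set_integral_diff)
          also have "\<bar>\<dots>\<bar> \<le> (LINT s:{a<..b}|lborel. norm (D (\<psi> x) \<bullet> g s - D (\<psi> s) \<bullet> g s))"
            unfolding real_norm_def[symmetric]
            by (rule set_integral_norm_bound) (use ii i' ab' in \<open>auto intro: set_integral_diff\<close>)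
          also have "\<dots> \<le> (LINT s:{a<..b}|lborel. e / 2 * norm (g s))"
          proof (rule set_integral_mono)
            show "set_integrable lborel {a<..b} (\<lambda>s. norm (D (\<psi> x) \<bullet> g s - D (\<psi> s) \<bullet> g s))"
              by (rule set_integrable_norm) (use ii i' ab' in \<open>auto intro: set_integral_diff\<close>)
            show "set_integrable lborel {a<..b} (\<lambda>s. e / 2 * norm (g s))"
              by (intro set_integrable_mult_right set_integrable_norm ig') (use ab' in auto)
            fix s assume s: "s \<in> {a<..b}"
            have "norm ((D (\<psi> x) - D (\<psi> s)) \<bullet> g s) \<le> norm (D (\<psi> x) - D (\<psi> s)) * norm (g s)"
              by (simp add: Cauchy_Schwarz_ineq2)
            also have "\<dots> \<le> e / 2 * norm (g s)"
              using r(2)[OF near[of s]] s by (intro mult_right_mono) (auto simp: dist_norm norm_minus_commute)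
            finally show "norm (D (\<psi> x) \<bullet> g s - D (\<psi> s) \<bullet> g s) \<le> e / 2 * norm (g s)"
              by (simp add: inner_diff_left)
          qed
          also have "\<dots> = e / 2 * ?V a b" by simp
          finally show ?thesis .
        qed
        have "norm (\<psi> b - \<psi> a) * (e / 2) \<le> e / 2 * ?V a b"
          using V e by (simp add: mult.commute mult_left_mono)
        with 1 2 show "\<bar>\<Theta> (\<psi> b) - \<Theta> (\<psi> a) - ?I a b\<bar> \<le> e * ?V a b" by linarith
      qed
    qed
    then show ?thesis using R by (simp add: P_def)
  qed
  have "\<bar>\<Theta> (\<psi> R) - \<Theta> (\<psi> 0) - ?I 0 R\<bar> \<le> 0"
  proof (rule field_le_epsilon)
    fix e :: real assume e: "0 < e"
    have V: "0 \<le> ?V 0 R" by (simp add: set_lebesgue_integral_def Bochner_Integration.integral_nonneg)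
    have "\<bar>\<Theta> (\<psi> R) - \<Theta> (\<psi> 0) - ?I 0 R\<bar> \<le> e / (1 + ?V 0 R) * ?V 0 R"
      by (rule key) (use e V in auto)
    also have "\<dots> = e * (?V 0 R / (1 + ?V 0 R))" by simp
    also have "\<dots> \<le> e * 1"
      using e V by (intro mult_left_mono) auto
    finally show "\<bar>\<Theta> (\<psi> R) - \<Theta> (\<psi> 0) - ?I 0 R\<bar> \<le> 0 + e" by simp
  qed
  then show "\<Theta> (\<psi> R) - \<Theta> (\<psi> 0) = ?I 0 R" by simp
qed

lemma set_integral_mono_subset:
  fixes f :: "_ \<Rightarrow> real"
  assumes f: "set_integrable M B f" and A: "A \<in> sets M" "A \<subseteq> B" and nonneg: "\<And>x. x \<in> B \<Longrightarrow> 0 \<le> f x"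
  shows "(LINT x:A|M. f x) \<le> (LINT x:B|M. f x)"
proof -
  have "set_integrable M A f" using f A by (rule set_integrable_subset)
  with f show ?thesis
    unfolding set_integrable_def set_lebesgue_integral_def
    by (intro integral_mono) (use A nonneg in \<open>auto simp: indicator_def\<close>)
qed

lemma halfline_integral_limit:
  fixes u :: "real \<Rightarrow> real"
  assumes u: "set_integrable lborel {0<..} u"
  shows "((\<lambda>R. LINT x:{0<..R}|lborel. u x) \<longlongrightarrow> (LINT x:{0<..}|lborel. u x)) at_top"
proof (rule tendsto_at_topI_sequentially)
  fix X :: "nat \<Rightarrow> real" assume X: "filterlim X at_top sequentially"
  show "(\<lambda>n. LINT x:{0<..X n}|lborel. u x) \<longlonglongrightarrow> (LINT x:{0<..}|lborel. u x)"
    unfolding set_lebesgue_integral_def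
  proof (rule integral_dominated_convergence[where w="\<lambda>x. norm (indicator {0<..} x *\<^sub>R u x)"])
    show "integrable lborel (\<lambda>x. norm (indicat_real {0<..} x *\<^sub>R u x))"
      using u unfolding set_integrable_def by (rule integrable_norm)
    show "(\<lambda>x. indicat_real {0<..} x *\<^sub>R u x) \<in> borel_measurable lborel"
      using u unfolding set_integrable_def by (rule borel_measurable_integrable)
    show "(\<lambda>x. indicat_real {0<..X n} x *\<^sub>R u x) \<in> borel_measurable lborel" for n
      by (rule borel_measurable_integrable)
        (use set_integrable_subset[OF u, of "{0<..X n}"] in \<open>auto simp: set_integrable_def greaterThanAtMost_def\<close>)
    show "AE x in lborel. (\<lambda>n. indicat_real {0<..X n} x *\<^sub>R u x) \<longlonglongrightarrow> indicat_real {0<..} x *\<^sub>R u x"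
    proof (rule AE_I2)
      fix x
      have "eventually (\<lambda>n. x \<le> X n) sequentially" using X by (simp add: filterlim_at_top)
      then have "eventually (\<lambda>n. indicat_real {0<..X n} x *\<^sub>R u x = indicat_real {0<..} x *\<^sub>R u x) sequentially"
        by eventually_elim (auto simp: indicator_def)
      then show "(\<lambda>n. indicat_real {0<..X n} x *\<^sub>R u x) \<longlonglongrightarrow> indicat_real {0<..} x *\<^sub>R u x"
        by (rule tendsto_eventually)
    qed
  qed (auto simp: indicator_def)
qed

lemma halfline_L2_dominated:
  fixes f u :: "real \<Rightarrow> complex"
  assumes f: "halfline_L2 f" and u: "continuous_on {0..} u"
    and b: "\<And>x. 0 \<le> x \<Longrightarrow> norm (u x) \<le> C * norm (f x)"
  shows "halfline_L2 u"
proof -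
  have i: "set_integrable lborel {0<..} (\<lambda>x. C\<^sup>2 * norm (f x) ^ 2)"
    using f by (auto simp: halfline_L2_def)
  have "(\<lambda>x. indicator {0<..} x *\<^sub>R u x) \<in> borel_measurable borel"
    by (rule borel_measurable_continuous_on_indicator[OF _ continuous_on_subset[OF u]]) auto
  then have m: "set_borel_measurable lborel {0<..} u" by (simp add: set_borel_measurable_def)
  have "set_integrable lborel {0<..} (\<lambda>x. norm (u x) ^ 2)"
  proof (rule set_integrable_bound[OF i])
    have "(\<lambda>x. (norm (indicator {0<..} x *\<^sub>R u x))\<^sup>2) \<in> borel_measurable lborel"
      using m unfolding set_borel_measurable_def by measurable
    moreover have "(norm (indicator {0<..} x *\<^sub>R u x))\<^sup>2 = indicator {0<..} x *\<^sub>R norm (u x) ^ 2" for x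
      by (auto simp: indicator_def)
    ultimately show "set_borel_measurable lborel {0<..} (\<lambda>x. norm (u x) ^ 2)"
      by (simp only: set_borel_measurable_def)
    show "AE x in lborel. x \<in> {0<..} \<longrightarrow> norm ((cmod (u x))\<^sup>2) \<le> norm (C\<^sup>2 * (cmod (f x))\<^sup>2)"
    proof (intro AE_I2 impI)
      fix x :: real assume "x \<in> {0<..}"
      then have "(norm (u x))\<^sup>2 \<le> (C * norm (f x))\<^sup>2" by (intro power_mono b) auto
      then show "norm ((cmod (u x))\<^sup>2) \<le> norm (C\<^sup>2 * (cmod (f x))\<^sup>2)"
        by (simp add: power_mult_distrib abs_mult)
    qed
  qed
  with m show ?thesis by (simp add: halfline_L2_def)
qed

lemma halfline_L2_inner_integrable:
  assumes f: "halfline_L2 f" and g: "halfline_L2 g"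
  shows "set_integrable lborel {0<..} (\<lambda>x. f x \<bullet> g x)"
proof -
  have m: "set_borel_measurable lborel {0<..} f" "set_borel_measurable lborel {0<..} g"
    and i: "set_integrable lborel {0<..} (\<lambda>x. norm (f x) ^ 2 + norm (g x) ^ 2)"
    using assms by (auto simp: halfline_L2_def intro!: set_integral_add)
  show ?thesis
  proof (rule set_integrable_bound[OF i])
    have "(\<lambda>x. (indicator {0<..} x *\<^sub>R f x) \<bullet> (indicator {0<..} x *\<^sub>R g x)) \<in> borel_measurable lborel"
      using m unfolding set_borel_measurable_def by (intro borel_measurable_inner)
    moreover have "(indicator {0<..} x *\<^sub>R f x) \<bullet> (indicator {0<..} x *\<^sub>R g x) = indicator {0<..} x *\<^sub>R (f x \<bullet> g x)" for x
      by (auto simp: indicator_def)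
    ultimately show "set_borel_measurable lborel {0<..} (\<lambda>x. f x \<bullet> g x)"
      by (simp only: set_borel_measurable_def)
    have "\<bar>f x \<bullet> g x\<bar> \<le> norm (f x) ^ 2 + norm (g x) ^ 2" for x
    proof -
      have "\<bar>f x \<bullet> g x\<bar> \<le> norm (f x) * norm (g x)" by (rule Cauchy_Schwarz_ineq2)
      moreover have "2 * (norm (f x) * norm (g x)) \<le> norm (f x) ^ 2 + norm (g x) ^ 2"
        using sum_squares_bound[of "norm (f x)" "norm (g x)"] by simp
      moreover have "0 \<le> norm (f x) * norm (g x)" by simp
      ultimately show ?thesis by linarith
    qed
    then show "AE x in lborel. x \<in> {0<..} \<longrightarrow> norm (f x \<bullet> g x) \<le> norm (norm (f x) ^ 2 + norm (g x) ^ 2)"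
      by (intro AE_I2 impI) (simp only: real_norm_def, rule order.trans[OF _ abs_ge_self])
  qed
qed

lemma norm_squared_derivative: "((\<lambda>z::complex. (norm z)\<^sup>2) has_derivative (\<lambda>h. (2 *\<^sub>R z) \<bullet> h)) (at z)"
  unfolding power2_norm_eq_inner by (auto intro!: derivative_eq_intros simp: inner_commute)

lemma weak_deriv_chain_interval:
  assumes w: "has_weak_deriv \<psi> g" and c: "continuous_on {0..} \<psi>"
    and d: "\<And>z. (\<Theta> has_derivative (\<lambda>h. D z \<bullet> h)) (at z)" and cD: "continuous_on UNIV D"
    and R: "0 \<le> R"
  shows "\<Theta> (\<psi> R) - \<Theta> (\<psi> 0) = (LINT x:{0<..R}|lborel. D (\<psi> x) \<bullet> g x)"
  by (rule chain_rule_integral(2)[OF continuous_on_subset[OF c] _ _ d cD R])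
    (use w in \<open>auto simp: has_weak_deriv_def intro!: halfline_L2_integrable_bounded has_weak_deriv_FTC[OF w c]\<close>)

text \<open>The derivative of \<open>(norm \<psi>)\<^sup>2\<close> is integrable, so the limit exists; a positive limit would contradict the
  integrability of \<open>(norm \<psi>)\<^sup>2\<close> itself.\<close>

lemma weak_deriv_decay:
  assumes w: "has_weak_deriv \<psi> g" and c: "continuous_on {0..} \<psi>"
  shows "((\<lambda>R. (norm (\<psi> R))\<^sup>2) \<longlongrightarrow> 0) at_top"
proof -
  have L: "halfline_L2 \<psi>" "halfline_L2 g" using w by (auto simp: has_weak_deriv_def)
  have i: "set_integrable lborel {0<..} (\<lambda>x. (2 *\<^sub>R \<psi> x) \<bullet> g x)"
    using set_integrable_mult_right[of 2, OF halfline_L2_inner_integrable[OF L]] by simp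
  have iq: "set_integrable lborel {0<..} (\<lambda>x. (norm (\<psi> x))\<^sup>2)" using L by (simp add: halfline_L2_def)
  define l where "l = (norm (\<psi> 0))\<^sup>2 + (LINT x:{0<..}|lborel. (2 *\<^sub>R \<psi> x) \<bullet> g x)"
  have "((\<lambda>R. (norm (\<psi> 0))\<^sup>2 + (LINT x:{0<..R}|lborel. (2 *\<^sub>R \<psi> x) \<bullet> g x)) \<longlongrightarrow> l) at_top"
    unfolding l_def by (intro tendsto_intros halfline_integral_limit[OF i])
  moreover have "eventually (\<lambda>R. (norm (\<psi> 0))\<^sup>2 + (LINT x:{0<..R}|lborel. (2 *\<^sub>R \<psi> x) \<bullet> g x) = (norm (\<psi> R))\<^sup>2) at_top"
    using eventually_ge_at_top[of 0]
  proof eventually_elim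
    case (elim R)
    show ?case
      using weak_deriv_chain_interval[OF w c norm_squared_derivative _ elim]
      by (simp add: continuous_intros)
  qed
  ultimately have lim: "((\<lambda>R. (norm (\<psi> R))\<^sup>2) \<longlongrightarrow> l) at_top"
    by (rule Lim_transform_eventually)
  have "l = 0"
  proof (rule ccontr)
    assume "l \<noteq> 0"
    moreover have "0 \<le> l" by (rule tendsto_lowerbound[OF lim]) auto
    ultimately have "l / 2 < l" "0 < l" by auto
    then have "eventually (\<lambda>R. l / 2 < (norm (\<psi> R))\<^sup>2) at_top"
      using lim order_tendstoD(1) by blast
    then obtain r where r: "\<And>x. r \<le> x \<Longrightarrow> l / 2 < (norm (\<psi> x))\<^sup>2"
      by (auto simp: eventually_at_top_linorder)
    define a where "a = max r 0"
    let ?I = "LINT x:{0<..}|lborel. (norm (\<psi> x))\<^sup>2"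
    obtain n :: nat where n: "?I / (l / 2) < real n" using reals_Archimedean2 by blast
    have ic: "set_integrable lborel {a<..a + real n} (\<lambda>x. l / 2)"
      by (rule set_integrable_subset[of _ "{a..a + real n}"]) (auto intro!: borel_integrable_atLeastAtMost')
    have "real n * (l / 2) = (LINT x:{a<..a + real n}|lborel. l / 2)"
      by (simp add: set_lebesgue_integral_def)
    also have "\<dots> \<le> (LINT x:{a<..a + real n}|lborel. (norm (\<psi> x))\<^sup>2)"
    proof (rule set_integral_mono[OF ic set_integrable_subset[OF iq]])
      show "l / 2 \<le> (norm (\<psi> x))\<^sup>2" if "x \<in> {a<..a + real n}" for x
        using r[of x] that by (simp add: a_def)
    qed (auto simp: a_def)
    also have "\<dots> \<le> ?I"
      by (rule set_integral_mono_subset[OF iq]) (auto simp: a_def)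
    finally show False using n \<open>0 < l\<close> by (simp add: field_simps)
  qed
  then show ?thesis using lim by simp
qed

lemma weak_deriv_chain_halfline:
  assumes w: "has_weak_deriv \<psi> g" and c: "continuous_on {0..} \<psi>"
    and d: "\<And>z. (\<Theta> has_derivative (\<lambda>h. D z \<bullet> h)) (at z)" and cD: "continuous_on UNIV D"
    and b: "\<And>x. 0 \<le> x \<Longrightarrow> norm (D (\<psi> x)) \<le> C * norm (\<psi> x)" and z: "\<Theta> 0 = 0"
  shows "set_integrable lborel {0<..} (\<lambda>x. D (\<psi> x) \<bullet> g x)"
    and "(LINT x:{0<..}|lborel. D (\<psi> x) \<bullet> g x) = - \<Theta> (\<psi> 0)"
proof -
  have L: "halfline_L2 \<psi>" "halfline_L2 g" using w by (auto simp: has_weak_deriv_def)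
  have "continuous_on {0..} (\<lambda>x. D (\<psi> x))" by (rule continuous_on_compose2[OF cD c]) auto
  then show i: "set_integrable lborel {0<..} (\<lambda>x. D (\<psi> x) \<bullet> g x)"
    by (intro halfline_L2_inner_integrable L halfline_L2_dominated[OF L(1) _ b])
  have "((\<lambda>R. norm (\<psi> R)) \<longlongrightarrow> 0) at_top"
    using tendsto_real_sqrt[OF weak_deriv_decay[OF w c]] by simp
  then have "(\<psi> \<longlongrightarrow> 0) at_top" by (rule tendsto_norm_zero_cancel)
  moreover have "isCont \<Theta> 0" using has_derivative_continuous[OF d] .
  ultimately have "((\<lambda>R. \<Theta> (\<psi> R)) \<longlongrightarrow> \<Theta> 0) at_top" by (rule isCont_tendsto_compose[rotated])
  then have "((\<lambda>R. \<Theta> (\<psi> R) - \<Theta> (\<psi> 0)) \<longlongrightarrow> - \<Theta> (\<psi> 0)) at_top"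
    using z by (auto intro!: tendsto_eq_intros)
  moreover have "eventually (\<lambda>R. \<Theta> (\<psi> R) - \<Theta> (\<psi> 0) = (LINT x:{0<..R}|lborel. D (\<psi> x) \<bullet> g x)) at_top"
    using eventually_ge_at_top[of 0] by eventually_elim (rule weak_deriv_chain_interval[OF w c d cD])
  ultimately have "((\<lambda>R. LINT x:{0<..R}|lborel. D (\<psi> x) \<bullet> g x) \<longlongrightarrow> - \<Theta> (\<psi> 0)) at_top"
    by (rule Lim_transform_eventually)
  with halfline_integral_limit[OF i]
  show "(LINT x:{0<..}|lborel. D (\<psi> x) \<bullet> g x) = - \<Theta> (\<psi> 0)"
    by (rule tendsto_unique[OF trivial_limit_at_top_linorder])
qed

text \<open>Integrate the derivative \<open>2 \<psi> \<bullet> g\<close> of \<open>(norm \<psi>)\<^sup>2\<close> from \<open>x\<close> to infinity, where \<open>\<psi>\<close> vanishes. This is the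
  embedding of \<open>H\<^sup>1\<close> into the continuous functions, by which closeness in \<open>H\<^sup>1\<close> controls all point values.\<close>

lemma weak_deriv_sup_bound:
  assumes w: "has_weak_deriv \<psi> g" and c: "continuous_on {0..} \<psi>" and x: "0 \<le> x"
  shows "(norm (\<psi> x))\<^sup>2 \<le> (LINT s:{0<..}|lborel. (norm (\<psi> s))\<^sup>2) + (LINT s:{0<..}|lborel. (norm (g s))\<^sup>2)"
proof -
  have L: "halfline_L2 \<psi>" "halfline_L2 g" using w by (auto simp: has_weak_deriv_def)
  let ?u = "\<lambda>x. (2 *\<^sub>R \<psi> x) \<bullet> g x" and ?v = "\<lambda>s. (norm (\<psi> s))\<^sup>2 + (norm (g s))\<^sup>2"
  have i: "set_integrable lborel {0<..} ?u"
    using set_integrable_mult_right[of 2, OF halfline_L2_inner_integrable[OF L]] by simp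
  have iv: "set_integrable lborel {0<..} ?v" using L by (auto simp: halfline_L2_def intro!: set_integral_add)
  let ?I = "LINT s:{0<..}|lborel. ?v s"
  have "eventually (\<lambda>R. (norm (\<psi> x))\<^sup>2 \<le> (norm (\<psi> R))\<^sup>2 + ?I) at_top"
    using eventually_ge_at_top[of x]
  proof eventually_elim
    case (elim R)
    then have R: "0 \<le> R" using x by simp
    have ch: "(norm (\<psi> r))\<^sup>2 - (norm (\<psi> 0))\<^sup>2 = (LINT s:{0<..r}|lborel. ?u s)" if "0 \<le> r" for r
      using weak_deriv_chain_interval[OF w c norm_squared_derivative _ that]
      by (simp add: continuous_intros)
    have iR: "set_integrable lborel {x<..R} ?u" and ix: "set_integrable lborel {0<..x} ?u"
      and ivR: "set_integrable lborel {x<..R} ?v"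
      by (rule set_integrable_subset[OF i] set_integrable_subset[OF iv]; use x in auto)+
    have "{0<..R} = {0<..x} \<union> {x<..R}" using x elim by auto
    then have "(LINT s:{0<..R}|lborel. ?u s) = (LINT s:{0<..x}|lborel. ?u s) + (LINT s:{x<..R}|lborel. ?u s)"
      using iR ix by (simp add: set_integral_Un)
    then have "(norm (\<psi> x))\<^sup>2 = (norm (\<psi> R))\<^sup>2 - (LINT s:{x<..R}|lborel. ?u s)"
      using ch[OF x] ch[OF R] by linarith
    moreover have "- (LINT s:{x<..R}|lborel. ?u s) \<le> (LINT s:{x<..R}|lborel. ?v s)"
    proof -
      have "- (LINT s:{x<..R}|lborel. ?u s) \<le> \<bar>LINT s:{x<..R}|lborel. ?u s\<bar>" by simp
      also have "\<dots> \<le> (LINT s:{x<..R}|lborel. norm (?u s))"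
        unfolding real_norm_def[symmetric] by (rule set_integral_norm_bound[OF iR])
      also have "\<dots> \<le> (LINT s:{x<..R}|lborel. ?v s)"
      proof (rule set_integral_mono[OF set_integrable_norm[OF iR] ivR])
        fix s
        have "\<bar>\<psi> s \<bullet> g s\<bar> \<le> norm (\<psi> s) * norm (g s)" by (rule Cauchy_Schwarz_ineq2)
        then show "norm (?u s) \<le> ?v s"
          using sum_squares_bound[of "norm (\<psi> s)" "norm (g s)"] by (simp add: abs_mult)
      qed
      finally show ?thesis .
    qed
    moreover have "(LINT s:{x<..R}|lborel. ?v s) \<le> ?I"
      by (rule set_integral_mono_subset[OF iv]) (use x in auto)
    ultimately show ?case by linarith
  qed
  moreover have "((\<lambda>R. (norm (\<psi> R))\<^sup>2 + ?I) \<longlongrightarrow> 0 + ?I) at_top"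
    by (intro tendsto_intros weak_deriv_decay[OF w c])
  ultimately have "(norm (\<psi> x))\<^sup>2 \<le> 0 + ?I"
    by (intro tendsto_lowerbound[of "\<lambda>R. (norm (\<psi> R))\<^sup>2 + ?I"]) auto
  also have "?I = (LINT s:{0<..}|lborel. (norm (\<psi> s))\<^sup>2) + (LINT s:{0<..}|lborel. (norm (g s))\<^sup>2)"
    using L by (intro set_integral_add(2)) (auto simp: halfline_L2_def)
  finally show ?thesis by simp
qed

section \<open>Completing the square on the halfline\<close>

text \<open>The soliton of frequency \<open>\<nu>\<close> solves \<open>\<psi>' = - decay_rate \<mu> \<nu> (\<psi>\<^sup>2) \<psi>\<close> where it decreases (conservation of
  the energy of the associated Newton equation, at level zero). The rate is a function of the squared modulus
  because the latter is smooth at \<open>\<psi> = 0\<close>.\<close>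

definition decay_rate :: "real \<Rightarrow> real \<Rightarrow> real \<Rightarrow> real" where
  "decay_rate \<mu> \<nu> t = sqrt (\<nu> - t powr \<mu> / (\<mu> + 1))"

definition soliton_action :: "real \<Rightarrow> real \<Rightarrow> real \<Rightarrow> real" where
  "soliton_action \<mu> \<nu> t = integral {0..t} (decay_rate \<mu> \<nu>)"

lemma continuous_on_decay_rate:
  assumes "0 < \<mu>" shows "continuous_on {0..} (decay_rate \<mu> \<nu>)"
  unfolding decay_rate_def[abs_def]
  by (intro continuous_intros continuous_on_powr') (use assms in auto)

lemma soliton_action_0 [simp]: "soliton_action \<mu> \<nu> 0 = 0"
  by (simp add: soliton_action_def)

lemma soliton_action_deriv:
  assumes \<mu>: "0 < \<mu>" and t: "0 \<le> t"
  shows "(soliton_action \<mu> \<nu> has_real_derivative decay_rate \<mu> \<nu> t) (at t within {0..})"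
proof -
  have "(soliton_action \<mu> \<nu> has_real_derivative decay_rate \<mu> \<nu> t) (at t within {0..t + 1})"
    unfolding soliton_action_def[abs_def]
    by (rule integral_has_real_derivative)
      (use t in \<open>auto intro: continuous_on_subset[OF continuous_on_decay_rate[OF \<mu>]]\<close>)
  moreover have "at t within {0..t + 1} = at t within {0..}"
    by (rule at_within_nhd[of _ "{..<t + 1}"]) (use t in auto)
  ultimately show ?thesis by simp
qed

text \<open>The gradient is a scalar multiple of \<open>z\<close>, which identifies the cross term in
  \<open>\<bar>\<psi>' + q \<psi>\<bar>\<^sup>2\<close> as the derivative of \<open>soliton_action \<mu> \<nu> (\<bar>\<psi>\<bar>\<^sup>2)\<close>.\<close>

lemma soliton_action_norm_derivative:
  fixes z :: complex
  assumes \<mu>: "0 < \<mu>"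
  shows "((\<lambda>z. soliton_action \<mu> \<nu> ((norm z)\<^sup>2)) has_derivative
           (\<lambda>h. ((2 * decay_rate \<mu> \<nu> ((norm z)\<^sup>2)) *\<^sub>R z) \<bullet> h)) (at z)"
proof -
  have "(soliton_action \<mu> \<nu> has_derivative (*) (decay_rate \<mu> \<nu> ((norm z)\<^sup>2)))
      (at ((norm z)\<^sup>2) within (\<lambda>z. (norm z)\<^sup>2) ` UNIV)"
    by (rule has_derivative_subset[OF soliton_action_deriv[OF \<mu>, unfolded has_field_derivative_def]]) auto
  from has_derivative_in_compose[OF norm_squared_derivative this]
  show ?thesis by (simp add: algebra_simps)
qed

text \<open>The bound on the modulus makes the radicand of the decay rate nonnegative, so that the square of the rate
  reproduces \<open>\<nu> - \<bar>\<psi>\<bar>\<^bsup>2\<mu>\<^esup> / (\<mu> + 1)\<close>; the cross term integrates to the value at the origin.\<close>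

lemma halfline_completing_square:
  assumes \<mu>: "0 < \<mu>" and w: "has_weak_deriv \<psi> g" and c: "continuous_on {0..} \<psi>"
    and b: "\<And>x. 0 \<le> x \<Longrightarrow> norm (\<psi> x) powr (2 * \<mu>) \<le> (\<mu> + 1) * \<nu>"
  defines "R \<equiv> \<lambda>x. g x + decay_rate \<mu> \<nu> ((norm (\<psi> x))\<^sup>2) *\<^sub>R \<psi> x"
  shows "halfline_L2 R"
    and "(LINT x:{0<..}|lborel. (norm (g x))\<^sup>2) + \<nu> * (LINT x:{0<..}|lborel. (norm (\<psi> x))\<^sup>2)
       - (LINT x:{0<..}|lborel. norm (\<psi> x) powr (2 * \<mu> + 2)) / (\<mu> + 1)
       = (LINT x:{0<..}|lborel. (norm (R x))\<^sup>2) + soliton_action \<mu> \<nu> ((norm (\<psi> 0))\<^sup>2)"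
proof -
  have L: "halfline_L2 \<psi>" "halfline_L2 g" using w by (auto simp: has_weak_deriv_def)
  define q where "q = (\<lambda>z::complex. decay_rate \<mu> \<nu> ((norm z)\<^sup>2))"
  have pw: "((norm z)\<^sup>2) powr \<mu> = norm z powr (2 * \<mu>)" for z :: complex
    by (cases "z = 0") (simp_all add: powr_powr flip: powr_numeral)
  have cq: "continuous_on UNIV q"
    unfolding q_def by (rule continuous_on_compose2[OF continuous_on_decay_rate[OF \<mu>]])
      (auto intro!: continuous_intros)
  have rad: "0 \<le> \<nu> - norm (\<psi> x) powr (2 * \<mu>) / (\<mu> + 1)" if "0 \<le> x" for x
    using b[OF that] \<mu> by (simp add: field_simps)
  have q2: "(q (\<psi> x))\<^sup>2 = \<nu> - norm (\<psi> x) powr (2 * \<mu>) / (\<mu> + 1)" if "0 \<le> x" for x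
    using rad[OF that] by (simp add: q_def decay_rate_def pw)
  have qb: "0 \<le> q (\<psi> x)" "q (\<psi> x) \<le> sqrt \<nu>" if "0 \<le> x" for x
    using rad[OF that] \<mu> by (auto simp: q_def decay_rate_def pw)
  have Lq: "halfline_L2 (\<lambda>x. q (\<psi> x) *\<^sub>R \<psi> x)"
    by (rule halfline_L2_dominated[OF L(1), of _ "sqrt \<nu>"])
      (use qb in \<open>auto intro!: continuous_intros c continuous_on_compose2[OF cq c] mult_right_mono\<close>)
  have R: "R = (\<lambda>x. g x - - (q (\<psi> x) *\<^sub>R \<psi> x))" by (simp add: R_def q_def)
  have "halfline_L2 (\<lambda>x. - (q (\<psi> x) *\<^sub>R \<psi> x))"
    by (rule halfline_L2_dominated[OF L(1), of _ "sqrt \<nu>"])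
      (use qb in \<open>auto intro!: continuous_intros c continuous_on_compose2[OF cq c] mult_right_mono\<close>)
  then show LR: "halfline_L2 R" unfolding R by (intro halfline_L2_diff L)
  let ?D = "\<lambda>z::complex. (2 * decay_rate \<mu> \<nu> ((norm z)\<^sup>2)) *\<^sub>R z"
  have cD: "continuous_on UNIV ?D"
    using cq unfolding q_def by (intro continuous_on_scaleR continuous_on_mult continuous_on_const continuous_on_id)
  have bD: "norm (?D (\<psi> x)) \<le> (2 * sqrt \<nu>) * norm (\<psi> x)" if "0 \<le> x" for x
    using qb[OF that] by (auto simp: q_def abs_mult intro!: mult_right_mono)
  note ch = weak_deriv_chain_halfline[OF w c soliton_action_norm_derivative[OF \<mu>] cD bD]
  have i1: "set_integrable lborel {0<..} (\<lambda>x. (norm (g x))\<^sup>2)"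
    and i2: "set_integrable lborel {0<..} (\<lambda>x. (norm (\<psi> x))\<^sup>2)"
    and i3: "set_integrable lborel {0<..} (\<lambda>x. (norm (R x))\<^sup>2)"
    and i4: "set_integrable lborel {0<..} (\<lambda>x. ?D (\<psi> x) \<bullet> g x)"
    using L LR ch(1) by (auto simp: halfline_L2_def)
  have p: "norm (\<psi> x) powr (2 * \<mu> + 2) / (\<mu> + 1) = \<nu> * (norm (\<psi> x))\<^sup>2 + (norm (g x))\<^sup>2 + ?D (\<psi> x) \<bullet> g x
      - (norm (R x))\<^sup>2" if "0 < x" for x
  proof -
    have Rq: "R x = g x + q (\<psi> x) *\<^sub>R \<psi> x" by (simp add: R_def q_def)
    have "(norm (R x))\<^sup>2 = (norm (g x))\<^sup>2 + 2 * q (\<psi> x) * (\<psi> x \<bullet> g x) + (q (\<psi> x))\<^sup>2 * (norm (\<psi> x))\<^sup>2"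
      unfolding Rq power2_norm_eq_inner
      by (simp add: inner_add_left inner_add_right power2_eq_square inner_commute algebra_simps)
    moreover have "norm (\<psi> x) powr (2 * \<mu> + 2) = norm (\<psi> x) powr (2 * \<mu>) * (norm (\<psi> x))\<^sup>2"
      by (simp add: powr_add)
    ultimately show ?thesis
      using arg_cong[OF q2[of x], of "\<lambda>v. v * (norm (\<psi> x))\<^sup>2"] that by (simp add: q_def algebra_simps)
  qed
  have "(LINT x:{0<..}|lborel. norm (\<psi> x) powr (2 * \<mu> + 2)) / (\<mu> + 1) =
        (LINT x:{0<..}|lborel. norm (\<psi> x) powr (2 * \<mu> + 2) / (\<mu> + 1))"
    by simp
  also have "\<dots> = (LINT x:{0<..}|lborel. \<nu> * (norm (\<psi> x))\<^sup>2 + (norm (g x))\<^sup>2 + ?D (\<psi> x) \<bullet> g x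
      - (norm (R x))\<^sup>2)"
    by (rule set_lebesgue_integral_cong) (use p in auto)
  also have "\<dots> = \<nu> * (LINT x:{0<..}|lborel. (norm (\<psi> x))\<^sup>2) + (LINT x:{0<..}|lborel. (norm (g x))\<^sup>2)
      + (LINT x:{0<..}|lborel. ?D (\<psi> x) \<bullet> g x) - (LINT x:{0<..}|lborel. (norm (R x))\<^sup>2)"
    using i1 i2 i3 i4 by (simp add: set_integral_add set_integral_diff)
  finally show "(LINT x:{0<..}|lborel. (norm (g x))\<^sup>2) + \<nu> * (LINT x:{0<..}|lborel. (norm (\<psi> x))\<^sup>2)
       - (LINT x:{0<..}|lborel. norm (\<psi> x) powr (2 * \<mu> + 2)) / (\<mu> + 1)
       = (LINT x:{0<..}|lborel. (norm (R x))\<^sup>2) + soliton_action \<mu> \<nu> ((norm (\<psi> 0))\<^sup>2)"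
    using ch(2) by simp
qed

section \<open>Action and mass along the branch of symmetric bound states\<close>

text \<open>With \<open>\<beta> = \<alpha> / N\<close> and \<open>b = \<beta> / sqrt \<nu>\<close>, action and mass of the bound state of frequency \<open>\<nu>\<close> are powers
  of \<open>\<nu>\<close> times functions of \<open>b\<close> alone, the following two. The second equals
  \<open>1 / \<mu>\<close> times the integral of \<open>(1 - z\<^sup>2)\<^bsup>1/\<mu> - 1\<^esup>\<close> over \<open>[b, 1]\<close>, but its present form avoids the singularity
  of that integrand at \<open>1\<close> for \<open>\<mu> > 1\<close>.\<close>

definition profile_integral :: "real \<Rightarrow> real \<Rightarrow> real" where
  "profile_integral \<mu> b = integral {b..1} (\<lambda>z. (1 - z\<^sup>2) powr (1 / \<mu>))"

definition profile_mass :: "real \<Rightarrow> real \<Rightarrow> real" where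
  "profile_mass \<mu> b = (1 / \<mu> + 1 / 2) * profile_integral \<mu> b + b * (1 - b\<^sup>2) powr (1 / \<mu>) / 2"

lemma continuous_on_profile:
  assumes "0 < \<mu>" shows "continuous_on {0..1} (\<lambda>z::real. (1 - z\<^sup>2) powr (1 / \<mu>))"
  by (intro continuous_on_powr' continuous_intros)
    (use assms in \<open>auto simp: power_le_one\<close>)

lemma continuous_on_profile_integral:
  assumes "0 < \<mu>" shows "continuous_on {0..1} (profile_integral \<mu>)"
proof -
  have "(profile_integral \<mu> has_real_derivative - ((1 - b\<^sup>2) powr (1 / \<mu>))) (at b within {0..1})"
    if "b \<in> {0..1}" for b
    unfolding profile_integral_def[abs_def]
    by (rule integral_has_real_derivative'[OF continuous_on_profile[OF assms] that])
  then show ?thesis by (rule DERIV_continuous_on)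
qed

lemma profile_integral_deriv:
  assumes "0 < \<mu>" "0 < b" "b < 1"
  shows "(profile_integral \<mu> has_real_derivative - ((1 - b\<^sup>2) powr (1 / \<mu>))) (at b)"
proof -
  have "(profile_integral \<mu> has_real_derivative - ((1 - b\<^sup>2) powr (1 / \<mu>))) (at b within {0..1})"
    unfolding profile_integral_def[abs_def]
    by (rule integral_has_real_derivative'[OF continuous_on_profile]) (use assms in auto)
  then show ?thesis using assms by (simp add: at_within_Icc_at)
qed

lemma profile_integral_1 [simp]: "profile_integral \<mu> 1 = 0"
  by (simp add: profile_integral_def)

lemma profile_mass_1 [simp]: "profile_mass \<mu> 1 = 0"
  by (simp add: profile_mass_def)

lemma continuous_on_profile_mass:
  assumes "0 < \<mu>" shows "continuous_on {0..1} (profile_mass \<mu>)"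
  unfolding profile_mass_def[abs_def]
  by (intro continuous_on_add continuous_on_mult continuous_on_divide continuous_on_const continuous_on_id
      continuous_on_profile_integral continuous_on_profile assms) auto

lemma profile_mass_deriv:
  assumes "0 < \<mu>" "0 < b" "b < 1"
  shows "(profile_mass \<mu> has_real_derivative - (1 / \<mu>) * (1 - b\<^sup>2) powr (1 / \<mu> - 1)) (at b)"
proof -
  have b2: "0 < 1 - b\<^sup>2" using assms by (simp add: power_less_one_iff)
  have e: "(1 - b\<^sup>2) powr (1 / \<mu>) = (1 - b\<^sup>2) * (1 - b\<^sup>2) powr (1 / \<mu> - 1)"
    using powr_add[of "1 - b\<^sup>2" 1 "1 / \<mu> - 1"] b2 by simp
  have dp: "((\<lambda>b. (1 - b\<^sup>2) powr (1 / \<mu>)) has_real_derivative 1 / \<mu> * (1 - b\<^sup>2) powr (1 / \<mu> - 1) * (- (2 * b))) (at b)"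
    using b2 by (auto intro!: derivative_eq_intros)
  have "(profile_mass \<mu> has_real_derivative (1 / \<mu> + 1 / 2) * - ((1 - b\<^sup>2) powr (1 / \<mu>))
      + (1 * (1 - b\<^sup>2) powr (1 / \<mu>) + 1 / \<mu> * (1 - b\<^sup>2) powr (1 / \<mu> - 1) * (- (2 * b)) * b) / 2) (at b)"
    unfolding profile_mass_def[abs_def]
    by (intro DERIV_add DERIV_cmult DERIV_cdivide profile_integral_deriv assms)
      (rule DERIV_mult[OF DERIV_ident dp])
  also have "(1 / \<mu> + 1 / 2) * - ((1 - b\<^sup>2) powr (1 / \<mu>))
      + (1 * (1 - b\<^sup>2) powr (1 / \<mu>) + 1 / \<mu> * (1 - b\<^sup>2) powr (1 / \<mu> - 1) * (- (2 * b)) * b) / 2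
      = - (1 / \<mu>) * (1 - b\<^sup>2) powr (1 / \<mu> - 1)"
    unfolding e using assms(1) by (simp add: field_simps power2_eq_square)
  finally show ?thesis .
qed

lemma profile_mass_decreasing:
  assumes "0 < \<mu>" "0 \<le> a" "a < b" "b \<le> 1"
  shows "profile_mass \<mu> b < profile_mass \<mu> a"
proof (rule DERIV_neg_imp_decreasing_open[OF assms(3)])
  show "\<exists>y. (profile_mass \<mu> has_real_derivative y) (at x) \<and> y < 0" if "a < x" "x < b" for x
  proof (intro exI conjI)
    show "(profile_mass \<mu> has_real_derivative - (1 / \<mu>) * (1 - x\<^sup>2) powr (1 / \<mu> - 1)) (at x)"
      by (rule profile_mass_deriv) (use assms that in auto)
    have "x\<^sup>2 < 1" using assms that by (simp add: power_less_one_iff)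
    then show "- (1 / \<mu>) * (1 - x\<^sup>2) powr (1 / \<mu> - 1) < 0" using assms by (simp add: mult_neg_pos)
  qed
  show "continuous_on {a..b} (profile_mass \<mu>)"
    by (rule continuous_on_subset[OF continuous_on_profile_mass]) (use assms in auto)
qed

text \<open>Per edge, as functions of the frequency \<open>\<nu>\<close>: \<open>branch_action\<close> is the boundary term of the completed square
  minus the vertex term \<open>\<beta> \<bar>\<psi>(0)\<bar>\<^sup>2\<close> at the bound state (\<open>soliton_action_at_vertex\<close>), and \<open>branch_mass\<close> is the mass of the
  bound state (\<open>shifted_soliton_mass\<close>).\<close>

definition branch_action :: "real \<Rightarrow> real \<Rightarrow> real \<Rightarrow> real" where
  "branch_action \<mu> \<beta> \<nu> = (\<mu> + 1) powr (1 / \<mu>) * \<nu> powr (1 / \<mu> + 1 / 2) * profile_integral \<mu> (\<beta> / sqrt \<nu>)"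

definition branch_mass :: "real \<Rightarrow> real \<Rightarrow> real \<Rightarrow> real" where
  "branch_mass \<mu> \<beta> \<nu> = (\<mu> + 1) powr (1 / \<mu>) * \<nu> powr (1 / \<mu> - 1 / 2) * profile_mass \<mu> (\<beta> / sqrt \<nu>)"

lemma branch_ratio:
  assumes "0 < \<beta>" "\<beta>\<^sup>2 < \<nu>"
  shows "0 < \<nu>" "0 < \<beta> / sqrt \<nu>" "\<beta> / sqrt \<nu> < 1"
proof -
  show n: "0 < \<nu>" using assms by (smt (verit) zero_le_power2)
  then show "0 < \<beta> / sqrt \<nu>" using assms by simp
  have "\<beta> < sqrt \<nu>" using assms by (simp add: real_less_rsqrt)
  then show "\<beta> / sqrt \<nu> < 1" using n by simp
qed

lemma branch_action_deriv:
  assumes \<mu>: "0 < \<mu>" and \<beta>: "0 < \<beta>" "\<beta>\<^sup>2 < \<nu>"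
  shows "(branch_action \<mu> \<beta> has_real_derivative branch_mass \<mu> \<beta> \<nu>) (at \<nu>)"
proof -
  note r = branch_ratio[OF \<beta>]
  let ?b = "\<beta> / sqrt \<nu>" and ?p = "1 / \<mu> + 1 / 2"
  have db: "((\<lambda>\<nu>. \<beta> / sqrt \<nu>) has_real_derivative - ?b / (2 * \<nu>)) (at \<nu>)"
    using r(1) by (auto intro!: derivative_eq_intros simp: field_simps)
  have dJ: "((\<lambda>\<nu>. profile_integral \<mu> (\<beta> / sqrt \<nu>)) has_real_derivative
      - ((1 - ?b\<^sup>2) powr (1 / \<mu>)) * (- ?b / (2 * \<nu>))) (at \<nu>)"
    by (rule DERIV_chain2[OF profile_integral_deriv[OF \<mu> r(2,3)] db])
  have dp: "((\<lambda>\<nu>. \<nu> powr ?p) has_real_derivative ?p * \<nu> powr (?p - 1)) (at \<nu>)"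
    by (rule has_real_derivative_powr[OF r(1)])
  have e: "\<nu> powr ?p = \<nu> * \<nu> powr (1 / \<mu> - 1 / 2)"
    using powr_add[of \<nu> 1 "1 / \<mu> - 1 / 2"] r(1) by (simp add: algebra_simps)
  have e': "?p - 1 = 1 / \<mu> - 1 / 2" by simp
  have "branch_mass \<mu> \<beta> \<nu> = (\<mu> + 1) powr (1 / \<mu>) * (?p * \<nu> powr (?p - 1) * profile_integral \<mu> ?b
      + - ((1 - ?b\<^sup>2) powr (1 / \<mu>)) * (- ?b / (2 * \<nu>)) * \<nu> powr ?p)"
    unfolding branch_mass_def profile_mass_def e e' using r(1) by (simp add: field_simps)
  then show ?thesis
    unfolding branch_action_def[abs_def] mult.assoc[of "(\<mu> + 1) powr (1 / \<mu>)"]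
    using DERIV_cmult[OF DERIV_mult[OF dp dJ], of "(\<mu> + 1) powr (1 / \<mu>)"] by simp
qed

text \<open>Both factors increase: the exponent \<open>1 / \<mu> - 1 / 2\<close> is positive as \<open>\<mu> < 2\<close>, and the argument
  \<open>\<beta> / sqrt \<nu>\<close> of the decreasing function \<open>profile_mass\<close> decreases.\<close>

lemma branch_mass_increasing:
  assumes \<mu>: "0 < \<mu>" "\<mu> < 2" and \<beta>: "0 < \<beta>" "\<beta>\<^sup>2 < \<nu>" and l: "\<nu> < \<kappa>"
  shows "branch_mass \<mu> \<beta> \<nu> < branch_mass \<mu> \<beta> \<kappa>"
proof -
  note r = branch_ratio[OF \<beta>]
  have k: "0 < \<kappa>" using r l by simp
  have b: "\<beta> / sqrt \<kappa> < \<beta> / sqrt \<nu>" using \<beta> r l k by (intro divide_strict_left_mono) auto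
  have "profile_mass \<mu> (\<beta> / sqrt \<nu>) < profile_mass \<mu> (\<beta> / sqrt \<kappa>)"
    by (rule profile_mass_decreasing[OF \<mu>(1) _ b]) (use r \<beta> k in auto)
  moreover have "0 < profile_mass \<mu> (\<beta> / sqrt \<nu>)"
    using profile_mass_decreasing[OF \<mu>(1), of "\<beta> / sqrt \<nu>" 1] r by simp
  moreover have "\<nu> powr (1 / \<mu> - 1 / 2) < \<kappa> powr (1 / \<mu> - 1 / 2)"
    using \<mu> l r by (intro powr_less_mono2) (auto simp: field_simps)
  ultimately have "\<nu> powr (1 / \<mu> - 1 / 2) * profile_mass \<mu> (\<beta> / sqrt \<nu>)
      < \<kappa> powr (1 / \<mu> - 1 / 2) * profile_mass \<mu> (\<beta> / sqrt \<kappa>)"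
    by (intro mult_strict_mono) auto
  then show ?thesis using \<mu> unfolding branch_mass_def mult.assoc by (intro mult_strict_left_mono) auto
qed

text \<open>A function with strictly increasing derivative lies above its tangents.\<close>

lemma branch_action_tangent:
  assumes \<mu>: "0 < \<mu>" "\<mu> < 2" and \<beta>: "0 < \<beta>" "\<beta>\<^sup>2 < \<nu>" "\<beta>\<^sup>2 < \<omega>" and ne: "\<nu> \<noteq> \<omega>"
  shows "branch_action \<mu> \<beta> \<omega> + branch_mass \<mu> \<beta> \<omega> * (\<nu> - \<omega>) < branch_action \<mu> \<beta> \<nu>"
proof (cases "\<omega> < \<nu>")
  case True
  obtain z where z: "\<omega> < z" "z < \<nu>" "branch_action \<mu> \<beta> \<nu> - branch_action \<mu> \<beta> \<omega> = (\<nu> - \<omega>) * branch_mass \<mu> \<beta> z"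
    using MVT2[OF True, of "branch_action \<mu> \<beta>" "branch_mass \<mu> \<beta>"] branch_action_deriv[OF \<mu>(1) \<beta>(1)] \<beta>
    by (smt (verit))
  have "(\<nu> - \<omega>) * branch_mass \<mu> \<beta> \<omega> < (\<nu> - \<omega>) * branch_mass \<mu> \<beta> z"
    using branch_mass_increasing[OF \<mu> \<beta>(1,3) z(1)] True by (intro mult_strict_left_mono) auto
  then show ?thesis using z(3) by (simp add: algebra_simps)
next
  case False
  then have lt: "\<nu> < \<omega>" using ne by simp
  obtain z where z: "\<nu> < z" "z < \<omega>" "branch_action \<mu> \<beta> \<omega> - branch_action \<mu> \<beta> \<nu> = (\<omega> - \<nu>) * branch_mass \<mu> \<beta> z"
    using MVT2[OF lt, of "branch_action \<mu> \<beta>" "branch_mass \<mu> \<beta>"] branch_action_deriv[OF \<mu>(1) \<beta>(1)] \<beta>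
    by (smt (verit))
  have "(\<omega> - \<nu>) * branch_mass \<mu> \<beta> z < (\<omega> - \<nu>) * branch_mass \<mu> \<beta> \<omega>"
    using branch_mass_increasing[OF \<mu> \<beta>(1) _ z(2)] z \<beta> lt by (intro mult_strict_left_mono) auto
  then show ?thesis using z(3) by (simp add: algebra_simps)
qed

text \<open>The relation between \<open>\<nu>\<close> and the squared vertex modulus \<open>t\<close> says that the decay rate at \<open>t\<close> equals \<open>\<beta>\<close>,
  which is the vertex condition of the symmetric bound state. The region below the graph of the decay rate over
  \<open>[0, t]\<close> and above the height \<open>\<beta>\<close> has the area on the left; cutting it horizontally yields the right hand side.\<close>

lemma soliton_action_at_vertex:
  assumes \<mu>: "0 < \<mu>" and \<beta>: "0 < \<beta>" and t: "0 < t" and \<nu>: "\<nu> = t powr \<mu> / (\<mu> + 1) + \<beta>\<^sup>2"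
  shows "soliton_action \<mu> \<nu> t - \<beta> * t = branch_action \<mu> \<beta> \<nu>"
proof -
  have tm: "0 < t powr \<mu> / (\<mu> + 1)" using t \<mu> by simp
  have n: "0 < \<nu>" using tm by (simp add: \<nu> add_pos_nonneg)
  have yt: "decay_rate \<mu> \<nu> t = \<beta>" using \<beta> by (simp add: decay_rate_def \<nu>)
  let ?y = "decay_rate \<mu> \<nu>"
  define K where "K = (\<mu> + 1) powr (1 / \<mu>) * \<nu> powr (1 / \<mu> + 1 / 2)"
  \<comment> \<open>\<open>F\<close> vanishes at \<open>0\<close> and has derivative \<open>0\<close>: substituting the value \<open>?y s\<close> for \<open>s\<close> slices the area
    below the decreasing graph of \<open>?y\<close> horizontally instead of vertically.\<close>
  define F where "F = (\<lambda>s. soliton_action \<mu> \<nu> s - ?y s * s - K * profile_integral \<mu> (?y s / sqrt \<nu>))"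
  have rad0: "\<nu> - s powr \<mu> / (\<mu> + 1) > 0" if "0 \<le> s" "s \<le> t" for s
  proof -
    have "s powr \<mu> \<le> t powr \<mu>" using that \<mu> by (intro powr_mono2) auto
    then have "\<nu> - s powr \<mu> / (\<mu> + 1) \<ge> \<beta>\<^sup>2" using \<mu> by (simp add: \<nu> divide_right_mono)
    then show ?thesis using \<beta> by (smt (verit) zero_less_power2)
  qed
  have ypos: "?y s > 0" if "0 \<le> s" "s \<le> t" for s
    using rad0[OF that] by (simp add: decay_rate_def)
  have yle: "?y s / sqrt \<nu> \<le> 1" for s
    using n \<mu> by (simp add: decay_rate_def)
  have ylt: "?y s / sqrt \<nu> < 1" if "0 < s" for s
    using n \<mu> that by (simp add: decay_rate_def)
  have "F t = F 0"
  proof (rule DERIV_isconst_end[OF t])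
    have cy: "continuous_on {0..t} ?y"
      by (rule continuous_on_subset[OF continuous_on_decay_rate[OF \<mu>]]) auto
    have "(soliton_action \<mu> \<nu> has_real_derivative ?y s) (at s within {0..t})" if "s \<in> {0..t}" for s
      using that by (intro DERIV_subset[OF soliton_action_deriv[OF \<mu>]]) auto
    then have ca: "continuous_on {0..t} (soliton_action \<mu> \<nu>)" by (rule DERIV_continuous_on)
    have cJ: "continuous_on {0..t} (\<lambda>s. profile_integral \<mu> (?y s / sqrt \<nu>))"
    proof (rule continuous_on_compose2[OF continuous_on_profile_integral[OF \<mu>]])
      show "continuous_on {0..t} (\<lambda>s. ?y s / sqrt \<nu>)"
        by (intro continuous_on_divide cy continuous_on_const) (use n in simp)
      show "(\<lambda>s. ?y s / sqrt \<nu>) ` {0..t} \<subseteq> {0..1}"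
      proof
        fix u assume "u \<in> (\<lambda>s. ?y s / sqrt \<nu>) ` {0..t}"
        then obtain s where s: "0 \<le> s" "s \<le> t" "u = ?y s / sqrt \<nu>" by auto
        then show "u \<in> {0..1}" using yle[of s] ypos[OF s(1,2)] n by simp
      qed
    qed
    show "continuous_on {0..t} F"
      unfolding F_def by (intro continuous_on_diff continuous_on_mult continuous_on_const continuous_on_id cy ca cJ)
    fix s assume s: "0 < s" "s < t"
    let ?d = "- (\<mu> * s powr (\<mu> - 1)) / (\<mu> + 1) / (2 * ?y s)"
    have dy: "(?y has_real_derivative ?d) (at s)"
    proof -
      have "((\<lambda>s. \<nu> - s powr \<mu> / (\<mu> + 1)) has_real_derivative 0 - \<mu> * s powr (\<mu> - 1) / (\<mu> + 1)) (at s)"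
        by (intro DERIV_diff DERIV_const DERIV_cdivide has_real_derivative_powr s)
      then have "((\<lambda>s. sqrt (\<nu> - s powr \<mu> / (\<mu> + 1))) has_real_derivative
          inverse (?y s) / 2 * (0 - \<mu> * s powr (\<mu> - 1) / (\<mu> + 1))) (at s)"
        unfolding decay_rate_def
        by (rule DERIV_chain2[where f=sqrt, OF DERIV_real_sqrt, rotated]) (use rad0[of s] s in simp)
      moreover have "inverse Y / 2 * (0 - A / B) = - A / B / (2 * Y)" for Y A B :: real
        by (cases "Y = 0"; cases "B = 0"; simp add: field_simps)
      ultimately show ?thesis
        unfolding decay_rate_def[abs_def] by (simp only:)
    qed
    have da: "(soliton_action \<mu> \<nu> has_real_derivative ?y s) (at s)"
    proof -
      have "at s within {0..} = at s" by (rule at_within_nhd[of s "{0<..}"]) (use s in auto)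
      then show ?thesis using soliton_action_deriv[OF \<mu>, of s \<nu>] s by simp
    qed
    have dJ: "((\<lambda>s. profile_integral \<mu> (?y s / sqrt \<nu>)) has_real_derivative
        - ((1 - (?y s / sqrt \<nu>)\<^sup>2) powr (1 / \<mu>)) * (?d / sqrt \<nu>)) (at s)"
      by (rule DERIV_chain2[where f="profile_integral \<mu>", OF profile_integral_deriv[OF \<mu>] DERIV_cdivide[OF dy]])
        (use ypos[of s] ylt s n in auto)
    have "1 - (?y s / sqrt \<nu>)\<^sup>2 = s powr \<mu> / ((\<mu> + 1) * \<nu>)"
      using rad0[of s] s n by (simp add: decay_rate_def power_divide diff_divide_distrib)
    then have pw: "(1 - (?y s / sqrt \<nu>)\<^sup>2) powr (1 / \<mu>) = s / ((\<mu> + 1) powr (1 / \<mu>) * \<nu> powr (1 / \<mu>))"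
      using s n \<mu> by (simp add: powr_divide powr_mult powr_powr)
    have "K * ((1 - (?y s / sqrt \<nu>)\<^sup>2) powr (1 / \<mu>) / sqrt \<nu>) = s"
      unfolding pw K_def powr_add using n \<mu> by (simp add: powr_half_sqrt)
    moreover have "?y s - (d * s + 1 * ?y s) - K * (- P * (d / sqrt \<nu>)) = d * (K * (P / sqrt \<nu>) - s)"
      for P d by (simp add: algebra_simps)
    ultimately have "?y s - (?d * s + 1 * ?y s) - K * (- ((1 - (?y s / sqrt \<nu>)\<^sup>2) powr (1 / \<mu>)) * (?d / sqrt \<nu>)) = 0"
      by (metis diff_self mult_zero_right)
    moreover have "(F has_real_derivative
        (?y s - (?d * s + 1 * ?y s) - K * (- ((1 - (?y s / sqrt \<nu>)\<^sup>2) powr (1 / \<mu>)) * (?d / sqrt \<nu>)))) (at s)"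
      unfolding F_def
      by (intro DERIV_diff da DERIV_cmult dJ) (rule DERIV_mult[OF dy DERIV_ident])
    ultimately show "(F has_real_derivative 0) (at s)" by simp
  qed
  also have "F 0 = 0" using n by (simp add: F_def decay_rate_def)
  finally show ?thesis
    by (simp add: F_def yt branch_action_def K_def)
qed

section \<open>The shifted soliton\<close>

lemma soliton_squared:
  assumes \<mu>: "0 < \<mu>" and \<omega>: "0 < \<omega>"
  shows "(soliton \<mu> \<omega> x)\<^sup>2 = ((\<mu> + 1) * \<omega>) powr (1 / \<mu>) * (1 - (tanh (\<mu> * sqrt \<omega> * x))\<^sup>2) powr (1 / \<mu>)"
proof -
  have s: "0 < soliton \<mu> \<omega> x" by (rule soliton_pos[OF \<mu> \<omega>])
  have t: "0 \<le> 1 - (tanh (\<mu> * sqrt \<omega> * x))\<^sup>2"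
    using tanh_real_bounds[of "\<mu> * sqrt \<omega> * x"] by (simp add: abs_square_le_1 abs_le_iff)
  have "(soliton \<mu> \<omega> x)\<^sup>2 = soliton \<mu> \<omega> x powr 2" using s by simp
  also have "\<dots> = (soliton \<mu> \<omega> x powr (2 * \<mu>)) powr (1 / \<mu>)" using \<mu> by (simp add: powr_powr)
  finally show ?thesis using soliton_powr[OF \<mu> \<omega>, of x] t \<mu> \<omega> by (simp add: powr_mult)
qed

lemma shifted_soliton_L2:
  assumes \<mu>: "0 < \<mu>" and \<omega>: "0 < \<omega>"
  shows "halfline_L2 (\<lambda>x. complex_of_real (soliton \<mu> \<omega> (x + z)))"
proof -
  obtain K where K: "0 \<le> K" "\<And>x. soliton \<mu> \<omega> x \<le> K * exp (- sqrt \<omega> * x)"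
    using soliton_decay[OF \<mu> \<omega>] by blast
  have "continuous_on UNIV (soliton \<mu> \<omega>)"
    by (rule DERIV_continuous_on) (rule has_field_derivative_at_within[OF soliton_deriv[OF \<mu> \<omega>]])
  then have c: "continuous_on UNIV (\<lambda>x. complex_of_real (soliton \<mu> \<omega> (x + z)))"
    by (intro continuous_on_of_real) (erule continuous_on_compose2, auto intro!: continuous_intros)
  show ?thesis
  proof (rule halfline_L2_exp_bound[OF c])
    show "0 < sqrt \<omega>" using \<omega> by simp
    fix x
    have "soliton \<mu> \<omega> (x + z) \<le> (K * exp (- sqrt \<omega> * z)) * exp (- sqrt \<omega> * x)"
      using K(2)[of "x + z"] by (simp add: distrib_left exp_add exp_diff exp_minus field_simps)
    then show "norm (complex_of_real (soliton \<mu> \<omega> (x + z))) \<le> (K * exp (- sqrt \<omega> * z)) * exp (- sqrt \<omega> * x)"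
      using soliton_pos[OF \<mu> \<omega>, of "x + z"] by simp
  qed
qed

lemma shifted_soliton_deriv:
  assumes \<mu>: "0 < \<mu>" and \<omega>: "0 < \<omega>"
  shows "((\<lambda>x. soliton \<mu> \<omega> (x + z)) has_real_derivative
     - sqrt \<omega> * tanh (\<mu> * sqrt \<omega> * (x + z)) * soliton \<mu> \<omega> (x + z)) (at x)"
  using DERIV_shift[THEN iffD1, OF soliton_deriv[OF \<mu> \<omega>]] by simp

lemma shifted_soliton_tanh_bounds:
  assumes \<mu>: "0 < \<mu>" and \<omega>: "0 < \<omega>" and z: "tanh (\<mu> * sqrt \<omega> * z) = b" and b: "0 < b" and x: "0 \<le> x"
  shows "b \<le> tanh (\<mu> * sqrt \<omega> * (x + z))" "tanh (\<mu> * sqrt \<omega> * (x + z)) < 1"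
proof -
  have "\<mu> * sqrt \<omega> * z \<le> \<mu> * sqrt \<omega> * (x + z)"
    using \<mu> \<omega> x by (intro mult_left_mono) auto
  then show "b \<le> tanh (\<mu> * sqrt \<omega> * (x + z))" by (simp add: z[symmetric])
  show "tanh (\<mu> * sqrt \<omega> * (x + z)) < 1" by (rule tanh_real_lt_1)
qed

lemma decay_rate_soliton:
  assumes \<mu>: "0 < \<mu>" and \<omega>: "0 < \<omega>" and t: "0 \<le> tanh (\<mu> * sqrt \<omega> * x)"
  shows "decay_rate \<mu> \<omega> ((soliton \<mu> \<omega> x)\<^sup>2) = sqrt \<omega> * tanh (\<mu> * sqrt \<omega> * x)"
proof -
  have "((soliton \<mu> \<omega> x)\<^sup>2) powr \<mu> = soliton \<mu> \<omega> x powr (2 * \<mu>)"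
    using soliton_pos[OF \<mu> \<omega>, of x] by (simp add: powr_powr flip: powr_numeral)
  also have "\<dots> = (\<mu> + 1) * \<omega> * (1 - (tanh (\<mu> * sqrt \<omega> * x))\<^sup>2)"
    by (rule soliton_powr[OF \<mu> \<omega>])
  finally have "\<omega> - ((soliton \<mu> \<omega> x)\<^sup>2) powr \<mu> / (\<mu> + 1) = \<omega> * (tanh (\<mu> * sqrt \<omega> * x))\<^sup>2"
    using \<mu> by (simp add: field_simps)
  then show ?thesis using t by (simp add: decay_rate_def real_sqrt_mult)
qed

lemma shifted_soliton_weak_deriv:
  assumes \<mu>: "0 < \<mu>" and \<omega>: "0 < \<omega>"
  shows "has_weak_deriv (\<lambda>x. c * complex_of_real (soliton \<mu> \<omega> (x + z)))
    (\<lambda>x. c * complex_of_real (- sqrt \<omega> * tanh (\<mu> * sqrt \<omega> * (x + z)) * soliton \<mu> \<omega> (x + z)))"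
proof -
  let ?S = "\<lambda>x. soliton \<mu> \<omega> (x + z)"
  let ?T = "\<lambda>x. - sqrt \<omega> * tanh (\<mu> * sqrt \<omega> * (x + z)) * ?S x"
  have cS: "continuous_on UNIV ?S"
    by (rule DERIV_continuous_on) (rule has_field_derivative_at_within[OF shifted_soliton_deriv[OF \<mu> \<omega>]])
  have cT: "continuous_on UNIV ?T"
    by (intro continuous_on_mult continuous_on_const cS continuous_intros) (simp add: cosh_real_nonzero)
  have dom: "norm (?T x) \<le> sqrt \<omega> * norm (?S x)" for x
  proof -
    have "\<bar>tanh (\<mu> * sqrt \<omega> * (x + z))\<bar> \<le> 1"
      using tanh_real_bounds[of "\<mu> * sqrt \<omega> * (x + z)"] by auto
    then show ?thesis using \<omega> by (simp add: abs_mult mult_left_le_one_le mult.assoc)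
  qed
  show ?thesis
  proof (rule has_weak_deriv_C1)
    show "halfline_L2 (\<lambda>x. c * complex_of_real (?S x))"
      by (rule halfline_L2_dominated[OF shifted_soliton_L2[OF \<mu> \<omega>, of z], of _ "norm c"])
        (auto intro!: continuous_intros continuous_on_subset[OF cS] simp: norm_mult)
    show "halfline_L2 (\<lambda>x. c * complex_of_real (?T x))"
    proof (rule halfline_L2_dominated[OF shifted_soliton_L2[OF \<mu> \<omega>, of z], of _ "norm c * sqrt \<omega>"])
      show "continuous_on {0..} (\<lambda>x. c * complex_of_real (?T x))"
        by (intro continuous_on_mult continuous_on_const continuous_on_of_real continuous_on_subset[OF cT]) auto
      show "norm (c * complex_of_real (?T x)) \<le> norm c * sqrt \<omega> * norm (complex_of_real (?S x))" for x
        using mult_left_mono[OF dom[of x], of "norm c"] by (simp only: norm_mult norm_of_real real_norm_def mult.assoc norm_ge_zero)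
    qed
    show "((\<lambda>x. c * complex_of_real (?S x)) has_vector_derivative c * complex_of_real (?T x)) (at x)" for x
      by (intro has_vector_derivative_mult_right has_vector_derivative_of_real)
        (use shifted_soliton_deriv[OF \<mu> \<omega>, of z x] in \<open>simp only: has_real_derivative_iff_has_vector_derivative\<close>)
    show "continuous_on UNIV (\<lambda>x. c * complex_of_real (?T x))"
      by (intro continuous_on_mult continuous_on_const continuous_on_of_real cT)
  qed
qed

text \<open>In the variable \<open>T = tanh (\<mu> sqrt \<omega> (x + z))\<close>, which runs from \<open>\<beta> / sqrt \<omega>\<close> to \<open>1\<close>, an antiderivative of the square of
  the soliton is a multiple of \<open>profile_mass \<mu> T\<close>.\<close>

lemma shifted_soliton_mass:
  assumes \<mu>: "0 < \<mu>" and \<beta>: "0 < \<beta>" "\<beta>\<^sup>2 < \<omega>" and z: "tanh (\<mu> * sqrt \<omega> * z) = \<beta> / sqrt \<omega>"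
  shows "(LINT x:{0<..}|lborel. (soliton \<mu> \<omega> (x + z))\<^sup>2) = branch_mass \<mu> \<beta> \<omega>"
proof -
  note r = branch_ratio[OF \<beta>]
  let ?S = "\<lambda>x. (soliton \<mu> \<omega> (x + z))\<^sup>2"
  define T where "T = (\<lambda>x. tanh (\<mu> * sqrt \<omega> * (x + z)))"
  define A where "A = (\<lambda>x. - (((\<mu> + 1) * \<omega>) powr (1 / \<mu>) / sqrt \<omega>) * profile_mass \<mu> (T x))"
  have T01: "0 < T x" "T x < 1" if "0 \<le> x" for x
    using shifted_soliton_tanh_bounds[OF \<mu> r(1) z r(2) that] r(2) unfolding T_def by linarith+
  have i: "set_integrable lborel {0<..} ?S"
    using shifted_soliton_L2[OF \<mu> r(1), of z] by (simp add: halfline_L2_def)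
  have dT: "(T has_real_derivative (1 - (T x)\<^sup>2) * (\<mu> * sqrt \<omega>)) (at x)" for x
    unfolding T_def by (auto intro!: derivative_eq_intros simp: cosh_real_nonzero)
  have dA: "(A has_real_derivative ?S x) (at x)" if x: "0 \<le> x" for x
  proof -
    have t: "0 < 1 - (T x)\<^sup>2" using T01[OF x] by (simp add: power_less_one_iff)
    have "(1 - (T x)\<^sup>2) powr (1 / \<mu> - 1) * (1 - (T x)\<^sup>2) = (1 - (T x)\<^sup>2) powr (1 / \<mu>)"
      using powr_add[of "1 - (T x)\<^sup>2" "1 / \<mu> - 1" 1] t by simp
    moreover have "- (1 / \<mu>) * P * (Q * (\<mu> * sqrt \<omega>)) = - sqrt \<omega> * (P * Q)" for P Q
      using \<mu> by simp
    ultimately have "- (1 / \<mu>) * (1 - (T x)\<^sup>2) powr (1 / \<mu> - 1) * ((1 - (T x)\<^sup>2) * (\<mu> * sqrt \<omega>))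
        = - sqrt \<omega> * (1 - (T x)\<^sup>2) powr (1 / \<mu>)"
      by simp
    then have "((\<lambda>x. profile_mass \<mu> (T x)) has_real_derivative - sqrt \<omega> * (1 - (T x)\<^sup>2) powr (1 / \<mu>)) (at x)"
      using DERIV_chain2[where f="profile_mass \<mu>", OF profile_mass_deriv[OF \<mu> T01[OF x]] dT] by metis
    from DERIV_cmult[OF this, of "- (((\<mu> + 1) * \<omega>) powr (1 / \<mu>) / sqrt \<omega>)"]
    show ?thesis
      using r(1) by (simp add: A_def soliton_squared[OF \<mu> r(1)] T_def)
  qed
  have "eventually (\<lambda>R. A R - A 0 = (LINT x:{0<..R}|lborel. ?S x)) at_top"
    using eventually_ge_at_top[of 0]
  proof eventually_elim
    case (elim R)
    have cS: "continuous_on {0..R} ?S"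
      by (intro continuous_on_power DERIV_continuous_on)
        (rule has_field_derivative_at_within[OF shifted_soliton_deriv[OF \<mu> r(1)]])
    have "(LINT x|lborel. indicator {0..R} x *\<^sub>R ?S x) = A R - A 0"
      by (rule integral_FTC_atLeastAtMost[OF elim _ cS])
        (use dA in \<open>auto simp: has_real_derivative_iff_has_vector_derivative[symmetric] intro: has_field_derivative_at_within\<close>)
    moreover have "(LINT x|lborel. indicator {0..R} x *\<^sub>R ?S x) = (LINT x:{0<..R}|lborel. ?S x)"
      unfolding set_lebesgue_integral_def
    proof (rule integral_cong_AE)
      show "AE x in lborel. indicat_real {0..R} x *\<^sub>R ?S x = indicat_real {0<..R} x *\<^sub>R ?S x"
        using AE_lborel_singleton[of "0::real"] by eventually_elim (auto simp: indicator_def)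
      have "set_integrable lborel {0..R} ?S" by (rule borel_integrable_atLeastAtMost'[OF cS])
      then show "(\<lambda>x. indicat_real {0..R} x *\<^sub>R ?S x) \<in> borel_measurable lborel"
        unfolding set_integrable_def by (rule borel_measurable_integrable)
      have "set_integrable lborel {0<..R} ?S" by (rule set_integrable_subset[OF i]) auto
      then show "(\<lambda>x. indicat_real {0<..R} x *\<^sub>R ?S x) \<in> borel_measurable lborel"
        unfolding set_integrable_def by (rule borel_measurable_integrable)
    qed
    ultimately show ?case by simp
  qed
  moreover have "((\<lambda>R. A R - A 0) \<longlongrightarrow> 0 - A 0) at_top"
  proof (intro tendsto_diff tendsto_const)
    have "filterlim (\<lambda>x. z + x) at_top at_top" by (rule filterlim_tendsto_add_at_top[OF tendsto_const filterlim_ident])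
    then have "filterlim (\<lambda>x. \<mu> * sqrt \<omega> * (x + z)) at_top at_top"
      using \<mu> r by (intro filterlim_tendsto_pos_mult_at_top[OF tendsto_const]) (auto simp: add.commute)
    then have lT: "(T \<longlongrightarrow> 1) at_top"
      unfolding T_def by (rule filterlim_compose[OF tanh_real_at_top])
    have "((\<lambda>x. profile_mass \<mu> (T x)) \<longlongrightarrow> profile_mass \<mu> 1) at_top"
    proof (rule continuous_on_tendsto_compose[OF continuous_on_profile_mass[OF \<mu>] lT])
      show "eventually (\<lambda>x. T x \<in> {0..1}) at_top"
        using eventually_ge_at_top[of 0] by eventually_elim (use T01 in \<open>auto simp: less_imp_le\<close>)
    qed simp
    then show "(A \<longlongrightarrow> 0) at_top"
      unfolding A_def using tendsto_mult_right_zero by fastforce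
  qed
  ultimately have "((\<lambda>R. LINT x:{0<..R}|lborel. ?S x) \<longlongrightarrow> 0 - A 0) at_top"
    by (rule Lim_transform_eventually[rotated])
  with halfline_integral_limit[OF i] have "(LINT x:{0<..}|lborel. ?S x) = 0 - A 0"
    by (rule tendsto_unique[OF trivial_limit_at_top_linorder])
  also have "\<dots> = branch_mass \<mu> \<beta> \<omega>"
  proof -
    have "\<omega> powr (1 / \<mu> - 1 / 2) = \<omega> powr (1 / \<mu>) / sqrt \<omega>"
      using r(1) by (simp add: powr_diff powr_half_sqrt)
    then show ?thesis using \<mu> r(1) by (simp add: A_def T_def z branch_mass_def powr_mult)
  qed
  finally show ?thesis .
qed

text \<open>Uniqueness for the first order equation. The decay rate \<open>y\<close> along a solution satisfies the Riccati
  equation \<open>y' = \<mu> (\<omega> - y\<^sup>2)\<close>, which determines it from its initial value; given \<open>y\<close>, the equation for \<open>\<psi>\<close> is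
  linear. The bound on the modulus is strict in order that the square root in \<open>y\<close> be differentiable.\<close>

lemma integral_curve_eq_soliton:
  fixes \<psi> g :: "real \<Rightarrow> complex"
  assumes \<mu>: "0 < \<mu>" and \<omega>: "0 < \<omega>" and z: "0 < tanh (\<mu> * sqrt \<omega> * z)"
    and w: "has_weak_deriv \<psi> g" and c: "continuous_on {0..} \<psi>"
    and b: "\<And>x. 0 \<le> x \<Longrightarrow> norm (\<psi> x) powr (2 * \<mu>) < (\<mu> + 1) * \<omega>"
    and g: "AE x in lborel. 0 < x \<longrightarrow> g x = - (decay_rate \<mu> \<omega> ((norm (\<psi> x))\<^sup>2) *\<^sub>R \<psi> x)"
    and init: "norm (\<psi> 0) = soliton \<mu> \<omega> z"
    and x: "0 \<le> x"
  shows "\<psi> x = \<psi> 0 / complex_of_real (soliton \<mu> \<omega> z) * complex_of_real (soliton \<mu> \<omega> (x + z))"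
proof -
  define G where "G = (\<lambda>x. decay_rate \<mu> \<omega> ((norm (\<psi> x))\<^sup>2))"
  define v where "v = (\<lambda>x. (norm (\<psi> x))\<^sup>2)"
  have cG: "continuous_on {0..} G"
    unfolding G_def by (rule continuous_on_compose2[OF continuous_on_decay_rate[OF \<mu>]])
      (auto intro!: continuous_intros c)
  have vm: "v x powr \<mu> = norm (\<psi> x) powr (2 * \<mu>)" for x
    by (cases "\<psi> x = 0") (simp_all add: v_def powr_powr flip: powr_numeral)
  have rad: "0 < \<omega> - v x powr \<mu> / (\<mu> + 1)" if "0 \<le> x" for x
    using b[OF that] \<mu> by (simp add: vm field_simps)
  have G2: "(G x)\<^sup>2 = \<omega> - v x powr \<mu> / (\<mu> + 1)" if "0 \<le> x" for x
    using rad[OF that] by (simp add: G_def decay_rate_def v_def)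
  have Gpos: "0 < G x" if "0 \<le> x" for x
    using rad[OF that] by (simp add: G_def decay_rate_def v_def)
  have Gle: "G x \<le> sqrt \<omega>" for x
    using \<mu> by (simp add: G_def decay_rate_def)
  define F where "F = (\<lambda>x. - (G x *\<^sub>R \<psi> x))"
  have cF: "continuous_on {0..} F" unfolding F_def by (intro continuous_intros cG c)
  \<comment> \<open>The right hand side is continuous, so the equation holds classically.\<close>
  have rep: "\<psi> y = \<psi> 0 + integral {0..y} F" if y: "0 \<le> y" for y
  proof -
    have L: "halfline_L2 g" using w by (simp add: has_weak_deriv_def)
    have iF: "set_integrable lborel {0..y} F"
      by (rule borel_integrable_atLeastAtMost') (rule continuous_on_subset[OF cF], auto)
    have ig: "set_integrable lborel {0<..y} g" by (rule halfline_L2_integrable_bounded[OF L]) auto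
    have "\<psi> y - \<psi> 0 = (LINT s:{0<..y}|lborel. g s)"
      by (rule has_weak_deriv_FTC[OF w c]) (use y in auto)
    also have "\<dots> = (LINT s:{0..y}|lborel. F s)"
      unfolding set_lebesgue_integral_def
    proof (rule integral_cong_AE)
      show "(\<lambda>x. indicat_real {0<..y} x *\<^sub>R g x) \<in> borel_measurable lborel"
        using ig unfolding set_integrable_def by (rule borel_measurable_integrable)
      show "(\<lambda>x. indicat_real {0..y} x *\<^sub>R F x) \<in> borel_measurable lborel"
        using iF unfolding set_integrable_def by (rule borel_measurable_integrable)
      show "AE x in lborel. indicat_real {0<..y} x *\<^sub>R g x = indicat_real {0..y} x *\<^sub>R F x"
        using g AE_lborel_singleton[of "0::real"]
        by eventually_elim (auto simp: indicator_def F_def G_def)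
    qed
    also have "\<dots> = integral {0..y} F" by (rule set_borel_integral_eq_integral(2)[OF iF])
    finally show ?thesis by (simp add: algebra_simps)
  qed
  have d\<psi>: "(\<psi> has_vector_derivative F y) (at y within {0..})" if y: "0 \<le> y" for y
  proof -
    have "((\<lambda>y. integral {0..y} F) has_vector_derivative F y) (at y within {0..y+1})"
      by (rule integral_has_vector_derivative) (use y in \<open>auto intro: continuous_on_subset[OF cF]\<close>)
    moreover have "at y within {0..y + 1} = at y within {0..}"
      by (rule at_within_nhd[of _ "{..<y + 1}"]) (use y in auto)
    ultimately have "((\<lambda>y. \<psi> 0 + integral {0..y} F) has_vector_derivative 0 + F y) (at y within {0..})"
      by (intro has_vector_derivative_add has_vector_derivative_const) simp
    then have "((\<lambda>y. \<psi> 0 + integral {0..y} F) has_vector_derivative F y) (at y within {0..})" by simp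
    then show ?thesis
    proof (rule has_vector_derivative_transform[rotated 2])
      show "\<psi> s = \<psi> 0 + integral {0..s} F" if "s \<in> {0..}" for s
        using that by (intro rep) simp
    qed (use y in simp)
  qed
  have at: "at y within {0..} = at y" if "0 < y" for y :: real
    by (rule at_within_nhd[of y "{0<..}"]) (use that in auto)
  have dv: "(v has_real_derivative - (2 * G y * v y)) (at y)" if y: "0 < y" for y
  proof -
    have "(\<psi> has_derivative (\<lambda>h. h *\<^sub>R F y)) (at y)"
      using d\<psi>[of y] y at[OF y] by (simp add: has_vector_derivative_def)
    from has_derivative_compose[OF this norm_squared_derivative]
    have "(v has_derivative (\<lambda>h. (2 *\<^sub>R \<psi> y) \<bullet> (h *\<^sub>R F y))) (at y)" by (simp add: v_def)
    moreover have "(\<lambda>h. (2 *\<^sub>R \<psi> y) \<bullet> (h *\<^sub>R F y)) = (*) (- (2 * G y * v y))"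
      by (auto simp: fun_eq_iff F_def v_def power2_norm_eq_inner)
    ultimately show ?thesis by (simp add: has_field_derivative_def)
  qed
  have cv: "continuous_on {0..} v" unfolding v_def by (intro continuous_intros c)
  have v0: "v 0 = (soliton \<mu> \<omega> z)\<^sup>2" by (simp add: v_def init)
  \<comment> \<open>\<open>G \<le> sqrt \<omega>\<close> bounds the logarithmic decay of \<open>v\<close>, so \<open>v\<close> cannot reach zero.\<close>
  have vpos: "0 < v y" if y: "0 \<le> y" for y
  proof -
    have "v 0 * exp (2 * sqrt \<omega> * 0) \<le> v y * exp (2 * sqrt \<omega> * y)"
    proof (rule DERIV_nonneg_imp_increasing_open[OF y])
      show "continuous_on {0..y} (\<lambda>x. v x * exp (2 * sqrt \<omega> * x))"
        by (intro continuous_intros continuous_on_subset[OF cv]) auto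
      fix s assume s: "0 < s" "s < y"
      have "((\<lambda>x. v x * exp (2 * sqrt \<omega> * x)) has_real_derivative
         - (2 * G s * v s) * exp (2 * sqrt \<omega> * s) + exp (2 * sqrt \<omega> * s) * (2 * sqrt \<omega>) * v s) (at s)"
        by (rule DERIV_mult[OF dv[OF s(1)]]) (auto intro!: derivative_eq_intros)
      moreover have "- (2 * G s * v s) * exp (2 * sqrt \<omega> * s) + exp (2 * sqrt \<omega> * s) * (2 * sqrt \<omega>) * v s
         = 2 * (sqrt \<omega> - G s) * (v s * exp (2 * sqrt \<omega> * s))" by (simp add: algebra_simps)
      moreover have "0 \<le> 2 * (sqrt \<omega> - G s) * (v s * exp (2 * sqrt \<omega> * s))"
        using Gle[of s] by (simp add: v_def)
      ultimately show "\<exists>d. ((\<lambda>x. v x * exp (2 * sqrt \<omega> * x)) has_real_derivative d) (at s) \<and> 0 \<le> d"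
        by metis
    qed
    moreover have "0 < v 0" using soliton_pos[OF \<mu> \<omega>, of z] by (simp add: v0)
    ultimately show ?thesis by (smt (verit) exp_gt_zero mult_nonpos_nonneg mult_pos_pos)
  qed
  have dG: "(G has_real_derivative \<mu> * (\<omega> - (G y)\<^sup>2)) (at y)" if y: "0 < y" for y
  proof -
    have "((\<lambda>y. \<omega> - v y powr \<mu> / (\<mu> + 1)) has_real_derivative
        0 - \<mu> * v y powr (\<mu> - 1) * (- (2 * G y * v y)) / (\<mu> + 1)) (at y)"
      by (intro DERIV_diff DERIV_const DERIV_cdivide DERIV_chain2[OF has_real_derivative_powr dv[OF y]])
        (use vpos[of y] y in auto)
    then have "((\<lambda>y. sqrt (\<omega> - v y powr \<mu> / (\<mu> + 1))) has_real_derivative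
        inverse (sqrt (\<omega> - v y powr \<mu> / (\<mu> + 1))) / 2 * (0 - \<mu> * v y powr (\<mu> - 1) * (- (2 * G y * v y)) / (\<mu> + 1))) (at y)"
      by (rule DERIV_chain2[where f=sqrt, OF DERIV_real_sqrt, rotated]) (use rad[of y] y in simp)
    moreover have "sqrt (\<omega> - v y powr \<mu> / (\<mu> + 1)) = G y"
      by (simp add: G_def decay_rate_def v_def)
    ultimately have "((\<lambda>y. sqrt (\<omega> - v y powr \<mu> / (\<mu> + 1))) has_real_derivative
        inverse (G y) / 2 * (0 - \<mu> * v y powr (\<mu> - 1) * (- (2 * G y * v y)) / (\<mu> + 1))) (at y)"
      by simp
    moreover have "(\<lambda>y. sqrt (\<omega> - v y powr \<mu> / (\<mu> + 1))) = G"
      by (simp add: G_def decay_rate_def v_def)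
    moreover have "inverse (G y) / 2 * (0 - \<mu> * v y powr (\<mu> - 1) * (- (2 * G y * v y)) / (\<mu> + 1))
        = \<mu> * (v y powr (\<mu> - 1) * v y / (\<mu> + 1))"
      using Gpos[of y] y by (simp add: field_simps)
    moreover have "v y powr (\<mu> - 1) * v y = v y powr \<mu>"
      using powr_add[of "v y" "\<mu> - 1" 1] vpos[of y] y by simp
    moreover have "v y powr \<mu> / (\<mu> + 1) = \<omega> - (G y)\<^sup>2" using G2[of y] y by simp
    ultimately show ?thesis by (simp only:)
  qed
  define T where "T = (\<lambda>x. sqrt \<omega> * tanh (\<mu> * sqrt \<omega> * (x + z)))"
  have dT: "(T has_real_derivative \<mu> * (\<omega> - (T y)\<^sup>2)) (at y)" for y
  proof -
    have "(T has_real_derivative sqrt \<omega> * ((1 - (tanh (\<mu> * sqrt \<omega> * (y + z)))\<^sup>2) * (\<mu> * sqrt \<omega>))) (at y)"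
      unfolding T_def by (auto intro!: derivative_eq_intros simp: cosh_real_nonzero)
    moreover have "sqrt \<omega> * ((1 - t\<^sup>2) * (\<mu> * sqrt \<omega>)) = \<mu> * (\<omega> - (sqrt \<omega> * t)\<^sup>2)" for t
      using \<omega> by (simp add: power_mult_distrib algebra_simps flip: power2_eq_square)
    ultimately show ?thesis by (simp add: T_def)
  qed
  have Tpos: "0 < T y" if "0 \<le> y" for y
    using shifted_soliton_tanh_bounds(1)[OF \<mu> \<omega> refl z that] z \<omega> unfolding T_def by (intro mult_pos_pos) auto
  have TS: "decay_rate \<mu> \<omega> ((soliton \<mu> \<omega> (y + z))\<^sup>2) = T y" if "0 \<le> y" for y
  proof -
    have "0 \<le> tanh (\<mu> * sqrt \<omega> * (y + z))"
      using shifted_soliton_tanh_bounds(1)[OF \<mu> \<omega> refl z that] z by linarith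
    then show ?thesis unfolding T_def by (rule decay_rate_soliton[OF \<mu> \<omega>])
  qed
  \<comment> \<open>Both \<open>G\<close> and \<open>T\<close> solve the Riccati equation \<open>y' = \<mu> (\<omega> - y\<^sup>2)\<close> with the same initial value.\<close>
  have GT: "G y = T y" if y: "0 \<le> y" for y
  proof -
    \<comment> \<open>The flow of \<open>y' = \<mu> (\<omega> - y\<^sup>2)\<close> contracts distances between positive solutions.\<close>
    have "(G y - T y)\<^sup>2 \<le> (G 0 - T 0)\<^sup>2"
    proof (rule DERIV_nonpos_imp_decreasing_open[OF y])
      have "continuous_on {0..y} T" by (rule DERIV_continuous_on) (rule has_field_derivative_at_within[OF dT])
      then show "continuous_on {0..y} (\<lambda>y. (G y - T y)\<^sup>2)"
        by (intro continuous_intros continuous_on_subset[OF cG]) auto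
      fix s assume s: "0 < s" "s < y"
      have "((\<lambda>y. (G y - T y)\<^sup>2) has_real_derivative
          2 * (G s - T s) * (\<mu> * (\<omega> - (G s)\<^sup>2) - \<mu> * (\<omega> - (T s)\<^sup>2))) (at s)"
        using DERIV_power[OF DERIV_diff[OF dG[OF s(1)] dT[of s]], of 2] by (simp add: algebra_simps)
      moreover have "2 * (G s - T s) * (\<mu> * (\<omega> - (G s)\<^sup>2) - \<mu> * (\<omega> - (T s)\<^sup>2)) = - (2 * \<mu> * (G s + T s) * (G s - T s)\<^sup>2)"
        by (simp add: algebra_simps power2_eq_square)
      moreover have "0 \<le> 2 * \<mu> * (G s + T s) * (G s - T s)\<^sup>2"
        using Gpos[of s] Tpos[of s] s \<mu> by simp
      ultimately show "\<exists>d. ((\<lambda>y. (G y - T y)\<^sup>2) has_real_derivative d) (at s) \<and> d \<le> 0"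
        by (metis neg_le_0_iff_le)
    qed
    moreover have "G 0 = T 0" using TS[of 0] by (simp add: G_def init)
    ultimately show ?thesis by simp
  qed
  let ?S = "\<lambda>x. soliton \<mu> \<omega> (x + z)"
  have Spos: "0 < ?S y" for y by (rule soliton_pos[OF \<mu> \<omega>])
  \<comment> \<open>With \<open>G = T\<close>, \<open>\<psi>\<close> and the soliton solve the same linear equation \<open>u' = - T u\<close>.\<close>
  have "\<exists>k. \<forall>y\<in>{0..}. inverse (?S y) *\<^sub>R \<psi> y = k"
  proof (rule has_vector_derivative_zero_constant)
    show "convex {0::real..}" by simp
    fix y :: real assume "y \<in> {0..}"
    then have y: "0 \<le> y" by simp
    have "(?S has_real_derivative - (T y * ?S y)) (at y)"
      using shifted_soliton_deriv[OF \<mu> \<omega>, of z y] by (simp add: T_def)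
    then have "((\<lambda>x. inverse (?S x)) has_real_derivative T y * inverse (?S y)) (at y)"
      by (rule DERIV_cong[OF DERIV_inverse_fun]) (use Spos[of y] in \<open>simp_all add: power2_eq_square field_simps\<close>)
    from has_vector_derivative_scaleR[OF has_field_derivative_at_within[OF this] d\<psi>[OF y]]
    have "((\<lambda>x. inverse (?S x) *\<^sub>R \<psi> x) has_vector_derivative
        inverse (?S y) *\<^sub>R F y + (T y * inverse (?S y)) *\<^sub>R \<psi> y) (at y within {0..})" .
    then show "((\<lambda>x. inverse (?S x) *\<^sub>R \<psi> x) has_vector_derivative 0) (at y within {0..})"
      using GT[OF y] by (simp add: F_def mult.commute)
  qed blast
  then obtain k where k: "\<And>y. 0 \<le> y \<Longrightarrow> inverse (?S y) *\<^sub>R \<psi> y = k" by auto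
  have "inverse (?S x) *\<^sub>R \<psi> x = inverse (?S 0) *\<^sub>R \<psi> 0" unfolding k[OF x] by (simp only: k[OF order_refl])
  then have "?S x *\<^sub>R (inverse (?S x) *\<^sub>R \<psi> x) = ?S x *\<^sub>R (inverse (?S 0) *\<^sub>R \<psi> 0)" by simp
  then show ?thesis using Spos[of x] by (simp add: scaleR_conv_of_real divide_inverse mult.commute mult.left_commute)
qed

section \<open>Sup norm and energy on the star graph\<close>

lemma test_function_deriv_integrable:
  assumes t: "test_function p p'" and g: "halfline_L2 g"
  shows "set_integrable lborel {0<..} (\<lambda>x. p' x *\<^sub>R g x)"
proof -
  from t obtain a b where ab: "0 < a" "a < b" and s: "\<And>x. x \<notin> {a..b} \<Longrightarrow> p x = 0"
    unfolding test_function_def by blast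
  have dp: "(p has_real_derivative p' x) (at x)" for x using t by (simp add: test_function_def)
  have cp': "continuous_on UNIV p'" using t by (simp add: test_function_def)
  have s': "p' x = 0" if "x \<notin> {a..b}" for x
  proof -
    have "((\<lambda>x. 0) has_real_derivative p' x) (at x)"
      by (rule has_field_derivative_transform_within_open[OF dp, of "- {a..b}"])
        (use that s in \<open>auto simp del: atLeastAtMost_iff\<close>)
    then show ?thesis using DERIV_unique DERIV_const by blast
  qed
  have "bounded (p' ` {a..b})"
    by (intro compact_imp_bounded compact_continuous_image continuous_on_subset[OF cp']) auto
  then obtain B where B: "\<And>x. x \<in> {a..b} \<Longrightarrow> norm (p' x) \<le> B"
    unfolding bounded_iff by (meson imageI)
  have i: "set_integrable lborel {0<..b} g" by (rule halfline_L2_integrable_bounded[OF g]) auto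
  have "integrable lborel (\<lambda>x. B * norm (indicator {0<..b} x *\<^sub>R g x))"
    using i unfolding set_integrable_def by (intro integrable_mult_right integrable_norm)
  then have "integrable lborel (\<lambda>x. p' x *\<^sub>R (indicator {0<..b} x *\<^sub>R g x))"
  proof (rule Bochner_Integration.integrable_bound)
    have "(\<lambda>x. indicator {0<..b} x *\<^sub>R g x) \<in> borel_measurable lborel"
      using i unfolding set_integrable_def by (rule borel_measurable_integrable)
    then show "(\<lambda>x. p' x *\<^sub>R indicat_real {0<..b} x *\<^sub>R g x) \<in> borel_measurable lborel"
      by (rule borel_measurable_scaleR[rotated]) (simp add: borel_measurable_continuous_onI[OF cp'])
    show "AE x in lborel. norm (p' x *\<^sub>R indicat_real {0<..b} x *\<^sub>R g x)
         \<le> norm (B * cmod (indicat_real {0<..b} x *\<^sub>R g x))"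
    proof (rule AE_I2)
      fix x
      show "norm (p' x *\<^sub>R indicat_real {0<..b} x *\<^sub>R g x) \<le> norm (B * cmod (indicat_real {0<..b} x *\<^sub>R g x))"
      proof (cases "x \<in> {a..b}")
        case True
        then have "\<bar>p' x\<bar> \<le> \<bar>B\<bar>" using B[of x] by simp
        then show ?thesis by (simp add: abs_mult mult.assoc mult_right_mono)
      qed (simp add: s')
    qed
  qed
  moreover have "p' x *\<^sub>R (indicator {0<..b} x *\<^sub>R g x) = indicator {0<..} x *\<^sub>R (p' x *\<^sub>R g x)" for x
    using s'[of x] ab by (cases "x \<in> {a..b}") (auto simp: indicator_def)
  ultimately show ?thesis unfolding set_integrable_def by (simp only:)
qed

lemma has_weak_deriv_diff:
  assumes f: "has_weak_deriv f f'" and g: "has_weak_deriv g g'"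
  shows "has_weak_deriv (\<lambda>x. f x - g x) (\<lambda>x. f' x - g' x)"
proof -
  have L: "halfline_L2 f" "halfline_L2 f'" "halfline_L2 g" "halfline_L2 g'"
    using f g by (auto simp: has_weak_deriv_def)
  have "(LINT x:{0<..}|lborel. p' x *\<^sub>R (f x - g x)) = - (LINT x:{0<..}|lborel. p x *\<^sub>R (f' x - g' x))"
    if t: "test_function p p'" for p p'
  proof -
    have "(LINT x:{0<..}|lborel. p' x *\<^sub>R f x) = - (LINT x:{0<..}|lborel. p x *\<^sub>R f' x)"
      "(LINT x:{0<..}|lborel. p' x *\<^sub>R g x) = - (LINT x:{0<..}|lborel. p x *\<^sub>R g' x)"
      using f g t unfolding has_weak_deriv_def by blast+
    then show ?thesis
      using set_integral_diff(2)[OF test_function_deriv_integrable[OF t L(1)] test_function_deriv_integrable[OF t L(3)]]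
        set_integral_diff(2)[OF test_function_integrable[OF t L(2)] test_function_integrable[OF t L(4)]]
      by (simp add: scaleR_right_diff_distrib)
  qed
  then show ?thesis unfolding has_weak_deriv_def by (intro conjI allI impI halfline_L2_diff L) auto
qed

lemma graph_Lp_norm_powr:
  assumes "r \<noteq> 0"
  shows "graph_Lp_norm N r \<Psi> powr r = (\<Sum>j=1..N. LINT x:{0<..}|lborel. norm (\<Psi> j x) powr r)"
proof -
  have "0 \<le> (\<Sum>j=1..N. LINT x:{0<..}|lborel. norm (\<Psi> j x) powr r)"
    by (intro sum_nonneg) (simp add: set_lebesgue_integral_def Bochner_Integration.integral_nonneg)
  then show ?thesis using assms by (simp add: graph_Lp_norm_def powr_powr)
qed

lemma graph_Lp_norm_2_squared:
  "(graph_Lp_norm N 2 \<Psi>)\<^sup>2 = (\<Sum>j=1..N. LINT x:{0<..}|lborel. (norm (\<Psi> j x))\<^sup>2)"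
proof -
  have "0 \<le> graph_Lp_norm N 2 \<Psi>" by (simp add: graph_Lp_norm_def)
  then have "(graph_Lp_norm N 2 \<Psi>)\<^sup>2 = graph_Lp_norm N 2 \<Psi> powr 2" by simp
  then show ?thesis by (simp add: graph_Lp_norm_powr)
qed

lemma graph_H1_components:
  assumes "\<Psi> \<in> graph_H1 N" "j \<in> {1..N}"
  shows "continuous_on {0..} (\<Psi> j)" "has_weak_deriv (\<Psi> j) (graph_deriv \<Psi> j)" "\<Psi> j 0 = vertex_value \<Psi>"
proof -
  have h: "halfline_H1 (\<Psi> j)" and "\<Psi> j 0 = vertex_value \<Psi>" using assms by (auto simp: graph_H1_def)
  then show "continuous_on {0..} (\<Psi> j)" "\<Psi> j 0 = vertex_value \<Psi>" by (auto simp: halfline_H1_def)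
  show "has_weak_deriv (\<Psi> j) (graph_deriv \<Psi> j)"
    using h someI_ex[of "has_weak_deriv (\<Psi> j)"] by (simp add: halfline_H1_def graph_deriv_def weak_deriv_def)
qed

lemma graph_H1_diff_sup_bound:
  assumes \<Phi>: "\<Phi> \<in> graph_H1 N" and \<Psi>: "\<Psi> \<in> graph_H1 N" and j: "j \<in> {1..N}" and x: "0 \<le> x"
  shows "norm (\<Phi> j x - \<Psi> j x) \<le> graph_H1_norm N (\<lambda>j x. \<Phi> j x - \<Psi> j x)"
proof -
  let ?D = "\<lambda>j x. \<Phi> j x - \<Psi> j x"
  have c: "continuous_on {0..} (?D j)"
    by (intro continuous_on_diff graph_H1_components(1)[OF \<Phi> j] graph_H1_components(1)[OF \<Psi> j])
  have "\<exists>g. has_weak_deriv (?D j) g"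
    using has_weak_deriv_diff[OF graph_H1_components(2)[OF \<Phi> j] graph_H1_components(2)[OF \<Psi> j]] by blast
  then have w: "has_weak_deriv (?D j) (graph_deriv ?D j)"
    unfolding graph_deriv_def weak_deriv_def by (rule someI_ex)
  have nonneg: "0 \<le> (LINT x:{0<..}|lborel. (norm (u j x))\<^sup>2)" for u :: "nat \<Rightarrow> real \<Rightarrow> complex" and j
    by (simp add: set_lebesgue_integral_def Bochner_Integration.integral_nonneg)
  have le: "(LINT x:{0<..}|lborel. (norm (u j x))\<^sup>2) \<le> (graph_Lp_norm N 2 u)\<^sup>2" for u
    unfolding graph_Lp_norm_2_squared using j by (intro member_le_sum nonneg) auto
  have "(norm (?D j x))\<^sup>2 \<le> (graph_H1_norm N ?D)\<^sup>2"
    using weak_deriv_sup_bound[OF w c x] le[of ?D] le[of "graph_deriv ?D"] by (simp add: graph_H1_norm_def)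
  then show ?thesis by (rule power2_le_imp_le) (simp add: graph_H1_norm_def)
qed

text \<open>The choice of the weak derivative does not affect the integral.\<close>

definition decay_defect :: "real \<Rightarrow> real \<Rightarrow> (real \<Rightarrow> complex) \<Rightarrow> real" where
  "decay_defect \<mu> \<nu> \<psi> =
     (LINT x:{0<..}|lborel. (norm (weak_deriv \<psi> x + decay_rate \<mu> \<nu> ((norm (\<psi> x))\<^sup>2) *\<^sub>R \<psi> x))\<^sup>2)"

lemma energy_completing_square:
  assumes \<mu>: "0 < \<mu>" and \<Psi>: "\<Psi> \<in> graph_H1_mass N M"
    and b: "\<And>j x. j \<in> {1..N} \<Longrightarrow> 0 \<le> x \<Longrightarrow> norm (\<Psi> j x) powr (2 * \<mu>) \<le> (\<mu> + 1) * \<nu>"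
  shows "energy N \<mu> \<alpha> \<Psi> = (\<Sum>j=1..N. decay_defect \<mu> \<nu> (\<Psi> j)) / 2
     + real N / 2 * soliton_action \<mu> \<nu> ((norm (vertex_value \<Psi>))\<^sup>2)
     - \<alpha> / 2 * (norm (vertex_value \<Psi>))\<^sup>2 - \<nu> * M / 2"
proof -
  have H: "\<Psi> \<in> graph_H1 N" and M: "M = (\<Sum>j=1..N. LINT x:{0<..}|lborel. (norm (\<Psi> j x))\<^sup>2)"
    using \<Psi> by (auto simp: graph_H1_mass_def graph_Lp_norm_2_squared)
  let ?P = "\<lambda>j. LINT x:{0<..}|lborel. norm (\<Psi> j x) powr (2 * \<mu> + 2)"
  have "(\<Sum>j=1..N. LINT x:{0<..}|lborel. (norm (graph_deriv \<Psi> j x))\<^sup>2) + \<nu> * M - (\<Sum>j=1..N. ?P j) / (\<mu> + 1)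
     = (\<Sum>j=1..N. (LINT x:{0<..}|lborel. (norm (graph_deriv \<Psi> j x))\<^sup>2)
         + \<nu> * (LINT x:{0<..}|lborel. (norm (\<Psi> j x))\<^sup>2) - ?P j / (\<mu> + 1))"
    by (simp add: M sum.distrib sum_subtractf sum_distrib_left sum_divide_distrib)
  also have "\<dots> = (\<Sum>j=1..N. decay_defect \<mu> \<nu> (\<Psi> j) + soliton_action \<mu> \<nu> ((norm (vertex_value \<Psi>))\<^sup>2))"
  proof (rule sum.cong[OF refl])
    fix j assume j: "j \<in> {1..N}"
    show "(LINT x:{0<..}|lborel. (norm (graph_deriv \<Psi> j x))\<^sup>2)
         + \<nu> * (LINT x:{0<..}|lborel. (norm (\<Psi> j x))\<^sup>2) - ?P j / (\<mu> + 1)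
         = decay_defect \<mu> \<nu> (\<Psi> j) + soliton_action \<mu> \<nu> ((norm (vertex_value \<Psi>))\<^sup>2)"
      using halfline_completing_square(2)[OF \<mu> graph_H1_components(2,1)[OF H j] b[OF j]]
        graph_H1_components(3)[OF H j] by (simp add: decay_defect_def graph_deriv_def)
  qed
  finally have id: "(\<Sum>j=1..N. LINT x:{0<..}|lborel. (norm (graph_deriv \<Psi> j x))\<^sup>2) + \<nu> * M - (\<Sum>j=1..N. ?P j) / (\<mu> + 1)
     = (\<Sum>j=1..N. decay_defect \<mu> \<nu> (\<Psi> j)) + real N * soliton_action \<mu> \<nu> ((norm (vertex_value \<Psi>))\<^sup>2)"
    by (simp add: sum.distrib)
  have p: "1 / (2 * \<mu> + 2) * s = s / (\<mu> + 1) / 2" for s using \<mu> by (simp add: field_simps)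
  have r: "2 * \<mu> + 2 \<noteq> 0" using \<mu> by simp
  have "1 / 2 * G - Q / 2 - v = D / 2 + k / 2 * A - v - n * m / 2" if "G + n * m - Q = D + k * A"
    for G Q v D k A n m :: real using that by (simp add: field_simps)
  from this[OF id] show ?thesis
    unfolding energy_def graph_Lp_norm_2_squared graph_Lp_norm_powr[OF r] p .
qed

lemma decay_defect_nonneg: "0 \<le> decay_defect \<mu> \<nu> \<psi>"
  by (simp add: decay_defect_def set_lebesgue_integral_def Bochner_Integration.integral_nonneg)

lemma decay_defect_zero_iff:
  assumes \<mu>: "0 < \<mu>" and w: "has_weak_deriv \<psi> g" and c: "continuous_on {0..} \<psi>"
    and b: "\<And>x. 0 \<le> x \<Longrightarrow> norm (\<psi> x) powr (2 * \<mu>) \<le> (\<mu> + 1) * \<nu>"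
  shows "decay_defect \<mu> \<nu> \<psi> = 0 \<longleftrightarrow>
    (AE x in lborel. 0 < x \<longrightarrow> g x = - (decay_rate \<mu> \<nu> ((norm (\<psi> x))\<^sup>2) *\<^sub>R \<psi> x))"
proof -
  have w': "has_weak_deriv \<psi> (weak_deriv \<psi>)" unfolding weak_deriv_def by (rule someI[of "has_weak_deriv \<psi>", OF w])
  let ?R = "\<lambda>x. weak_deriv \<psi> x + decay_rate \<mu> \<nu> ((norm (\<psi> x))\<^sup>2) *\<^sub>R \<psi> x"
  have "set_integrable lborel {0<..} (\<lambda>x. (norm (?R x))\<^sup>2)"
    using halfline_completing_square(1)[OF \<mu> w' c b] by (simp add: halfline_L2_def)
  then have "decay_defect \<mu> \<nu> \<psi> = 0 \<longleftrightarrow> (AE x in lborel. indicat_real {0<..} x *\<^sub>R (norm (?R x))\<^sup>2 = 0)"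
    unfolding decay_defect_def set_lebesgue_integral_def set_integrable_def
    by (rule integral_nonneg_eq_0_iff_AE) auto
  also have "\<dots> \<longleftrightarrow> (AE x in lborel. 0 < x \<longrightarrow> ?R x = 0)"
    by (rule AE_cong) (auto simp: indicator_def)
  also have "\<dots> \<longleftrightarrow> (AE x in lborel. 0 < x \<longrightarrow> g x = - (decay_rate \<mu> \<nu> ((norm (\<psi> x))\<^sup>2) *\<^sub>R \<psi> x))"
  proof -
    have eq: "AE x in lborel. (0 < x \<longrightarrow> ?R x = 0) = (0 < x \<longrightarrow> g x = - (decay_rate \<mu> \<nu> ((norm (\<psi> x))\<^sup>2) *\<^sub>R \<psi> x))"
      using has_weak_deriv_unique[OF w w'] by eventually_elim (auto simp: add_eq_0_iff2)
    show ?thesis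
    proof
      assume "AE x in lborel. 0 < x \<longrightarrow> ?R x = 0"
      with eq show "AE x in lborel. 0 < x \<longrightarrow> g x = - (decay_rate \<mu> \<nu> ((norm (\<psi> x))\<^sup>2) *\<^sub>R \<psi> x)"
        by eventually_elim blast
    next
      assume "AE x in lborel. 0 < x \<longrightarrow> g x = - (decay_rate \<mu> \<nu> ((norm (\<psi> x))\<^sup>2) *\<^sub>R \<psi> x)"
      with eq show "AE x in lborel. 0 < x \<longrightarrow> ?R x = 0" by eventually_elim blast
    qed
  qed
  finally show ?thesis .
qed

section \<open>Local minimality of the symmetric bound state\<close>

text \<open>The square vanishes on the shifted soliton, so the energy consists of the boundary terms alone.\<close>

lemma energy_soliton_branch:
  assumes \<mu>: "0 < \<mu>" and N: "1 \<le> N" and \<beta>: "0 < \<beta>" "\<beta>\<^sup>2 < \<omega>" and z: "tanh (\<mu> * sqrt \<omega> * z) = \<beta> / sqrt \<omega>"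
    and \<Phi>: "\<Phi> \<in> graph_H1_mass N M"
    and eq: "\<And>j x. j \<in> {1..N} \<Longrightarrow> 0 \<le> x \<Longrightarrow> \<Phi> j x = c * complex_of_real (soliton \<mu> \<omega> (x + z))"
    and c: "norm c = 1"
  shows "energy N \<mu> (real N * \<beta>) \<Phi> = real N / 2 * branch_action \<mu> \<beta> \<omega> - \<omega> * M / 2"
proof -
  note r = branch_ratio[OF \<beta>]
  let ?S = "\<lambda>x. soliton \<mu> \<omega> (x + z)"
  have S: "0 < ?S x" for x by (rule soliton_pos[OF \<mu> r(1)])
  have H: "\<Phi> \<in> graph_H1 N" using \<Phi> by (simp add: graph_H1_mass_def)
  have nrm: "norm (\<Phi> j x) = ?S x" if "j \<in> {1..N}" "0 \<le> x" for j x
    using S[of x] by (simp add: eq[OF that] norm_mult c)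
  have b: "norm (\<Phi> j x) powr (2 * \<mu>) \<le> (\<mu> + 1) * \<omega>" if "j \<in> {1..N}" "0 \<le> x" for j x
  proof -
    have "(\<mu> + 1) * \<omega> * (1 - (tanh (\<mu> * sqrt \<omega> * (x + z)))\<^sup>2) \<le> (\<mu> + 1) * \<omega> * 1"
      using \<mu> r(1) by (intro mult_left_mono) auto
    then show ?thesis by (simp add: nrm[OF that] soliton_powr[OF \<mu> r(1)])
  qed
  have defect: "decay_defect \<mu> \<omega> (\<Phi> j) = 0" if j: "j \<in> {1..N}" for j
  proof -
    have w: "has_weak_deriv (\<Phi> j) (\<lambda>x. c * complex_of_real (- sqrt \<omega> * tanh (\<mu> * sqrt \<omega> * (x + z)) * ?S x))"
    proof (rule has_weak_deriv_cong[OF shifted_soliton_weak_deriv[OF \<mu> r(1), of c z]])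
      show "halfline_L2 (\<Phi> j)" using graph_H1_components(2)[OF H j] by (simp add: has_weak_deriv_def)
      show "AE x in lborel. 0 < x \<longrightarrow> \<Phi> j x = c * complex_of_real (?S x)"
        using eq[OF j] by (intro AE_I2) simp
    qed
    have t: "decay_rate \<mu> \<omega> ((norm (\<Phi> j x))\<^sup>2) = sqrt \<omega> * tanh (\<mu> * sqrt \<omega> * (x + z))" if "0 < x" for x
    proof -
      have "0 \<le> tanh (\<mu> * sqrt \<omega> * (x + z))"
        using shifted_soliton_tanh_bounds(1)[OF \<mu> r(1) z r(2), of x] r(2) that by linarith
      then show ?thesis using nrm[OF j, of x] that by (simp only: less_imp_le decay_rate_soliton[OF \<mu> r(1)])
    qed
    show ?thesis
    proof (subst decay_defect_zero_iff[OF \<mu> w graph_H1_components(1)[OF H j] b[OF j]])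
      show "AE x in lborel. 0 < x \<longrightarrow> c * complex_of_real (- sqrt \<omega> * tanh (\<mu> * sqrt \<omega> * (x + z)) * ?S x)
          = - (decay_rate \<mu> \<omega> ((norm (\<Phi> j x))\<^sup>2) *\<^sub>R \<Phi> j x)"
        using t eq[OF j] by (intro AE_I2 impI) (simp add: scaleR_conv_of_real mult_ac)
    qed
  qed
  have v: "norm (vertex_value \<Phi>) = soliton \<mu> \<omega> z"
    using nrm[of 1 0] N by (simp add: vertex_value_def)
  define t where "t = (soliton \<mu> \<omega> z)\<^sup>2"
  have t: "0 < t" using soliton_pos[OF \<mu> r(1), of z] by (simp add: t_def)
  have "t powr \<mu> = soliton \<mu> \<omega> z powr (2 * \<mu>)"
    using soliton_pos[OF \<mu> r(1), of z] by (simp add: t_def powr_powr flip: powr_numeral)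
  also have "\<dots> = (\<mu> + 1) * (\<omega> - \<beta>\<^sup>2)"
    using r(1) by (simp add: soliton_powr[OF \<mu> r(1)] z power_divide right_diff_distrib)
  finally have "\<omega> = t powr \<mu> / (\<mu> + 1) + \<beta>\<^sup>2" using \<mu> by simp
  from soliton_action_at_vertex[OF \<mu> \<beta>(1) t this]
  have sa: "soliton_action \<mu> \<omega> t = branch_action \<mu> \<beta> \<omega> + \<beta> * t" by simp
  have "energy N \<mu> (real N * \<beta>) \<Phi> = (\<Sum>j=1..N. decay_defect \<mu> \<omega> (\<Phi> j)) / 2
     + real N / 2 * soliton_action \<mu> \<omega> t - real N * \<beta> / 2 * t - \<omega> * M / 2"
    using energy_completing_square[OF \<mu> \<Phi> b] by (simp only: v t_def)
  then show ?thesis by (simp add: defect sa algebra_simps)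
qed

theorem theorem1:
  fixes N :: nat and \<mu> \<alpha> \<omega> M :: real
    and \<Psi>\<^sub>\<omega> :: "nat \<Rightarrow> real \<Rightarrow> complex"
  assumes "N \<ge> 3"
    and "0 < \<mu>" and "\<mu> < 2"
    and "\<alpha> > 0"
    and "\<omega> > \<alpha>\<^sup>2 / (real N)\<^sup>2"
    and "\<Psi>\<^sub>\<omega> = symmetric_bound_state N \<mu> \<alpha> \<omega>"
    and "M = (graph_Lp_norm N 2 \<Psi>\<^sub>\<omega>)\<^sup>2"
  shows "\<Psi>\<^sub>\<omega> \<in> graph_H1_mass N M \<and>
    (\<exists>\<delta>>0. \<forall>\<Phi>\<in>graph_H1_mass N M.
       graph_H1_norm N (\<lambda>j x. \<Phi> j x - \<Psi>\<^sub>\<omega> j x) < \<delta> \<longrightarrow>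
         energy N \<mu> \<alpha> \<Phi> \<ge> energy N \<mu> \<alpha> \<Psi>\<^sub>\<omega> \<and>
         (energy N \<mu> \<alpha> \<Phi> = energy N \<mu> \<alpha> \<Psi>\<^sub>\<omega> \<longleftrightarrow>
           (\<exists>\<theta>::real. \<forall>j\<in>{1..N}. \<forall>x\<ge>0.
              \<Phi> j x = exp (\<i> * complex_of_real \<theta>) * \<Psi>\<^sub>\<omega> j x)))"
proof
  note \<mu> = \<open>0 < \<mu>\<close>
  have N: "1 \<le> N" using \<open>N \<ge> 3\<close> by simp
  define \<beta> where "\<beta> = \<alpha> / real N"
  define z where "z = soliton_shift N \<mu> \<alpha> \<omega>"
  have \<alpha>: "\<alpha> = real N * \<beta>" using N by (simp add: \<beta>_def)
  have \<beta>: "0 < \<beta>" "\<beta>\<^sup>2 < \<omega>" using assms N by (simp_all add: \<beta>_def power_divide)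
  note r = branch_ratio[OF \<beta>]
  have z: "tanh (\<mu> * sqrt \<omega> * z) = \<beta> / sqrt \<omega>"
  proof -
    have "\<mu> * sqrt \<omega> * z = artanh (\<beta> / sqrt \<omega>)"
      using \<mu> r by (simp add: z_def soliton_shift_def \<beta>_def)
    moreover have "\<bar>\<beta> / sqrt \<omega>\<bar> < 1" using r(2,3) by linarith
    ultimately show ?thesis by (simp only: tanh_artanh)
  qed
  let ?S = "\<lambda>x. soliton \<mu> \<omega> (x + z)"
  have \<Psi>: "\<Psi>\<^sub>\<omega> j x = complex_of_real (?S x)" for j x
    by (simp add: assms(6) symmetric_bound_state_def z_def)
  have S: "0 < ?S x" for x by (rule soliton_pos[OF \<mu> r(1)])
  have H\<Psi>: "\<Psi>\<^sub>\<omega> \<in> graph_H1 N"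
    using symmetric_bound_state_stationary[OF N \<mu>, of \<alpha> \<omega>] assms(5)
    by (simp add: assms(6) stationary_state_def hamiltonian_domain_def)
  then show mass\<Psi>: "\<Psi>\<^sub>\<omega> \<in> graph_H1_mass N M" by (simp add: graph_H1_mass_def assms(7))
  have M: "M = real N * branch_mass \<mu> \<beta> \<omega>"
    using shifted_soliton_mass[OF \<mu> \<beta> z] S by (simp add: assms(7) graph_Lp_norm_2_squared \<Psi>)
  \<comment> \<open>stated for all phases \<open>c\<close>, so that it serves \<open>\<Psi>\<^sub>\<omega>\<close> and its rotations alike\<close>
  have E: "energy N \<mu> \<alpha> \<Phi> = real N / 2 * branch_action \<mu> \<beta> \<omega> - \<omega> * M / 2"
    if "\<Phi> \<in> graph_H1_mass N M" "norm c = 1"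
      "\<And>j x. j \<in> {1..N} \<Longrightarrow> 0 \<le> x \<Longrightarrow> \<Phi> j x = c * complex_of_real (?S x)" for \<Phi> c
    unfolding \<alpha> using energy_soliton_branch[OF \<mu> N \<beta> z that(1,3,2)] by blast
  have E\<Psi>: "energy N \<mu> \<alpha> \<Psi>\<^sub>\<omega> = real N / 2 * branch_action \<mu> \<beta> \<omega> - \<omega> * M / 2"
    by (rule E[OF mass\<Psi>, of 1]) (simp_all add: \<Psi>)
  define a where "a = soliton \<mu> \<omega> z"
  have a: "0 < a" using S[of 0] by (simp add: a_def)
  have apow: "a powr (2 * \<mu>) = (\<mu> + 1) * (\<omega> - \<beta>\<^sup>2)"
    using r(1) by (simp add: a_def soliton_powr[OF \<mu> r(1)] z power_divide right_diff_distrib)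
  have Sa: "?S x \<le> a" if x: "0 \<le> x" for x
  proof -
    have "(\<beta> / sqrt \<omega>)\<^sup>2 \<le> (tanh (\<mu> * sqrt \<omega> * (x + z)))\<^sup>2"
      using shifted_soliton_tanh_bounds(1)[OF \<mu> r(1) z r(2) x] r(2) by (intro power_mono) auto
    then have "?S x powr (2 * \<mu>) \<le> a powr (2 * \<mu>)"
      unfolding a_def soliton_powr[OF \<mu> r(1)] z using \<mu> r(1) by (intro mult_left_mono) auto
    then show ?thesis using \<mu> S[of x] a by (meson less_eq_real_def mult_pos_pos not_le powr_less_mono2 zero_less_numeral)
  qed
  \<comment> \<open>On the \<open>\<delta>\<close>-ball all moduli are below \<open>a + \<delta>\<close> and the vertex modulus is above \<open>a - \<delta>\<close>. The
    inequality keeps the radicand of the decay rate positive for the frequency \<open>\<nu>\<close> chosen below, since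
    \<open>(\<mu> + 1) \<nu> = s\<^bsup>2\<mu>\<^esup> + (\<mu> + 1) \<beta>\<^sup>2\<close> for the vertex modulus \<open>s\<close>.\<close>
  obtain \<delta> where \<delta>: "0 < \<delta>" "\<delta> < a" "(a + \<delta>) powr (2 * \<mu>) < (a - \<delta>) powr (2 * \<mu>) + (\<mu> + 1) * \<beta>\<^sup>2"
  proof -
    let ?f = "\<lambda>d. (a - d) powr (2 * \<mu>) + (\<mu> + 1) * \<beta>\<^sup>2 - (a + d) powr (2 * \<mu>)"
    have "(?f \<longlongrightarrow> ?f 0) (at_right 0)"
      using a by (intro tendsto_intros) auto
    moreover have "0 < ?f 0" using \<mu> \<beta> by simp
    ultimately have "eventually (\<lambda>d. 0 < ?f d) (at_right 0)" by (rule order_tendstoD(1))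
    moreover have "eventually (\<lambda>d. d < a) (at_right 0)"
      using a by (rule eventually_at_rightI[of 0 a, rotated]) auto
    moreover have "eventually (\<lambda>d::real. 0 < d) (at_right 0)" by (rule eventually_at_right_less)
    ultimately have "eventually (\<lambda>d. 0 < ?f d \<and> d < a \<and> 0 < d) (at_right 0)" by eventually_elim simp
    then obtain d where "0 < ?f d" "d < a" "0 < d"
      using eventually_happens trivial_limit_at_right_real by blast
    then show ?thesis using that[of d] by simp
  qed
  show "\<exists>\<delta>>0. \<forall>\<Phi>\<in>graph_H1_mass N M.
       graph_H1_norm N (\<lambda>j x. \<Phi> j x - \<Psi>\<^sub>\<omega> j x) < \<delta> \<longrightarrow>
         energy N \<mu> \<alpha> \<Phi> \<ge> energy N \<mu> \<alpha> \<Psi>\<^sub>\<omega> \<and>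
         (energy N \<mu> \<alpha> \<Phi> = energy N \<mu> \<alpha> \<Psi>\<^sub>\<omega> \<longleftrightarrow>
           (\<exists>\<theta>::real. \<forall>j\<in>{1..N}. \<forall>x\<ge>0.
              \<Phi> j x = exp (\<i> * complex_of_real \<theta>) * \<Psi>\<^sub>\<omega> j x))"
  proof (intro exI[of _ \<delta>] conjI ballI impI \<delta>(1))
    fix \<Phi> assume \<Phi>: "\<Phi> \<in> graph_H1_mass N M"
      and near: "graph_H1_norm N (\<lambda>j x. \<Phi> j x - \<Psi>\<^sub>\<omega> j x) < \<delta>"
    have H: "\<Phi> \<in> graph_H1 N" using \<Phi> by (simp add: graph_H1_mass_def)
    have close: "norm (\<Phi> j x - complex_of_real (?S x)) < \<delta>" if "j \<in> {1..N}" "0 \<le> x" for j x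
      using graph_H1_diff_sup_bound[OF H H\<Psi> that] near by (simp add: \<Psi>)
    define s where "s = norm (vertex_value \<Phi>)"
    have s: "a - \<delta> < s"
    proof -
      have "norm (vertex_value \<Phi> - complex_of_real a) < \<delta>"
        using close[of 1 0] N by (simp add: vertex_value_def a_def)
      moreover have "norm (complex_of_real a) - norm (vertex_value \<Phi>) \<le> norm (vertex_value \<Phi> - complex_of_real a)"
        by (metis norm_minus_commute norm_triangle_ineq2)
      ultimately show ?thesis using a by (simp add: s_def)
    qed
    have spos: "0 < s" using s \<delta> by linarith
    \<comment> \<open>the frequency of the symmetric bound state that has the vertex modulus of \<open>\<Phi>\<close>\<close>
    define \<nu> where "\<nu> = s powr (2 * \<mu>) / (\<mu> + 1) + \<beta>\<^sup>2"
    have \<nu>: "\<beta>\<^sup>2 < \<nu>" using \<mu> spos by (simp add: \<nu>_def)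
    have b: "norm (\<Phi> j x) powr (2 * \<mu>) < (\<mu> + 1) * \<nu>" if "j \<in> {1..N}" "0 \<le> x" for j x
    proof -
      have "norm (\<Phi> j x) \<le> norm (complex_of_real (?S x)) + norm (\<Phi> j x - complex_of_real (?S x))"
        by (metis add.commute diff_add_cancel norm_triangle_ineq)
      then have "norm (\<Phi> j x) \<le> a + \<delta>"
        using close[OF that] Sa[OF that(2)] S[of x] by simp
      then have "norm (\<Phi> j x) powr (2 * \<mu>) \<le> (a + \<delta>) powr (2 * \<mu>)" using \<mu> by (intro powr_mono2) auto
      also have "\<dots> < (a - \<delta>) powr (2 * \<mu>) + (\<mu> + 1) * \<beta>\<^sup>2" by (rule \<delta>(3))
      also have "\<dots> \<le> s powr (2 * \<mu>) + (\<mu> + 1) * \<beta>\<^sup>2" using s \<delta> \<mu> by (intro add_right_mono powr_mono2) auto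
      also have "\<dots> = (\<mu> + 1) * \<nu>" using \<mu> by (simp add: \<nu>_def field_simps)
      finally show ?thesis .
    qed
    have sa: "soliton_action \<mu> \<nu> (s\<^sup>2) = branch_action \<mu> \<beta> \<nu> + \<beta> * s\<^sup>2"
    proof -
      have "(s\<^sup>2) powr \<mu> = s powr (2 * \<mu>)" using spos by (simp add: powr_powr flip: powr_numeral)
      then show ?thesis
        using soliton_action_at_vertex[OF \<mu> \<beta>(1), of "s\<^sup>2" \<nu>] spos by (simp add: \<nu>_def)
    qed
    let ?D = "\<Sum>j=1..N. decay_defect \<mu> \<nu> (\<Phi> j)"
    have E\<Phi>: "energy N \<mu> \<alpha> \<Phi> = ?D / 2 + real N / 2 * branch_action \<mu> \<beta> \<nu> - \<nu> * M / 2"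
      using energy_completing_square[OF \<mu> \<Phi> less_imp_le[OF b], of \<alpha>] unfolding s_def[symmetric] sa
      by (simp add: \<alpha> algebra_simps)
    have gap: "energy N \<mu> \<alpha> \<Phi> - energy N \<mu> \<alpha> \<Psi>\<^sub>\<omega> = ?D / 2
        + real N / 2 * (branch_action \<mu> \<beta> \<nu> - (branch_action \<mu> \<beta> \<omega> + branch_mass \<mu> \<beta> \<omega> * (\<nu> - \<omega>)))"
      unfolding E\<Phi> E\<Psi> M by (simp add: field_simps)
    have D: "0 \<le> ?D" by (intro sum_nonneg decay_defect_nonneg)
    have tangent: "branch_action \<mu> \<beta> \<omega> + branch_mass \<mu> \<beta> \<omega> * (\<nu> - \<omega>) < branch_action \<mu> \<beta> \<nu>" if "\<nu> \<noteq> \<omega>"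
      by (rule branch_action_tangent[OF \<mu> \<open>\<mu> < 2\<close> \<beta>(1) \<nu> \<beta>(2) that])
    then have T: "0 \<le> real N / 2 * (branch_action \<mu> \<beta> \<nu> - (branch_action \<mu> \<beta> \<omega> + branch_mass \<mu> \<beta> \<omega> * (\<nu> - \<omega>)))"
      by (cases "\<nu> = \<omega>") (auto intro!: mult_nonneg_nonneg)
    show "energy N \<mu> \<alpha> \<Psi>\<^sub>\<omega> \<le> energy N \<mu> \<alpha> \<Phi>" using gap D T by linarith
    show "energy N \<mu> \<alpha> \<Phi> = energy N \<mu> \<alpha> \<Psi>\<^sub>\<omega> \<longleftrightarrow>
        (\<exists>\<theta>::real. \<forall>j\<in>{1..N}. \<forall>x\<ge>0. \<Phi> j x = exp (\<i> * complex_of_real \<theta>) * \<Psi>\<^sub>\<omega> j x)"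
    proof
      assume "\<exists>\<theta>::real. \<forall>j\<in>{1..N}. \<forall>x\<ge>0. \<Phi> j x = exp (\<i> * complex_of_real \<theta>) * \<Psi>\<^sub>\<omega> j x"
      then obtain \<theta> :: real where
        "\<And>j x. j \<in> {1..N} \<Longrightarrow> 0 \<le> x \<Longrightarrow> \<Phi> j x = exp (\<i> * complex_of_real \<theta>) * complex_of_real (?S x)"
        unfolding \<Psi> by blast
      from E[OF \<Phi> _ this] show "energy N \<mu> \<alpha> \<Phi> = energy N \<mu> \<alpha> \<Psi>\<^sub>\<omega>" by (simp add: E\<Psi>)
    next
      assume "energy N \<mu> \<alpha> \<Phi> = energy N \<mu> \<alpha> \<Psi>\<^sub>\<omega>"
      then have D0: "?D = 0"
        and T0: "real N / 2 * (branch_action \<mu> \<beta> \<nu> - (branch_action \<mu> \<beta> \<omega> + branch_mass \<mu> \<beta> \<omega> * (\<nu> - \<omega>))) = 0"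
        using gap D T by linarith+
      have \<nu>\<omega>: "\<nu> = \<omega>"
        using T0 N tangent by fastforce
      have "s powr (2 * \<mu>) = a powr (2 * \<mu>)"
        using \<nu>\<omega> \<mu> unfolding apow \<nu>_def by (simp add: field_simps)
      then have sa_eq: "s = a"
        using spos a \<mu> by (metis less_eq_real_def linorder_neqE_linordered_idom mult_pos_pos order_less_irrefl powr_less_mono2 zero_less_numeral)
      define \<theta> where "\<theta> = Arg2pi (vertex_value \<Phi>)"
      have \<theta>: "vertex_value \<Phi> = complex_of_real a * exp (\<i> * complex_of_real \<theta>)"
        unfolding \<theta>_def sa_eq[symmetric] s_def by (rule Arg2pi_eq)
      show "\<exists>\<theta>::real. \<forall>j\<in>{1..N}. \<forall>x\<ge>0. \<Phi> j x = exp (\<i> * complex_of_real \<theta>) * \<Psi>\<^sub>\<omega> j x"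
      proof (intro exI[of _ \<theta>] ballI allI impI)
        fix j and x :: real assume j: "j \<in> {1..N}" and x: "0 \<le> x"
        have "decay_defect \<mu> \<omega> (\<Phi> j) = 0"
          using D0 j decay_defect_nonneg by (simp add: sum_nonneg_eq_0_iff \<nu>\<omega>)
        then have ode: "AE x in lborel. 0 < x \<longrightarrow> graph_deriv \<Phi> j x = - (decay_rate \<mu> \<omega> ((norm (\<Phi> j x))\<^sup>2) *\<^sub>R \<Phi> j x)"
          using decay_defect_zero_iff[OF \<mu> graph_H1_components(2,1)[OF H j] less_imp_le[OF b[OF j]]] by (simp add: \<nu>\<omega>)
        have "\<Phi> j x = \<Phi> j 0 / complex_of_real (soliton \<mu> \<omega> z) * complex_of_real (?S x)"
        proof (rule integral_curve_eq_soliton[OF \<mu> r(1) _ graph_H1_components(2,1)[OF H j] _ ode _ x])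
          show "0 < tanh (\<mu> * sqrt \<omega> * z)" using z r by simp
          show "norm (\<Phi> j x) powr (2 * \<mu>) < (\<mu> + 1) * \<omega>" if "0 \<le> x" for x
            using b[OF j that] by (simp add: \<nu>\<omega>)
          show "norm (\<Phi> j 0) = soliton \<mu> \<omega> z"
            using graph_H1_components(3)[OF H j] sa_eq by (simp add: s_def a_def)
        qed
        then show "\<Phi> j x = exp (\<i> * complex_of_real \<theta>) * \<Psi>\<^sub>\<omega> j x"
          using graph_H1_components(3)[OF H j] a by (simp add: \<theta> \<Psi> a_def)
      qed
    qed
  qed
qed

end
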